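(* Assume: (1) $Z$ is independent of $\eta$, the $Z_t$ are i.i.d., and for each $\vartheta\in\Theta$, $t\in\mathbb Z$, $\varphi(Z_t,\vartheta)$ has a density $f(x,\vartheta)$; (2) $\eta$ is a Markov chain and there is $\phi_*>0$ such that $\Pr\{\eta_t=b\mid\eta_s=a\}\ge\phi_*$ for all $a,b\in\mathcal H$ and $s,t\in\mathbb Z$ with $|s-t|\ge1$; (3) for each $z\in\mathcal Z$, $a,b\in\mathcal H$, $0<f(\varphi(z,\theta_a(\varepsilon)),\theta_b(\varepsilon))<\infty$ and this is continuous in $\varepsilon$; (4) there is $q\in\mathbb N$ such that for each $z\in\mathcal Z$, $a,b\in\mathcal H$, $f(\varphi(z,\theta_a(\varepsilon)),\theta_b(\varepsilon))$ as a function of $\varepsilon$ belongs to $C^{(q)}$ and all its partial derivatives of order $\le q$ are continuous in $(z,\varepsilon)$; furthermore, for any $r>0$, $\mathsf E[M_q(Z_0,r)^k]<\infty$, where $k=q^2(q+1)/2$. Then: 1. There are $0<c<C<\infty$ such that almost surely, $c\le\Lambda_{n,a}(\varepsilon)\le C$ for all sufficiently large $n$, all $a\in\mathcal H$ and all $\varepsilon$; thus $$\mathsf E[\ln\mathsf L_a(\varepsilon)\mid\eta]=\lim_{n\to\infty}\mathsf E[\ln\Lambda_{n,a}(\varepsilon)\mid\eta].$$ 2. For every multi-index $\nu$ with $1\le|\nu|\le q$ and every $a\in\mathcal H$, $$\bigl(\mathsf E[\ln\mathsf L_a(\varepsilon)\mid\eta]\bigr)^{(\nu)}=\mathsf E\bigl[(\ln\mathsf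 L_a)^{(\nu)}(\varepsilon)\mid\eta\bigr]=\lim_{n\to\infty}\mathsf E\bigl[(\ln\Lambda_{n,a})^{(\nu)}(\varepsilon)\mid\eta\bigr].$$ Similar results hold for $\Lambda_{-n,a}$ and $\bar{\mathsf L}_a$ (in place of $\Lambda_{n,a}$ and $\mathsf L_a$).
   Context: Multi-index notation: for $h:\mathbb R^s\to\mathbb R$ and $\nu=(\nu_1,\ldots,\nu_s)$ with nonnegative integer entries, $|\nu|=\nu_1+\cdots+\nu_s$, $h^{(\nu)}=\partial^{|\nu|}h/\partial x_1^{\nu_1}\cdots\partial x_s^{\nu_s}$, $h^{(0)}=h$; $h\in C^{(q)}$ means $h^{(\nu)}$ exists and is continuous for every $|\nu|\le q$. Derivatives of random functions of $\varepsilon$ are taken in $\varepsilon$ with the realization of $(\eta,Z)$ fixed. Since $Z$ is independent of $\eta$, $\mathsf E[\,\cdot\mid\eta]$ is understood as integration over $Z$ with $\eta$ fixed. Model: $\mathcal H$ is a finite set partitioned into nonempty subsets $\mathcal H_0$ and $\mathcal H_1$; $\eta=(\eta_t)_{t\in\mathbb Z}$ is an $\mathcal H$-valued process; $Z=(Z_t)_{t\in\mathbb Z}$ takes values in a Euclidean space $\mathcal Z$; $\Theta\subset\mathbb R^d$ is open; $\varphi(\cdot,\vartheta):\mathcal Z\to\mathcal X$, $\vartheta\in\Theta$, is a family of maps into a Euclidean space $\mathcal X$; $\theta_a:\mathbb R^p\to\Theta$, $a\in\mathcal H$, are functions; $\varepsilon\in\mathbb R^p$. With $\ell_{z,ab}(\varepsilon)=\ln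 f(\varphi(z,\theta_a(\varepsilon)),\theta_b(\varepsilon))$: $M_0(z,r)=1$ and, for $k>0$, $M_k(z,r)=\sup\{|\ell_{z,ab}^{(\nu)}(\varepsilon)|: 1\le|\nu|\le k,\ |\varepsilon|\le r,\ a,b\in\mathcal H\}$. Let $\sigma=(\sigma_t)$ be an independent copy of $\eta$, also independent of $Z$; $\mathsf E_\sigma$ is expectation with respect to $\sigma$ ($\eta$, $Z$ held fixed). Let $\psi_t(\varepsilon,c)=f(\varphi(Z_t,\theta_{\eta_t}(\varepsilon)),\theta_c(\varepsilon))$ for $c\in\mathcal H$. Fix an arbitrary $\imath\in\mathcal H$ and define, for $n\ge1$, $$\Lambda_{\pm n,a}(\varepsilon)=\frac{\mathsf E_\sigma[\prod_{s=1}^n\psi_{\pm s}(\varepsilon,\sigma_{\pm s})\mid\sigma_0=a]}{\mathsf E_\sigma[\prod_{s=1}^n\psi_{\pm s}(\varepsilon,\sigma_{\pm s})\mid\sigma_0=\imath]},$$ $\mathsf L_a(\varepsilon)=\lim_{n\to\infty}\Lambda_{n,a}(\varepsilon)$, $\bar{\mathsf L}_a(\varepsilon)=\lim_{n\to\infty}\Lambda_{-n,a}(\varepsilon)$ (almost sure limits, which exist). *)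

theory Defs
  imports "HOL-Probability.Probability"
begin

section \<open>Multi-index derivatives on \<open>\<real>\<^sup>p\<close>\<close>

text \<open>
  The index type carries a linear order, so that the coordinates are \<open>x\<^sub>1, \<dots>, x\<^sub>s\<close>. The mixed
  derivative for \<open>\<nu>\<close> is
  \<open>(\<partial>/\<partial>x\<^sub>1)\<close> applied \<open>\<nu>\<^sub>1\<close> times to \<open>(\<partial>/\<partial>x\<^sub>2)\<close> applied \<open>\<nu>\<^sub>2\<close> times to \<open>\<dots>\<close> \<open>h\<close>.
  As \<^const>\<open>deriv\<close> is total, existence of the derivative is a separate predicate.
\<close>

definition partial_deriv :: "'p::finite \<Rightarrow> (real^'p \<Rightarrow> real) \<Rightarrow> real^'p \<Rightarrow> real" where
  "partial_deriv i h x = deriv (\<lambda>t. h (x + t *\<^sub>R axis i 1)) 0"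

definition partial_deriv_exists :: "'p::finite \<Rightarrow> (real^'p \<Rightarrow> real) \<Rightarrow> real^'p \<Rightarrow> bool" where
  "partial_deriv_exists i h x \<longleftrightarrow> (\<lambda>t. h (x + t *\<^sub>R axis i 1)) differentiable (at 0)"

primrec iter_partial :: "'p::finite list \<Rightarrow> (real^'p \<Rightarrow> real) \<Rightarrow> real^'p \<Rightarrow> real" where
  "iter_partial [] h = h"
| "iter_partial (i # is) h = partial_deriv i (iter_partial is h)"

primrec iter_partial_exists :: "'p::finite list \<Rightarrow> (real^'p \<Rightarrow> real) \<Rightarrow> bool" where
  "iter_partial_exists [] h \<longleftrightarrow> True"
| "iter_partial_exists (i # is) h \<longleftrightarrow>
     iter_partial_exists is h \<and> (\<forall>x. partial_deriv_exists i (iter_partial is h) x)"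

definition mi_list :: "('p::{finite,linorder} \<Rightarrow> nat) \<Rightarrow> 'p::{finite,linorder} list" where
  "mi_list \<nu> = concat (map (\<lambda>i. replicate (\<nu> i) i) (sorted_list_of_set UNIV))"

definition mi_order :: "('p::finite \<Rightarrow> nat) \<Rightarrow> nat" where
  "mi_order \<nu> = (\<Sum>i\<in>UNIV. \<nu> i)"

definition mderiv :: "('p::{finite,linorder} \<Rightarrow> nat) \<Rightarrow> (real^'p::{finite,linorder} \<Rightarrow> real) \<Rightarrow> real^'p::{finite,linorder} \<Rightarrow> real" where
  "mderiv \<nu> h = iter_partial (mi_list \<nu>) h"

definition mderiv_exists :: "('p::{finite,linorder} \<Rightarrow> nat) \<Rightarrow> (real^'p::{finite,linorder} \<Rightarrow> real) \<Rightarrow> bool" where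
  "mderiv_exists \<nu> h \<longleftrightarrow> iter_partial_exists (mi_list \<nu>) h"

definition class_C :: "nat \<Rightarrow> (real^'p::{finite,linorder} \<Rightarrow> real) \<Rightarrow> bool" where
  "class_C q h \<longleftrightarrow>
     (\<forall>\<nu>. mi_order \<nu> \<le> q \<longrightarrow> mderiv_exists \<nu> h \<and> continuous_on UNIV (mderiv \<nu> h))"


section \<open>The model\<close>

text \<open>
  Independence of two random elements; unlike for \<^const>\<open>prob_space.indep_var\<close>, their values may
  be of different types.
\<close>

definition indep_rv ::
  "'w measure \<Rightarrow> 'a measure \<Rightarrow> ('w \<Rightarrow> 'a) \<Rightarrow> 'b measure \<Rightarrow> ('w \<Rightarrow> 'b) \<Rightarrow> bool" where
  "indep_rv M N X N' Y \<longleftrightarrow>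
     X \<in> measurable M N \<and> Y \<in> measurable M N' \<and>
     prob_space.indep_set M {X -` A \<inter> space M | A. A \<in> sets N} {Y -` B \<inter> space M | B. B \<in> sets N'}"

text \<open>Markov property of a (possibly inhomogeneous) chain on a finite state space indexed by \<open>\<int>\<close>.\<close>

definition markov_chain :: "'w measure \<Rightarrow> (int \<Rightarrow> 'w \<Rightarrow> 'h) \<Rightarrow> bool" where
  "markov_chain M X \<longleftrightarrow>
     (\<forall>t (m::nat) b x.
        measure M {\<omega>\<in>space M. \<forall>s\<in>{t - int m..t}. X s \<omega> = x s} > 0 \<longrightarrow>
        \<P>(\<omega> in M. X (t + 1) \<omega> = b \<bar> \<forall>s\<in>{t - int m..t}. X s \<omega> = x s) =
        \<P>(\<omega> in M. X (t + 1) \<omega> = b \<bar> X t \<omega> = x t))"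

definition cond_expect :: "'w measure \<Rightarrow> ('w \<Rightarrow> real) \<Rightarrow> ('w \<Rightarrow> bool) \<Rightarrow> real" where
  "cond_expect M X P =
     (LINT \<omega>:{\<omega>\<in>space M. P \<omega>}|M. X \<omega>) / measure M {\<omega>\<in>space M. P \<omega>}"

text \<open>
  Densities take values in \<open>[0,\<infinity>]\<close>; \<open>lik f \<phi> \<theta> z a b \<epsilon>\<close> is the number
  \<open>f(\<phi>(z, \<theta>\<^sub>a(\<epsilon>)), \<theta>\<^sub>b(\<epsilon>))\<close>, which the theorem assumes to be finite and positive.
\<close>

definition lik ::
  "('x \<Rightarrow> 'd \<Rightarrow> ennreal) \<Rightarrow> ('z \<Rightarrow> 'd \<Rightarrow> 'x) \<Rightarrow> ('h \<Rightarrow> 'e \<Rightarrow> 'd) \<Rightarrow> 'z \<Rightarrow> 'h \<Rightarrow> 'h \<Rightarrow> 'e \<Rightarrow> real" where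
  "lik f \<phi> \<theta> z a b \<epsilon> = enn2real (f (\<phi> z (\<theta> a \<epsilon>)) (\<theta> b \<epsilon>))"

definition loglik ::
  "('x \<Rightarrow> 'd \<Rightarrow> ennreal) \<Rightarrow> ('z \<Rightarrow> 'd \<Rightarrow> 'x) \<Rightarrow> ('h \<Rightarrow> 'e \<Rightarrow> 'd) \<Rightarrow> 'z \<Rightarrow> 'h \<Rightarrow> 'h \<Rightarrow> 'e \<Rightarrow> real" where
  "loglik f \<phi> \<theta> z a b \<epsilon> = ln (lik f \<phi> \<theta> z a b \<epsilon>)"

text \<open>The supremum \<open>M\<^sub>k(z,r)\<close>, taken in \<open>[0,\<infinity>]\<close>.\<close>

definition deriv_sup ::
  "('x \<Rightarrow> 'd \<Rightarrow> ennreal) \<Rightarrow> ('z \<Rightarrow> 'd \<Rightarrow> 'x) \<Rightarrow> ('h \<Rightarrow> real^'p::{finite,linorder} \<Rightarrow> 'd) \<Rightarrow>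
    nat \<Rightarrow> 'z \<Rightarrow> real \<Rightarrow> ennreal" where
  "deriv_sup f \<phi> \<theta> k z r =
     (if k = 0 then 1
      else Sup {ennreal \<bar>mderiv \<nu> (loglik f \<phi> \<theta> z a b) \<epsilon>\<bar> | \<nu> \<epsilon> a b.
                  1 \<le> mi_order \<nu> \<and> mi_order \<nu> \<le> k \<and> norm \<epsilon> \<le> r})"

text \<open>
  From here on \<open>h\<close> and \<open>z\<close> denote realizations of \<open>\<eta>\<close> and \<open>Z\<close>, which are held fixed when
  integrating over \<open>\<sigma>\<close> or differentiating in \<open>\<epsilon>\<close>.
\<close>

definition psi ::
  "('x \<Rightarrow> 'd \<Rightarrow> ennreal) \<Rightarrow> ('z \<Rightarrow> 'd \<Rightarrow> 'x) \<Rightarrow> ('h \<Rightarrow> 'e \<Rightarrow> 'd) \<Rightarrow>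
    (int \<Rightarrow> 'h) \<Rightarrow> (int \<Rightarrow> 'z) \<Rightarrow> int \<Rightarrow> 'e \<Rightarrow> 'h \<Rightarrow> real" where
  "psi f \<phi> \<theta> h z t \<epsilon> c = lik f \<phi> \<theta> (z t) (h t) c \<epsilon>"

text \<open>
  The argument \<open>u \<in> {1, -1}\<close> is the direction of time: \<open>Lambda \<dots> u h z n a\<close> is
  \<open>\<Lambda>\<^bsub>n,a\<^esub>\<close> for \<open>u = 1\<close> and \<open>\<Lambda>\<^bsub>-n,a\<^esub>\<close> for \<open>u = -1\<close>;
  likewise \<open>Lambda_lim\<close> is \<open>L\<^sub>a\<close> for \<open>u = 1\<close> and its barred version for \<open>u = -1\<close>.
\<close>

definition Lambda ::
  "'w measure \<Rightarrow> (int \<Rightarrow> 'w \<Rightarrow> 'h) \<Rightarrow> ('x \<Rightarrow> 'd \<Rightarrow> ennreal) \<Rightarrow> ('z \<Rightarrow> 'd \<Rightarrow> 'x) \<Rightarrow>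
    ('h \<Rightarrow> 'e \<Rightarrow> 'd) \<Rightarrow> 'h \<Rightarrow> int \<Rightarrow> (int \<Rightarrow> 'h) \<Rightarrow> (int \<Rightarrow> 'z) \<Rightarrow> nat \<Rightarrow> 'h \<Rightarrow> 'e \<Rightarrow> real" where
  "Lambda M \<sigma> f \<phi> \<theta> \<iota> u h z n a \<epsilon> =
     cond_expect M (\<lambda>\<omega>. \<Prod>s=1..n. psi f \<phi> \<theta> h z (u * int s) \<epsilon> (\<sigma> (u * int s) \<omega>)) (\<lambda>\<omega>. \<sigma> 0 \<omega> = a) /
     cond_expect M (\<lambda>\<omega>. \<Prod>s=1..n. psi f \<phi> \<theta> h z (u * int s) \<epsilon> (\<sigma> (u * int s) \<omega>)) (\<lambda>\<omega>. \<sigma> 0 \<omega> = \<iota>)"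

definition Lambda_lim ::
  "'w measure \<Rightarrow> (int \<Rightarrow> 'w \<Rightarrow> 'h) \<Rightarrow> ('x \<Rightarrow> 'd \<Rightarrow> ennreal) \<Rightarrow> ('z \<Rightarrow> 'd \<Rightarrow> 'x) \<Rightarrow>
    ('h \<Rightarrow> 'e \<Rightarrow> 'd) \<Rightarrow> 'h \<Rightarrow> int \<Rightarrow> (int \<Rightarrow> 'h) \<Rightarrow> (int \<Rightarrow> 'z) \<Rightarrow> 'h \<Rightarrow> 'e \<Rightarrow> real" where
  "Lambda_lim M \<sigma> f \<phi> \<theta> \<iota> u h z a \<epsilon> = lim (\<lambda>n. Lambda M \<sigma> f \<phi> \<theta> \<iota> u h z n a \<epsilon>)"

text \<open>
  Conditional expectation given \<open>\<eta>\<close>: integration over \<open>Z\<close>, the realization of \<open>\<eta>\<close> being already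
  plugged into \<open>G\<close>. Derivatives of \<open>ln L\<^sub>a\<close> exist only for almost every realization of \<open>Z\<close>;
  integrating with respect to the completion makes the values of \<open>G\<close> on a null set irrelevant even
  for measurability, and agrees with the integral over \<open>M\<close> for measurable integrands.
\<close>

definition expect_Z :: "'w measure \<Rightarrow> (int \<Rightarrow> 'w \<Rightarrow> 'z) \<Rightarrow> ((int \<Rightarrow> 'z) \<Rightarrow> real) \<Rightarrow> real" where
  "expect_Z M Z G = (LINT \<omega>|completion M. G (\<lambda>t. Z t \<omega>))"

definition integrable_Z :: "'w measure \<Rightarrow> (int \<Rightarrow> 'w \<Rightarrow> 'z) \<Rightarrow> ((int \<Rightarrow> 'z) \<Rightarrow> real) \<Rightarrow> bool" where
  "integrable_Z M Z G \<longleftrightarrow> integrable (completion M) (\<lambda>\<omega>. G (\<lambda>t. Z t \<omega>))"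

end

theory Submission
  imports Defs
begin

text \<open>
  Fix a realization and a direction of time. By the Markov property, which holds in both
  directions, \<open>ln \<Lambda>\<^sub>n\<^sub>,\<^sub>a\<close> is the value \<open>u\<^sub>0(a)\<close> of a backward recursion: \<open>u\<^sub>n = 0\<close>, and \<open>u\<^sub>s(a)\<close> is the
  logarithm of \<open>\<Sum>\<^sub>b P\<^sub>s(a,b) exp (l\<^sub>s\<^sub>+\<^sub>1(b) + u\<^sub>s\<^sub>+\<^sub>1(b))\<close>, normalised by subtracting the same expression
  for the reference state; here \<open>P\<^sub>s\<close> are transition probabilities of the chain and \<open>l\<^sub>s(b)\<close> the
  log-likelihoods (\<open>Lambda_eq_exp_logback\<close>). The gradient of such a logarithm is a vector of Gibbs
  weights. As \<open>\<phi> \<le> P\<^sub>s(a,b) \<le> 1\<close>, these weights dominate \<open>\<phi>\<close> times a probability vector that is the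
  same for all \<open>a\<close>, so the differences over \<open>a\<close> of averages shrink the oscillation of the averaged
  function by the factor \<open>1 - \<phi>\<close> (\<open>gibbs_average_osc\<close>). Hence \<open>ln \<Lambda>\<^sub>n\<^sub>,\<^sub>a\<close> lies between \<open>ln \<phi>\<close> and \<open>- ln \<phi>\<close>
  and converges at the rate \<open>(1 - \<phi>)\<^sup>n\<close> for every realization; bounded convergence gives the first
  claim.

  For the derivatives, differentiate the recursion. The derivatives of the highest order \<open>k\<close> enter
  linearly, with Gibbs weights as coefficients, hence they are contracted; what is left over is a
  polynomial in derivatives of lower order, homogeneous of degree \<open>k\<close> when a derivative of order \<open>i\<close>
  counts with degree \<open>i\<close> (\<open>lse_remainder_bound\<close>). If the derivatives of \<open>l\<^sub>t\<close> are at most \<open>g / \<kappa>\<^sup>t\<close> for some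
  \<open>g \<ge> 1\<close> and some \<open>\<kappa> < 1\<close>, homogeneity suggests the bound \<open>C (g / \<kappa>\<^sup>s)\<^sup>k\<close> for the derivatives of order
  \<open>k\<close> of \<open>u\<^sub>s\<close>. Passing from \<open>s + 1\<close> to \<open>s\<close> contracts by \<open>1 - \<phi>\<close> while the bound decreases only by \<open>\<kappa>\<^sup>k\<close>, so
  for \<open>\<kappa>\<close> close to \<open>1\<close> the bound reproduces itself once \<open>C\<close> absorbs the lower orders
  (\<open>logback_deriv_bound\<close>). The difference of the recursions with horizons \<open>n\<close> and \<open>n + 1\<close> obeys the
  same kind of inequality and gains a factor \<open>\<tau>\<^sup>n\<close> with \<open>\<tau> < 1\<close> (\<open>logback_deriv_step_bound\<close>).

  The constants do not depend on the realization. So, up to order \<open>q\<close>, the derivatives of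
  \<open>ln \<Lambda>\<^sub>n\<^sub>,\<^sub>a\<close> converge uniformly on each ball, and they are dominated there by a multiple of \<open>g\<^sup>q\<close>. The
  variable \<open>g\<^sup>q\<close> can be taken as the maximum of \<open>1\<close> and \<open>\<Sum>\<^sub>t (\<kappa>\<^sup>t M\<^sub>q(Z\<^sub>t, r))\<^sup>q\<close>, which is integrable since
  \<open>q \<le> q\<^sup>2(q+1)/2\<close> (\<open>dominating_variable\<close>). Uniform convergence allows differentiating the limit, and
  domination allows differentiating under the expectation and passing to the limit in it
  (\<open>limit_derivatives_expectation\<close>).
\<close>

section \<open>Iterated partial derivatives along sorted index lists\<close>

lemma partial_deriv_has_derivative:
  assumes "partial_deriv_exists i g x"
  shows "((\<lambda>t. g (x + t *\<^sub>R axis i 1)) has_real_derivative partial_deriv i g x) (at 0)"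
  using assms unfolding partial_deriv_exists_def partial_deriv_def
  by (simp add: DERIV_deriv_iff_real_differentiable)

lemma partial_derivI:
  assumes "((\<lambda>t. g (x + t *\<^sub>R axis i 1)) has_real_derivative d) (at 0)"
  shows "partial_deriv_exists i g x" "partial_deriv i g x = d"
  using assms unfolding partial_deriv_exists_def partial_deriv_def
  by (auto simp: real_differentiable_def intro: DERIV_imp_deriv)

lemma iter_partial_append: "iter_partial (I @ J) g = iter_partial I (iter_partial J g)"
  by (induction I) auto

lemma iter_partial_exists_append:
  "iter_partial_exists (I @ J) g \<longleftrightarrow> iter_partial_exists J g \<and> iter_partial_exists I (iter_partial J g)"
  by (induction I) (auto simp: iter_partial_append)

lemma iter_partial_add:
  assumes "iter_partial_exists I f" "iter_partial_exists I g"
  shows "iter_partial_exists I (\<lambda>x. f x + g x)"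
    and "iter_partial I (\<lambda>x. f x + g x) = (\<lambda>x. iter_partial I f x + iter_partial I g x)"
proof -
  have "iter_partial_exists I (\<lambda>x. f x + g x) \<and>
        iter_partial I (\<lambda>x. f x + g x) = (\<lambda>x. iter_partial I f x + iter_partial I g x)"
    using assms
  proof (induction I)
    case (Cons i I)
    have D: "((\<lambda>t. iter_partial I f (x + t *\<^sub>R axis i 1) + iter_partial I g (x + t *\<^sub>R axis i 1))
        has_real_derivative partial_deriv i (iter_partial I f) x + partial_deriv i (iter_partial I g) x) (at 0)" for x
      using Cons.prems by (intro DERIV_add partial_deriv_has_derivative) auto
    show ?case using Cons partial_derivI[OF D] by auto
  qed auto
  then show "iter_partial_exists I (\<lambda>x. f x + g x)"
    and "iter_partial I (\<lambda>x. f x + g x) = (\<lambda>x. iter_partial I f x + iter_partial I g x)" by auto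
qed

lemma iter_partial_const:
  shows "iter_partial_exists I (\<lambda>x. c)"
    and "iter_partial I (\<lambda>x. c) = (if I = [] then (\<lambda>x. c) else (\<lambda>x. 0))"
proof -
  have "iter_partial_exists I (\<lambda>x. c) \<and> iter_partial I (\<lambda>x. c) = (if I = [] then (\<lambda>x. c) else (\<lambda>x. 0))"
  proof (induction I)
    case (Cons i I)
    have D: "((\<lambda>t. (if I = [] then (\<lambda>x. c) else (\<lambda>x. 0)) (x + t *\<^sub>R axis i 1)) has_real_derivative 0) (at 0)" for x
      by (cases I) auto
    show ?case using Cons partial_derivI[OF D] by auto
  qed auto
  then show "iter_partial_exists I (\<lambda>x. c)"
    and "iter_partial I (\<lambda>x. c) = (if I = [] then (\<lambda>x. c) else (\<lambda>x. 0))" by auto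
qed

lemma iter_partial_minus:
  assumes "iter_partial_exists I f"
  shows "iter_partial_exists I (\<lambda>x. - f x)"
    and "iter_partial I (\<lambda>x. - f x) = (\<lambda>x. - iter_partial I f x)"
proof -
  have "iter_partial_exists I (\<lambda>x. - f x) \<and> iter_partial I (\<lambda>x. - f x) = (\<lambda>x. - iter_partial I f x)"
    using assms
  proof (induction I)
    case (Cons i I)
    have D: "((\<lambda>t. - iter_partial I f (x + t *\<^sub>R axis i 1))
        has_real_derivative - partial_deriv i (iter_partial I f) x) (at 0)" for x
      using Cons.prems by (intro DERIV_minus partial_deriv_has_derivative) auto
    show ?case using Cons partial_derivI[OF D] by auto
  qed auto
  then show "iter_partial_exists I (\<lambda>x. - f x)"
    and "iter_partial I (\<lambda>x. - f x) = (\<lambda>x. - iter_partial I f x)" by auto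
qed

lemma iter_partial_diff:
  assumes "iter_partial_exists I f" "iter_partial_exists I g"
  shows "iter_partial_exists I (\<lambda>x. f x - g x)"
    and "iter_partial I (\<lambda>x. f x - g x) = (\<lambda>x. iter_partial I f x - iter_partial I g x)"
  using iter_partial_add[OF assms(1) iter_partial_minus(1)[OF assms(2)]] iter_partial_minus[OF assms(2)]
  by auto

lemma iter_partial_sum:
  assumes "finite A" "\<And>b. b \<in> A \<Longrightarrow> iter_partial_exists I (f b)"
  shows "iter_partial_exists I (\<lambda>x. \<Sum>b\<in>A. f b x)"
    and "iter_partial I (\<lambda>x. \<Sum>b\<in>A. f b x) = (\<lambda>x. \<Sum>b\<in>A. iter_partial I (f b) x)"
proof -
  have "iter_partial_exists I (\<lambda>x. \<Sum>b\<in>A. f b x) \<and>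
      iter_partial I (\<lambda>x. \<Sum>b\<in>A. f b x) = (\<lambda>x. \<Sum>b\<in>A. iter_partial I (f b) x)"
    using assms
    by (induction A rule: finite_induct) (auto simp: iter_partial_const iter_partial_add)
  then show "iter_partial_exists I (\<lambda>x. \<Sum>b\<in>A. f b x)"
    and "iter_partial I (\<lambda>x. \<Sum>b\<in>A. f b x) = (\<lambda>x. \<Sum>b\<in>A. iter_partial I (f b) x)" by auto
qed

text \<open>
  The index lists are those of the multi-index derivatives: sorted, with the outermost derivative
  at the head. Such a list can be taken apart at its innermost coordinate \<open>i\<close>, and what remains is a
  sorted list over the coordinates up to \<open>i\<close>; the set \<open>S\<close> of admissible coordinates makes inductions
  along this decomposition possible.
\<close>

definition smooth :: "nat \<Rightarrow> 'p::{finite,linorder} set \<Rightarrow> ((real, 'p::{finite,linorder}) vec \<Rightarrow> real) \<Rightarrow> bool" where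
  "smooth k S g \<longleftrightarrow> (\<forall>I. sorted I \<longrightarrow> length I \<le> k \<longrightarrow> set I \<subseteq> S \<longrightarrow> iter_partial_exists I g)"

lemma smoothD: "smooth k S g \<Longrightarrow> sorted I \<Longrightarrow> length I \<le> k \<Longrightarrow> set I \<subseteq> S \<Longrightarrow> iter_partial_exists I g"
  by (auto simp: smooth_def)

lemma smooth_mono: "smooth k S g \<Longrightarrow> k' \<le> k \<Longrightarrow> S' \<subseteq> S \<Longrightarrow> smooth k' S' g"
  unfolding smooth_def by (meson order_trans subset_trans)

lemma smooth_0 [simp]: "smooth 0 S g"
  by (auto simp: smooth_def)

lemma sorted_snoc_iff: "sorted (J @ [i]) \<longleftrightarrow> sorted J \<and> set J \<subseteq> {..i}"
  by (auto simp: sorted_append)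

lemma smooth_Suc:
  "smooth (Suc k) S g \<longleftrightarrow>
     (\<forall>i\<in>S. (\<forall>x. partial_deriv_exists i g x) \<and> smooth k (S \<inter> {..i}) (partial_deriv i g))"
  (is "?L = ?R")
proof
  assume L: ?L
  show ?R
  proof
    fix i assume i: "i \<in> S"
    have "iter_partial_exists [i] g" using L i by (intro smoothD[OF L]) auto
    moreover have "smooth k (S \<inter> {..i}) (partial_deriv i g)"
      unfolding smooth_def
    proof (intro allI impI)
      fix J assume J: "sorted J" "length J \<le> k" "set J \<subseteq> S \<inter> {..i}"
      have "iter_partial_exists (J @ [i]) g"
        using J i by (intro smoothD[OF L]) (auto simp: sorted_snoc_iff)
      then show "iter_partial_exists J (partial_deriv i g)"
        by (simp add: iter_partial_exists_append)
    qed
    ultimately show "(\<forall>x. partial_deriv_exists i g x) \<and> smooth k (S \<inter> {..i}) (partial_deriv i g)"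
      by simp
  qed
next
  assume R: ?R
  show ?L unfolding smooth_def
  proof (intro allI impI)
    fix I assume I: "sorted I" "length I \<le> Suc k" "set I \<subseteq> S"
    show "iter_partial_exists I g"
    proof (cases I rule: rev_cases)
      case (snoc J i)
      have "iter_partial_exists J (partial_deriv i g)" "\<forall>x. partial_deriv_exists i g x"
        using R I snoc by (auto intro!: smoothD[of k "S \<inter> {..i}"] simp: sorted_snoc_iff)
      then show ?thesis by (simp add: snoc iter_partial_exists_append)
    qed simp
  qed
qed

lemma smooth_add: "smooth k S f \<Longrightarrow> smooth k S g \<Longrightarrow> smooth k S (\<lambda>x. f x + g x)"
  unfolding smooth_def using iter_partial_add(1) by blast

lemma smooth_diff: "smooth k S f \<Longrightarrow> smooth k S g \<Longrightarrow> smooth k S (\<lambda>x. f x - g x)"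
  unfolding smooth_def using iter_partial_diff(1) by blast

lemma smooth_const: "smooth k S (\<lambda>x. c)"
  unfolding smooth_def using iter_partial_const(1) by blast

lemma smooth_sum:
  "finite A \<Longrightarrow> (\<And>b. b \<in> A \<Longrightarrow> smooth k S (f b)) \<Longrightarrow> smooth k S (\<lambda>x. \<Sum>b\<in>A. f b x)"
  unfolding smooth_def using iter_partial_sum(1)[of A _ f] by blast

lemma partial_deriv_mult:
  assumes "\<And>x. partial_deriv_exists i f x" "\<And>x. partial_deriv_exists i g x"
  shows "partial_deriv_exists i (\<lambda>x. f x * g x) x"
    and "partial_deriv i (\<lambda>x. f x * g x) = (\<lambda>x. partial_deriv i f x * g x + f x * partial_deriv i g x)"
proof -
  have D: "((\<lambda>t. f (x + t *\<^sub>R axis i 1) * g (x + t *\<^sub>R axis i 1)) has_real_derivative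
      partial_deriv i f x * g x + f x * partial_deriv i g x) (at 0)" for x
    using DERIV_mult[OF partial_deriv_has_derivative[OF assms(1)[of x]]
      partial_deriv_has_derivative[OF assms(2)[of x]]] by (simp add: algebra_simps)
  show "partial_deriv_exists i (\<lambda>x. f x * g x) x" by (rule partial_derivI(1)[OF D])
  show "partial_deriv i (\<lambda>x. f x * g x) = (\<lambda>x. partial_deriv i f x * g x + f x * partial_deriv i g x)"
    using partial_derivI(2)[OF D] by auto
qed

lemma smooth_mult: "smooth k S f \<Longrightarrow> smooth k S g \<Longrightarrow> smooth k S (\<lambda>x. f x * g x)"
proof (induction k arbitrary: S f g)
  case (Suc k)
  show ?case unfolding smooth_Suc
  proof (intro ballI conjI allI)
    fix i x assume i: "i \<in> S"
    have ex: "\<And>x. partial_deriv_exists i f x" "\<And>x. partial_deriv_exists i g x"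
      using Suc.prems i by (auto simp: smooth_Suc)
    show "partial_deriv_exists i (\<lambda>x. f x * g x) x" by (rule partial_deriv_mult(1)[OF ex])
    show "smooth k (S \<inter> {..i}) (partial_deriv i (\<lambda>x. f x * g x))"
      unfolding partial_deriv_mult(2)[OF ex]
      using Suc.prems i
      by (intro smooth_add Suc.IH) (auto simp: smooth_Suc intro: smooth_mono[OF Suc.prems(1)] smooth_mono[OF Suc.prems(2)])
  qed
qed simp

lemma smooth_minus: "smooth k S f \<Longrightarrow> smooth k S (\<lambda>x. - f x)"
  unfolding smooth_def using iter_partial_minus(1) by blast

lemma sorted_concat_replicate:
  "sorted xs \<Longrightarrow> sorted (concat (map (\<lambda>i. replicate (\<nu> i) i) xs))"
  by (induction xs) (auto simp: sorted_append)

lemma sorted_mi_list: "sorted (mi_list \<nu>)"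
  unfolding mi_list_def by (intro sorted_concat_replicate) simp

lemma length_mi_list: "length (mi_list \<nu>) = mi_order \<nu>"
  by (simp add: mi_list_def mi_order_def length_concat o_def sum_list_distinct_conv_sum_set)

lemma count_concat_replicate:
  "distinct xs \<Longrightarrow> count (mset (concat (map (\<lambda>i. replicate (\<nu> i) i) xs))) j = (if j \<in> set xs then \<nu> j else 0)"
  by (induction xs) auto

text \<open>
  Sorted lists and multi-indices are the same thing.
\<close>

lemma mi_list_count:
  assumes "sorted I"
  shows "mi_list (count (mset I)) = I"
proof -
  have "mset (mi_list (count (mset I))) = mset I"
    by (rule multiset_eqI) (simp add: mi_list_def count_concat_replicate del: count_mset)
  then show ?thesis
    using properties_for_sort[of "mi_list (count (mset I))" I] properties_for_sort[of I I] assms sorted_mi_list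
    by metis
qed

definition cont_smooth :: "nat \<Rightarrow> 'p::{finite,linorder} set \<Rightarrow> ((real, 'p::{finite,linorder}) vec \<Rightarrow> real) \<Rightarrow> bool" where
  "cont_smooth k S g \<longleftrightarrow> (\<forall>I. sorted I \<longrightarrow> length I \<le> k \<longrightarrow> set I \<subseteq> S \<longrightarrow>
      iter_partial_exists I g \<and> continuous_on UNIV (iter_partial I g))"

lemma class_C_iff: "class_C q h \<longleftrightarrow> cont_smooth q UNIV h"
proof
  assume L: "class_C q h"
  show "cont_smooth q UNIV h" unfolding cont_smooth_def
  proof (intro allI impI)
    fix I :: "'a list" assume I: "sorted I" "length I \<le> q"
    then have "mi_order (count (mset I)) \<le> q" using length_mi_list[of "count (mset I)"] by (simp add: mi_list_count)
    then show "iter_partial_exists I h \<and> continuous_on UNIV (iter_partial I h)"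
      using L unfolding class_C_def mderiv_exists_def mderiv_def
      by (elim allE[of _ "count (mset I)"]) (simp add: mi_list_count I)
  qed
next
  assume "cont_smooth q UNIV h"
  then show "class_C q h"
    unfolding class_C_def mderiv_exists_def mderiv_def cont_smooth_def
    by (simp add: sorted_mi_list length_mi_list)
qed

lemma cont_smoothD:
  assumes "cont_smooth k S g" "sorted I" "length I \<le> k" "set I \<subseteq> S"
  shows "iter_partial_exists I g" "continuous_on UNIV (iter_partial I g)"
  using assms unfolding cont_smooth_def by auto

lemma cont_smooth_imp_smooth: "cont_smooth k S g \<Longrightarrow> smooth k S g"
  unfolding cont_smooth_def smooth_def by blast

lemma cont_smooth_mono: "cont_smooth k S g \<Longrightarrow> k' \<le> k \<Longrightarrow> S' \<subseteq> S \<Longrightarrow> cont_smooth k' S' g"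
  unfolding cont_smooth_def by (meson order_trans subset_trans)

lemma cont_smooth_0: "cont_smooth 0 S g \<longleftrightarrow> continuous_on UNIV g"
  unfolding cont_smooth_def by auto

lemma cont_smooth_Suc:
  "cont_smooth (Suc k) S g \<longleftrightarrow> continuous_on UNIV g \<and>
     (\<forall>i\<in>S. (\<forall>x. partial_deriv_exists i g x) \<and> cont_smooth k (S \<inter> {..i}) (partial_deriv i g))"
  (is "?L = ?R")
proof
  assume L: ?L
  have "continuous_on UNIV g" using cont_smoothD[OF L, of "[]"] by simp
  moreover have "(\<forall>x. partial_deriv_exists i g x) \<and> cont_smooth k (S \<inter> {..i}) (partial_deriv i g)" if i: "i \<in> S" for i
  proof
    show "\<forall>x. partial_deriv_exists i g x" using cont_smoothD[OF L, of "[i]"] i by simp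
    show "cont_smooth k (S \<inter> {..i}) (partial_deriv i g)"
      unfolding cont_smooth_def
    proof (intro allI impI)
      fix J assume J: "sorted J" "length J \<le> k" "set J \<subseteq> S \<inter> {..i}"
      have "iter_partial_exists (J @ [i]) g" "continuous_on UNIV (iter_partial (J @ [i]) g)"
        by (rule cont_smoothD[OF L]; use J i in \<open>auto simp: sorted_snoc_iff\<close>)+
      then show "iter_partial_exists J (partial_deriv i g) \<and> continuous_on UNIV (iter_partial J (partial_deriv i g))"
        by (simp add: iter_partial_exists_append iter_partial_append)
    qed
  qed
  ultimately show ?R by blast
next
  assume R: ?R
  show ?L unfolding cont_smooth_def
  proof (intro allI impI)
    fix I assume I: "sorted I" "length I \<le> Suc k" "set I \<subseteq> S"
    show "iter_partial_exists I g \<and> continuous_on UNIV (iter_partial I g)"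
    proof (cases I rule: rev_cases)
      case (snoc J i)
      have "cont_smooth k (S \<inter> {..i}) (partial_deriv i g)" "\<forall>x. partial_deriv_exists i g x"
        using R I snoc by auto
      then show ?thesis using I snoc cont_smoothD[of k "S \<inter> {..i}" "partial_deriv i g" J]
        by (auto simp: snoc iter_partial_exists_append iter_partial_append sorted_snoc_iff)
    qed (use R in simp)
  qed
qed

lemma cont_smooth_continuous: "cont_smooth k S g \<Longrightarrow> continuous_on UNIV g"
  using cont_smoothD(2)[of k S g "[]"] by simp

lemma cont_smooth_add: "cont_smooth k S f \<Longrightarrow> cont_smooth k S g \<Longrightarrow> cont_smooth k S (\<lambda>x. f x + g x)"
  unfolding cont_smooth_def by (auto simp: iter_partial_add intro!: continuous_intros)

lemma cont_smooth_minus: "cont_smooth k S f \<Longrightarrow> cont_smooth k S (\<lambda>x. - f x)"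
  unfolding cont_smooth_def by (auto simp: iter_partial_minus intro!: continuous_intros)

lemma cont_smooth_mult: "cont_smooth k S f \<Longrightarrow> cont_smooth k S g \<Longrightarrow> cont_smooth k S (\<lambda>x. f x * g x)"
proof (induction k arbitrary: S f g)
  case 0
  then show ?case by (auto simp: cont_smooth_0 intro!: continuous_intros)
next
  case (Suc k)
  show ?case unfolding cont_smooth_Suc
  proof (intro ballI conjI allI)
    show "continuous_on UNIV (\<lambda>x. f x * g x)"
      using Suc.prems[THEN cont_smooth_continuous] by (intro continuous_intros)
    fix i x assume i: "i \<in> S"
    have ex: "\<And>x. partial_deriv_exists i f x" "\<And>x. partial_deriv_exists i g x"
      using Suc.prems i by (auto simp: cont_smooth_Suc)
    show "partial_deriv_exists i (\<lambda>x. f x * g x) x" by (rule partial_deriv_mult(1)[OF ex])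
    show "cont_smooth k (S \<inter> {..i}) (partial_deriv i (\<lambda>x. f x * g x))"
      unfolding partial_deriv_mult(2)[OF ex]
      using Suc.prems i
      by (intro cont_smooth_add Suc.IH)
        (auto simp: cont_smooth_Suc intro: cont_smooth_mono[OF Suc.prems(1)] cont_smooth_mono[OF Suc.prems(2)])
  qed
qed

lemma cont_smooth_inverse:
  assumes pos: "\<And>x. 0 < h x"
  shows "cont_smooth k S h \<Longrightarrow> cont_smooth k S (\<lambda>x. inverse (h x))"
proof (induction k arbitrary: S)
  case 0
  then show ?case using pos by (auto simp: cont_smooth_0 less_le intro!: continuous_intros)
next
  case (Suc k)
  show ?case unfolding cont_smooth_Suc
  proof (intro ballI conjI allI)
    show "continuous_on UNIV (\<lambda>x. inverse (h x))"
      using Suc.prems[THEN cont_smooth_continuous] pos by (auto simp: less_le intro!: continuous_intros)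
    fix i x assume i: "i \<in> S"
    have ex: "\<And>x. partial_deriv_exists i h x" and sm: "cont_smooth k (S \<inter> {..i}) (partial_deriv i h)"
      using Suc.prems i by (auto simp: cont_smooth_Suc)
    have D: "((\<lambda>t. inverse (h (x + t *\<^sub>R axis i 1))) has_real_derivative
        - (inverse (h x) * partial_deriv i h x * inverse (h x))) (at 0)" for x
      using DERIV_inverse'[OF partial_deriv_has_derivative[OF ex[of x]]] pos[of x] by simp
    show "partial_deriv_exists i (\<lambda>x. inverse (h x)) x" by (rule partial_derivI(1)[OF D])
    have "partial_deriv i (\<lambda>x. inverse (h x)) = (\<lambda>x. - (inverse (h x) * partial_deriv i h x * inverse (h x)))"
      using partial_derivI(2)[OF D] by auto
    moreover have "cont_smooth k (S \<inter> {..i}) (\<lambda>x. inverse (h x))"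
      by (intro Suc.IH cont_smooth_mono[OF Suc.prems]) auto
    ultimately show "cont_smooth k (S \<inter> {..i}) (partial_deriv i (\<lambda>x. inverse (h x)))"
      using sm by (auto intro!: cont_smooth_minus cont_smooth_mult)
  qed
qed

lemma cont_smooth_ln:
  assumes pos: "\<And>x. 0 < h x" and h: "cont_smooth k S h"
  shows "cont_smooth k S (\<lambda>x. ln (h x))"
proof -
  have cont: "continuous_on UNIV (\<lambda>x. ln (h x))"
    using cont_smooth_continuous[OF h] pos by (auto simp: less_le intro!: continuous_intros)
  show ?thesis
  proof (cases k)
    case 0
    then show ?thesis using cont by (simp add: cont_smooth_0)
  next
    case (Suc k')
    show ?thesis unfolding Suc cont_smooth_Suc
    proof (intro ballI conjI allI)
      fix i x assume i: "i \<in> S"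
      have ex: "\<And>x. partial_deriv_exists i h x" and sm: "cont_smooth k' (S \<inter> {..i}) (partial_deriv i h)"
        using h i Suc by (auto simp: cont_smooth_Suc)
      have D: "((\<lambda>t. ln (h (x + t *\<^sub>R axis i 1))) has_real_derivative
          inverse (h x) * partial_deriv i h x) (at 0)" for x
        using DERIV_chain2[of ln _ "\<lambda>t. h (x + t *\<^sub>R axis i 1)", OF _ partial_deriv_has_derivative[OF ex[of x]]]
          DERIV_ln[of "h x"] pos[of x] by simp
      show "partial_deriv_exists i (\<lambda>x. ln (h x)) x" by (rule partial_derivI(1)[OF D])
      have "partial_deriv i (\<lambda>x. ln (h x)) = (\<lambda>x. inverse (h x) * partial_deriv i h x)"
        using partial_derivI(2)[OF D] by auto
      then show "cont_smooth k' (S \<inter> {..i}) (partial_deriv i (\<lambda>x. ln (h x)))"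
        using sm cont_smooth_mono[OF h, of k' "S \<inter> {..i}"] Suc
        by (auto intro!: cont_smooth_mult cont_smooth_inverse[OF pos])
    qed (rule cont)
  qed
qed

section \<open>Weighted bounds for pairs of functions\<close>

text \<open>
  A norm on pairs that measures the first entry and, in units of \<open>\<delta>\<close>, the distance of the two. As
  it is submultiplicative for \<open>\<delta> \<le> 1\<close>, one calculation with products yields both the size of an
  expression and its sensitivity to a perturbation of the data of size \<open>\<delta>\<close>.
\<close>

definition pair_norm :: "real \<Rightarrow> real \<Rightarrow> real \<Rightarrow> real" where
  "pair_norm \<delta> x y = \<bar>x\<bar> + \<bar>x - y\<bar> / \<delta>"

lemma pair_norm_add:
  "0 < \<delta> \<Longrightarrow> pair_norm \<delta> (x + x') (y + y') \<le> pair_norm \<delta> x y + pair_norm \<delta> x' y'"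
proof -
  assume d: "0 < \<delta>"
  have "\<bar>x + x' - (y + y')\<bar> / \<delta> \<le> (\<bar>x - y\<bar> + \<bar>x' - y'\<bar>) / \<delta>"
    using d by (intro divide_right_mono) auto
  then show ?thesis unfolding pair_norm_def add_divide_distrib by linarith
qed

lemma pair_norm_minus: "pair_norm \<delta> (- x) (- y) = pair_norm \<delta> x y"
  unfolding pair_norm_def by (simp add: abs_minus_commute)

lemma pair_norm_nonneg [simp]: "0 < \<delta> \<Longrightarrow> 0 \<le> pair_norm \<delta> x y"
  by (simp add: pair_norm_def)

lemma pair_norm_diag [simp]: "pair_norm \<delta> x x = \<bar>x\<bar>"
  by (simp add: pair_norm_def)

lemma pair_norm_sum:
  "0 < \<delta> \<Longrightarrow> pair_norm \<delta> (\<Sum>b\<in>A. f b) (\<Sum>b\<in>A. g b) \<le> (\<Sum>b\<in>A. pair_norm \<delta> (f b) (g b))"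
proof (induction A rule: infinite_finite_induct)
  case (insert b A)
  then show ?case using pair_norm_add[of \<delta> "f b" "sum f A" "g b" "sum g A"] by simp
qed (auto simp: pair_norm_def)

lemma pair_norm_mult:
  assumes "0 < \<delta>" "\<delta> \<le> 1"
  shows "pair_norm \<delta> (x * x') (y * y') \<le> pair_norm \<delta> x y * pair_norm \<delta> x' y'"
proof -
  define d d' where "d = \<bar>x - y\<bar> / \<delta>" and "d' = \<bar>x' - y'\<bar> / \<delta>"
  have nn: "0 \<le> d" "0 \<le> d'" using assms by (auto simp: d_def d'_def)
  have "\<bar>y\<bar> \<le> \<bar>x\<bar> + \<bar>x - y\<bar>" by linarith
  also have "\<bar>x - y\<bar> \<le> d" unfolding d_def using assms by (simp add: field_simps mult_left_le_one_le)
  finally have y: "\<bar>y\<bar> \<le> \<bar>x\<bar> + d" by simp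
  have "x * x' - y * y' = (x - y) * x' + y * (x' - y')" by (simp add: algebra_simps)
  then have "\<bar>x * x' - y * y'\<bar> \<le> \<bar>x - y\<bar> * \<bar>x'\<bar> + \<bar>y\<bar> * \<bar>x' - y'\<bar>"
    by (metis abs_mult abs_triangle_ineq)
  then have "\<bar>x * x' - y * y'\<bar> / \<delta> \<le> (\<bar>x - y\<bar> * \<bar>x'\<bar> + \<bar>y\<bar> * \<bar>x' - y'\<bar>) / \<delta>"
    using assms by (intro divide_right_mono) auto
  also have "\<dots> = d * \<bar>x'\<bar> + \<bar>y\<bar> * d'" by (simp add: d_def d'_def add_divide_distrib)
  also have "\<dots> \<le> d * \<bar>x'\<bar> + (\<bar>x\<bar> + d) * d'" using y nn by (intro add_left_mono mult_right_mono) auto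
  finally show ?thesis unfolding pair_norm_def abs_mult d_def[symmetric] d'_def[symmetric]
    by (simp add: algebra_simps)
qed

text \<open>
  Each derivative is charged one factor \<open>G\<close>. Bounds of this form are stable under products, and a
  term that arises from derivatives of orders adding up to \<open>k\<close> is automatically of size \<open>G\<^sup>k\<close>.
\<close>

definition pair_bound ::
  "nat \<Rightarrow> 'p::{finite,linorder} set \<Rightarrow> real \<Rightarrow> real \<Rightarrow> real \<Rightarrow> (real, 'p::{finite,linorder}) vec \<Rightarrow>
    ((real, 'p::{finite,linorder}) vec \<Rightarrow> real) \<Rightarrow> ((real, 'p::{finite,linorder}) vec \<Rightarrow> real) \<Rightarrow> bool" where
  "pair_bound k S \<delta> G C x g g' \<longleftrightarrow>
     (\<forall>I. sorted I \<longrightarrow> length I \<le> k \<longrightarrow> set I \<subseteq> S \<longrightarrow>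
        pair_norm \<delta> (iter_partial I g x) (iter_partial I g' x) \<le> C * G ^ length I)"

lemma pair_boundD:
  "pair_bound k S \<delta> G C x g g' \<Longrightarrow> sorted I \<Longrightarrow> length I \<le> k \<Longrightarrow> set I \<subseteq> S \<Longrightarrow>
    pair_norm \<delta> (iter_partial I g x) (iter_partial I g' x) \<le> C * G ^ length I"
  by (auto simp: pair_bound_def)

lemma pair_bound_mono:
  assumes "pair_bound k S \<delta> G C x g g'" "k' \<le> k" "S' \<subseteq> S" "C \<le> C'" "0 \<le> G"
  shows "pair_bound k' S' \<delta> G C' x g g'"
  unfolding pair_bound_def
proof (intro allI impI)
  fix I assume I: "sorted I" "length I \<le> k'" "set I \<subseteq> S'"
  have "pair_norm \<delta> (iter_partial I g x) (iter_partial I g' x) \<le> C * G ^ length I"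
    using I assms by (intro pair_boundD[OF assms(1)]) auto
  also have "\<dots> \<le> C' * G ^ length I" using assms by (intro mult_right_mono) auto
  finally show "pair_norm \<delta> (iter_partial I g x) (iter_partial I g' x) \<le> C' * G ^ length I" .
qed

lemma pair_bound_0 [simp]: "pair_bound 0 S \<delta> G C x g g' \<longleftrightarrow> pair_norm \<delta> (g x) (g' x) \<le> C"
  by (auto simp: pair_bound_def)

lemma pair_bound_Suc:
  "pair_bound (Suc k) S \<delta> G C x g g' \<longleftrightarrow>
     pair_norm \<delta> (g x) (g' x) \<le> C \<and>
     (\<forall>i\<in>S. pair_bound k (S \<inter> {..i}) \<delta> G (C * G) x (partial_deriv i g) (partial_deriv i g'))"
  (is "?L = ?R")
proof
  assume L: ?L
  have "pair_norm \<delta> (g x) (g' x) \<le> C" using pair_boundD[OF L, of "[]"] by simp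
  moreover have "pair_bound k (S \<inter> {..i}) \<delta> G (C * G) x (partial_deriv i g) (partial_deriv i g')"
    if i: "i \<in> S" for i
    unfolding pair_bound_def
  proof (intro allI impI)
    fix J assume J: "sorted J" "length J \<le> k" "set J \<subseteq> S \<inter> {..i}"
    show "pair_norm \<delta> (iter_partial J (partial_deriv i g) x) (iter_partial J (partial_deriv i g') x)
        \<le> C * G * G ^ length J"
      using pair_boundD[OF L, of "J @ [i]"] J i
      by (auto simp: iter_partial_append sorted_snoc_iff mult_ac)
  qed
  ultimately show ?R by blast
next
  assume R: ?R
  show ?L unfolding pair_bound_def
  proof (intro allI impI)
    fix I assume I: "sorted I" "length I \<le> Suc k" "set I \<subseteq> S"
    show "pair_norm \<delta> (iter_partial I g x) (iter_partial I g' x) \<le> C * G ^ length I"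
    proof (cases I rule: rev_cases)
      case (snoc J i)
      have "pair_norm \<delta> (iter_partial J (partial_deriv i g) x) (iter_partial J (partial_deriv i g') x)
          \<le> C * G * G ^ length J"
        using R I snoc by (intro pair_boundD[of k "S \<inter> {..i}"]) (auto simp: sorted_snoc_iff)
      then show ?thesis by (simp add: snoc iter_partial_append mult_ac)
    qed (use R in simp)
  qed
qed

lemma pair_bound_add:
  assumes "0 < \<delta>" "pair_bound k S \<delta> G A x f f'" "pair_bound k S \<delta> G B x g g'"
    "smooth k S f" "smooth k S f'" "smooth k S g" "smooth k S g'"
  shows "pair_bound k S \<delta> G (A + B) x (\<lambda>x. f x + g x) (\<lambda>x. f' x + g' x)"
  unfolding pair_bound_def
proof (intro allI impI)
  fix I assume I: "sorted I" "length I \<le> k" "set I \<subseteq> S"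
  note ex = smoothD[OF assms(4) I] smoothD[OF assms(5) I] smoothD[OF assms(6) I] smoothD[OF assms(7) I]
  show "pair_norm \<delta> (iter_partial I (\<lambda>x. f x + g x) x) (iter_partial I (\<lambda>x. f' x + g' x) x)
      \<le> (A + B) * G ^ length I"
    using pair_norm_add[OF assms(1), of "iter_partial I f x" "iter_partial I g x" "iter_partial I f' x" "iter_partial I g' x"]
      pair_boundD[OF assms(2) I] pair_boundD[OF assms(3) I]
    by (simp add: iter_partial_add ex algebra_simps)
qed

lemma pair_bound_minus:
  assumes "pair_bound k S \<delta> G A x f f'" "smooth k S f" "smooth k S f'"
  shows "pair_bound k S \<delta> G A x (\<lambda>x. - f x) (\<lambda>x. - f' x)"
  unfolding pair_bound_def
proof (intro allI impI)
  fix I assume I: "sorted I" "length I \<le> k" "set I \<subseteq> S"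
  show "pair_norm \<delta> (iter_partial I (\<lambda>x. - f x) x) (iter_partial I (\<lambda>x. - f' x) x) \<le> A * G ^ length I"
    using pair_boundD[OF assms(1) I] smoothD[OF assms(2) I] smoothD[OF assms(3) I]
    by (simp add: iter_partial_minus pair_norm_minus)
qed

lemma pair_bound_sum:
  assumes "0 < \<delta>" "finite A" "\<And>b. b \<in> A \<Longrightarrow> pair_bound k S \<delta> G (C b) x (f b) (f' b)"
    "\<And>b. b \<in> A \<Longrightarrow> smooth k S (f b)" "\<And>b. b \<in> A \<Longrightarrow> smooth k S (f' b)"
  shows "pair_bound k S \<delta> G (\<Sum>b\<in>A. C b) x (\<lambda>x. \<Sum>b\<in>A. f b x) (\<lambda>x. \<Sum>b\<in>A. f' b x)"
  unfolding pair_bound_def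
proof (intro allI impI)
  fix I assume I: "sorted I" "length I \<le> k" "set I \<subseteq> S"
  have "pair_norm \<delta> (\<Sum>b\<in>A. iter_partial I (f b) x) (\<Sum>b\<in>A. iter_partial I (f' b) x)
      \<le> (\<Sum>b\<in>A. pair_norm \<delta> (iter_partial I (f b) x) (iter_partial I (f' b) x))"
    by (rule pair_norm_sum[OF assms(1)])
  also have "\<dots> \<le> (\<Sum>b\<in>A. C b * G ^ length I)"
    by (intro sum_mono pair_boundD[OF assms(3)] I)
  finally show "pair_norm \<delta> (iter_partial I (\<lambda>x. \<Sum>b\<in>A. f b x) x) (iter_partial I (\<lambda>x. \<Sum>b\<in>A. f' b x) x)
      \<le> sum C A * G ^ length I"
    using iter_partial_sum(2)[OF assms(2), of I f] iter_partial_sum(2)[OF assms(2), of I f']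
      smoothD[OF assms(4) I] smoothD[OF assms(5) I] by (simp add: sum_distrib_right)
qed

lemma pair_bound_mult:
  assumes d: "0 < \<delta>" "\<delta> \<le> 1" and G: "0 \<le> G" and C: "0 \<le> A" "0 \<le> B"
  shows "pair_bound k S \<delta> G A x f f' \<Longrightarrow> pair_bound k S \<delta> G B x g g' \<Longrightarrow>
    smooth k S f \<Longrightarrow> smooth k S f' \<Longrightarrow> smooth k S g \<Longrightarrow> smooth k S g' \<Longrightarrow>
    pair_bound k S \<delta> G (2 ^ k * A * B) x (\<lambda>x. f x * g x) (\<lambda>x. f' x * g' x)"
  using C
proof (induction k arbitrary: S f f' g g' A B)
  case 0
  have "pair_norm \<delta> (f x * g x) (f' x * g' x) \<le> pair_norm \<delta> (f x) (f' x) * pair_norm \<delta> (g x) (g' x)"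
    by (rule pair_norm_mult[OF d])
  also have "\<dots> \<le> A * B" using 0 d by (intro mult_mono) auto
  finally show ?case by simp
next
  case (Suc k)
  have "pair_norm \<delta> (f x * g x) (f' x * g' x) \<le> pair_norm \<delta> (f x) (f' x) * pair_norm \<delta> (g x) (g' x)"
    by (rule pair_norm_mult[OF d])
  also have "\<dots> \<le> A * B" using Suc.prems d by (intro mult_mono) (auto simp: pair_bound_Suc)
  also have "\<dots> = 1 * (A * B)" by simp
  also have "\<dots> \<le> 2 ^ Suc k * (A * B)"
    using Suc.prems by (intro mult_right_mono one_le_power) auto
  finally have "pair_norm \<delta> (f x * g x) (f' x * g' x) \<le> 2 ^ Suc k * A * B" by (simp add: mult_ac)
  moreover have "pair_bound k (S \<inter> {..i}) \<delta> G (2 ^ Suc k * A * B * G) x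
      (partial_deriv i (\<lambda>x. f x * g x)) (partial_deriv i (\<lambda>x. f' x * g' x))" if i: "i \<in> S" for i
  proof -
    let ?S = "S \<inter> {..i}"
    have ex: "\<And>x. partial_deriv_exists i f x" "\<And>x. partial_deriv_exists i f' x"
      "\<And>x. partial_deriv_exists i g x" "\<And>x. partial_deriv_exists i g' x"
      using Suc.prems i by (auto simp: smooth_Suc)
    have sm: "smooth k ?S (partial_deriv i f)" "smooth k ?S (partial_deriv i f')"
      "smooth k ?S (partial_deriv i g)" "smooth k ?S (partial_deriv i g')"
      using Suc.prems i by (auto simp: smooth_Suc)
    have sm0: "smooth k ?S f" "smooth k ?S f'" "smooth k ?S g" "smooth k ?S g'"
      using smooth_mono[OF Suc.prems(3)] smooth_mono[OF Suc.prems(4)]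
        smooth_mono[OF Suc.prems(5)] smooth_mono[OF Suc.prems(6)] by auto
    have b0: "pair_bound k ?S \<delta> G A x f f'" "pair_bound k ?S \<delta> G B x g g'"
      using pair_bound_mono[OF Suc.prems(1)] pair_bound_mono[OF Suc.prems(2)] G by auto
    have b1: "pair_bound k ?S \<delta> G (A * G) x (partial_deriv i f) (partial_deriv i f')"
      "pair_bound k ?S \<delta> G (B * G) x (partial_deriv i g) (partial_deriv i g')"
      using Suc.prems i by (auto simp: pair_bound_Suc)
    have "pair_bound k ?S \<delta> G (2 ^ k * (A * G) * B + 2 ^ k * A * (B * G)) x
       (\<lambda>x. partial_deriv i f x * g x + f x * partial_deriv i g x)
       (\<lambda>x. partial_deriv i f' x * g' x + f' x * partial_deriv i g' x)"
      using Suc.prems G by (intro pair_bound_add Suc.IH smooth_mult b0 b1 sm sm0 d) auto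
    then show ?thesis
      unfolding partial_deriv_mult(2)[OF ex(1,3)] partial_deriv_mult(2)[OF ex(2,4)]
      by (simp add: algebra_simps)
  qed
  ultimately show ?case unfolding pair_bound_Suc by blast
qed

text \<open>
  Every term of the Leibniz expansion of \<open>(w v)\<^sup>(\<^sup>J\<^sup>)\<close> other than \<open>w v\<^sup>(\<^sup>J\<^sup>)\<close> has a derivative on \<open>w\<close>; hence bounds
  on \<open>v\<close> of one order less suffice to control these terms.
\<close>

lemma pair_bound_commutator:
  assumes d: "0 < \<delta>" "\<delta> \<le> 1" and G: "0 \<le> G" and C: "0 \<le> A" "0 \<le> B"
  shows "sorted J \<Longrightarrow> length J \<le> k \<Longrightarrow> set J \<subseteq> S \<Longrightarrow>
    pair_bound k S \<delta> G A x w w' \<Longrightarrow> pair_bound (k - 1) S \<delta> G B x v v' \<Longrightarrow>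
    smooth k S w \<Longrightarrow> smooth k S w' \<Longrightarrow> smooth k S v \<Longrightarrow> smooth k S v' \<Longrightarrow>
    pair_norm \<delta> (iter_partial J (\<lambda>x. w x * v x) x - w x * iter_partial J v x)
      (iter_partial J (\<lambda>x. w' x * v' x) x - w' x * iter_partial J v' x) \<le> 2 ^ k * A * B * G ^ length J"
  using C
proof (induction J arbitrary: k S v v' B rule: rev_induct)
  case Nil
  then show ?case using d by simp
next
  case (snoc j J)
  then obtain k' where k: "k = Suc k'" by (cases k) auto
  let ?S = "S \<inter> {..j}"
  have j: "j \<in> S" using snoc.prems by auto
  have J: "sorted J" "length J \<le> k'" "set J \<subseteq> ?S" using snoc.prems k by (auto simp: sorted_snoc_iff)
  have sm: "smooth k' ?S (partial_deriv j w)" "smooth k' ?S (partial_deriv j w')"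
      "smooth k' ?S (partial_deriv j v)" "smooth k' ?S (partial_deriv j v')"
      "\<And>x. partial_deriv_exists j w x" "\<And>x. partial_deriv_exists j w' x"
      "\<And>x. partial_deriv_exists j v x" "\<And>x. partial_deriv_exists j v' x"
    using snoc.prems j k by (auto simp: smooth_Suc)
  have sm0: "smooth k' ?S w" "smooth k' ?S w'" "smooth k' ?S v" "smooth k' ?S v'"
    using smooth_mono[OF snoc.prems(6)] smooth_mono[OF snoc.prems(7)]
      smooth_mono[OF snoc.prems(8)] smooth_mono[OF snoc.prems(9)] k by auto
  have bw: "pair_bound k' ?S \<delta> G (A * G) x (partial_deriv j w) (partial_deriv j w')"
    using snoc.prems(4) j k by (auto simp: pair_bound_Suc)
  have bw0: "pair_bound k' ?S \<delta> G A x w w'"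
    using pair_bound_mono[OF snoc.prems(4)] k G by auto
  have bv: "pair_bound k' ?S \<delta> G B x v v'"
    using pair_bound_mono[OF snoc.prems(5), of k' ?S B] k G by auto
  have bv': "pair_bound (k' - 1) ?S \<delta> G (B * G) x (partial_deriv j v) (partial_deriv j v')" if ne: "J \<noteq> []"
  proof -
    obtain k'' where "k' = Suc k''" using ne J by (cases k') auto
    then show ?thesis using snoc.prems(5) j k by (auto simp: pair_bound_Suc)
  qed
  have rem: "pair_norm \<delta> (iter_partial J (\<lambda>x. w x * partial_deriv j v x) x - w x * iter_partial J (partial_deriv j v) x)
      (iter_partial J (\<lambda>x. w' x * partial_deriv j v' x) x - w' x * iter_partial J (partial_deriv j v') x)
      \<le> 2 ^ k' * A * (B * G) * G ^ length J"
  proof (cases "J = []")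
    case True
    then show ?thesis using snoc.prems G by simp
  next
    case False
    show ?thesis
      using snoc.prems G by (intro snoc.IH[OF J bw0 bv'[OF False] sm0(1,2) sm(3,4)]) auto
  qed
  have pb: "pair_bound k' ?S \<delta> G (2 ^ k' * (A * G) * B) x (\<lambda>x. partial_deriv j w x * v x) (\<lambda>x. partial_deriv j w' x * v' x)"
    using snoc.prems G by (intro pair_bound_mult bw bv sm sm0 d) auto
  have eq: "iter_partial (J @ [j]) (\<lambda>x. w x * v x) x - w x * iter_partial (J @ [j]) v x =
      iter_partial J (\<lambda>x. partial_deriv j w x * v x) x +
      (iter_partial J (\<lambda>x. w x * partial_deriv j v x) x - w x * iter_partial J (partial_deriv j v) x)"
    if "\<And>x. partial_deriv_exists j w x" "\<And>x. partial_deriv_exists j v x"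
      "smooth k' ?S (partial_deriv j w)" "smooth k' ?S (partial_deriv j v)" "smooth k' ?S w" "smooth k' ?S v" for w v
    unfolding iter_partial_append
    by (simp add: partial_deriv_mult(2)[OF that(1,2)]
        iter_partial_add(2)[OF smoothD[OF smooth_mult[OF that(3,6)] J] smoothD[OF smooth_mult[OF that(5,4)] J]])
  have "pair_norm \<delta> (iter_partial (J @ [j]) (\<lambda>x. w x * v x) x - w x * iter_partial (J @ [j]) v x)
      (iter_partial (J @ [j]) (\<lambda>x. w' x * v' x) x - w' x * iter_partial (J @ [j]) v' x)
     \<le> 2 ^ k' * (A * G) * B * G ^ length J + 2 ^ k' * A * (B * G) * G ^ length J"
    unfolding eq[OF sm(5,7,1,3) sm0(1,3)] eq[OF sm(6,8,2,4) sm0(2,4)]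
    by (intro order_trans[OF pair_norm_add[OF d(1)]] add_mono rem pair_boundD[OF pb] J)
  also have "\<dots> = 2 ^ k * A * B * G ^ length (J @ [j])" by (simp add: k algebra_simps)
  finally show ?case .
qed

section \<open>Log-sum-exp functions and their Gibbs weights\<close>

definition gibbs :: "('h::finite \<Rightarrow> real) \<Rightarrow> ('h \<Rightarrow> real) \<Rightarrow> 'h \<Rightarrow> real" where
  "gibbs p y b = p b * exp (y b) / (\<Sum>c\<in>UNIV. p c * exp (y c))"

text \<open>
  The logarithm of a partition function; its gradient in \<open>y\<close> consists of the Gibbs weights.
\<close>

definition lse :: "('h::finite \<Rightarrow> real) \<Rightarrow> ('h \<Rightarrow> real) \<Rightarrow> real" where
  "lse p y = ln (\<Sum>c\<in>UNIV. p c * exp (y c))"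

lemma partition_pos: "\<forall>b. 0 < p b \<Longrightarrow> 0 < (\<Sum>c\<in>UNIV. p c * exp (y c :: real))"
  for p :: "'h::finite \<Rightarrow> real"
  by (intro sum_pos) auto

lemma gibbs_nonneg: "\<forall>b. 0 < p b \<Longrightarrow> 0 \<le> gibbs p y b"
  unfolding gibbs_def using partition_pos[of p y] by (simp add: less_imp_le)

lemma gibbs_sum: "\<forall>b. 0 < p b \<Longrightarrow> (\<Sum>b\<in>UNIV. gibbs p y b) = 1"
  unfolding gibbs_def sum_divide_distrib[symmetric] using partition_pos[of p y] by simp

lemma gibbs_le_1: "\<forall>b. 0 < p b \<Longrightarrow> gibbs p y b \<le> 1"
  using gibbs_sum[of p y] member_le_sum[of b UNIV "gibbs p y"] gibbs_nonneg[of p y] by auto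

lemma lse_has_derivative:
  assumes p: "\<forall>b. 0 < p b" and y: "\<forall>b. ((\<lambda>t. y b t) has_real_derivative d b) (at t)"
  shows "((\<lambda>t. lse p (\<lambda>b. y b t)) has_real_derivative (\<Sum>b\<in>UNIV. gibbs p (\<lambda>b. y b t) b * d b)) (at t)"
  unfolding lse_def gibbs_def
  using partition_pos[OF p, of "\<lambda>b. y b t"]
  by (auto intro!: derivative_eq_intros y[rule_format] simp: sum_divide_distrib mult_ac)

lemma gibbs_has_derivative:
  assumes p: "\<forall>b. 0 < p b" and y: "\<forall>b. ((\<lambda>t. y b t) has_real_derivative d b) (at t)"
  shows "((\<lambda>t. gibbs p (\<lambda>b. y b t) c) has_real_derivative
      gibbs p (\<lambda>b. y b t) c * (d c - (\<Sum>b\<in>UNIV. gibbs p (\<lambda>b. y b t) b * d b))) (at t)"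
proof -
  let ?S = "\<Sum>b\<in>UNIV. p b * exp (y b t)"
  have S: "?S > 0" using partition_pos[OF p, of "\<lambda>b. y b t"] .
  have "((\<lambda>t. p c * exp (y c t) / (\<Sum>b\<in>UNIV. p b * exp (y b t))) has_real_derivative
      (p c * exp (y c t) * d c * ?S - p c * exp (y c t) * (\<Sum>b\<in>UNIV. p b * exp (y b t) * d b)) / (?S * ?S)) (at t)"
    using S by (auto intro!: derivative_eq_intros y[rule_format] simp: mult_ac)
  also have "(p c * exp (y c t) * d c * ?S - p c * exp (y c t) * (\<Sum>b\<in>UNIV. p b * exp (y b t) * d b)) / (?S * ?S)
      = p c * exp (y c t) / ?S * (d c - (\<Sum>b\<in>UNIV. p b * exp (y b t) * d b) / ?S)"
    using S by (simp add: divide_simps) (simp add: algebra_simps)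
  also have "(\<Sum>b\<in>UNIV. p b * exp (y b t) * d b) / ?S = (\<Sum>b\<in>UNIV. p b * exp (y b t) / ?S * d b)"
    by (simp add: sum_divide_distrib)
  finally show ?thesis unfolding gibbs_def .
qed

text \<open>
  Removing the common part \<open>\<phi> \<mu>\<close> does not change the difference of the two averages and leaves
  positive weights of total mass \<open>1 - \<phi>\<close>.
\<close>

lemma minorized_average_osc:
  fixes w w' \<mu> v :: "'h::finite \<Rightarrow> real"
  assumes w: "\<forall>b. \<phi> * \<mu> b \<le> w b" "(\<Sum>b\<in>UNIV. w b) = 1"
    and w': "\<forall>b. \<phi> * \<mu> b \<le> w' b" "(\<Sum>b\<in>UNIV. w' b) = 1"
    and \<mu>: "(\<Sum>b\<in>UNIV. \<mu> b) = 1" and \<phi>: "\<phi> \<le> 1"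
    and v: "\<forall>b c. \<bar>v b - v c\<bar> \<le> K"
  shows "\<bar>\<Sum>b\<in>UNIV. (w b - w' b) * v b\<bar> \<le> (1 - \<phi>) * K"
proof -
  have main: "(\<Sum>b\<in>UNIV. (w b - w' b) * v b) \<le> (1 - \<phi>) * K"
    if w: "\<forall>b. \<phi> * \<mu> b \<le> w b" "(\<Sum>b\<in>UNIV. w b) = 1"
    and w': "\<forall>b. \<phi> * \<mu> b \<le> w' b" "(\<Sum>b\<in>UNIV. w' b) = 1" for w w'
  proof -
    obtain c where c: "\<And>b. v b \<le> v c"
      using Max_in[of "range v"] Max_ge[of "range v"]
      by (metis UNIV_not_empty empty_is_image finite finite_imageI imageE rangeI)
    have mass: "(\<Sum>b\<in>UNIV. w b - \<phi> * \<mu> b) = 1 - \<phi>" "(\<Sum>b\<in>UNIV. w' b - \<phi> * \<mu> b) = 1 - \<phi>"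
      by (simp_all add: sum_subtractf w w' \<mu> sum_distrib_left[symmetric])
    have "(\<Sum>b\<in>UNIV. (w b - \<phi> * \<mu> b) * v b) \<le> (\<Sum>b\<in>UNIV. (w b - \<phi> * \<mu> b) * v c)"
      using w c by (intro sum_mono mult_left_mono) (auto simp: algebra_simps)
    also have "\<dots> = (1 - \<phi>) * v c" by (simp add: sum_distrib_right[symmetric] mass)
    finally have 1: "(\<Sum>b\<in>UNIV. (w b - \<phi> * \<mu> b) * v b) \<le> (1 - \<phi>) * v c" .
    have "(1 - \<phi>) * (v c - K) = (\<Sum>b\<in>UNIV. (w' b - \<phi> * \<mu> b) * (v c - K))"
      by (simp add: sum_distrib_right[symmetric] mass)
    also have "\<dots> \<le> (\<Sum>b\<in>UNIV. (w' b - \<phi> * \<mu> b) * v b)"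
    proof (intro sum_mono mult_left_mono)
      fix b show "v c - K \<le> v b" using v[rule_format, of c b] by linarith
    qed (use w' in \<open>auto simp: algebra_simps\<close>)
    finally have 2: "(1 - \<phi>) * (v c - K) \<le> (\<Sum>b\<in>UNIV. (w' b - \<phi> * \<mu> b) * v b)" .
    have "(\<Sum>b\<in>UNIV. (w b - w' b) * v b) =
        (\<Sum>b\<in>UNIV. (w b - \<phi> * \<mu> b) * v b) - (\<Sum>b\<in>UNIV. (w' b - \<phi> * \<mu> b) * v b)"
      unfolding sum_subtractf[symmetric] by (simp add: algebra_simps)
    also have "\<dots> \<le> (1 - \<phi>) * K" using 1 2 by (simp add: algebra_simps)
    finally show ?thesis .
  qed
  have "- (\<Sum>b\<in>UNIV. (w b - w' b) * v b) = (\<Sum>b\<in>UNIV. (w' b - w b) * v b)"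
    unfolding sum_negf[symmetric] by (simp add: algebra_simps)
  moreover have "(\<Sum>b\<in>UNIV. (w b - w' b) * v b) \<le> (1 - \<phi>) * K" "(\<Sum>b\<in>UNIV. (w' b - w b) * v b) \<le> (1 - \<phi>) * K"
    by (rule main; use assms in simp)+
  ultimately show ?thesis by linarith
qed

lemma gibbs_minorized:
  fixes p :: "'h::finite \<Rightarrow> real"
  assumes \<phi>: "0 < \<phi>" and p: "\<forall>b. \<phi> \<le> p b \<and> p b \<le> 1"
  shows "\<phi> * gibbs (\<lambda>_. 1) y b \<le> gibbs p y b"
proof -
  have pos: "\<forall>b. 0 < p b" using p \<phi> by (meson less_le_trans)
  have "\<phi> * exp (y b) / (\<Sum>c\<in>UNIV. 1 * exp (y c)) \<le> p b * exp (y b) / (\<Sum>c\<in>UNIV. p c * exp (y c))"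
    using p pos \<phi> by (intro frac_le sum_mono mult_right_mono partition_pos) (auto simp: less_imp_le)
  then show ?thesis by (simp add: gibbs_def)
qed

lemma gibbs_average_osc:
  fixes p p' v :: "'h::finite \<Rightarrow> real"
  assumes \<phi>: "0 < \<phi>" and p: "\<forall>b. \<phi> \<le> p b \<and> p b \<le> 1" and p': "\<forall>b. \<phi> \<le> p' b \<and> p' b \<le> 1"
    and v: "\<forall>b c. \<bar>v b - v c\<bar> \<le> K"
  shows "\<bar>\<Sum>b\<in>UNIV. (gibbs p y b - gibbs p' y b) * v b\<bar> \<le> (1 - \<phi>) * K"
proof (rule minorized_average_osc)
  show "\<phi> \<le> 1" using p by (meson order_trans)
qed (use assms in \<open>auto intro!: gibbs_minorized gibbs_sum intro: less_le_trans\<close>)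

text \<open>
  On the segment from \<open>y'\<close> to \<open>y\<close> the derivative is a difference of two Gibbs averages of \<open>y - y'\<close>.
\<close>

lemma lse_diff_osc:
  fixes p p' y y' :: "'h::finite \<Rightarrow> real"
  assumes \<phi>: "0 < \<phi>" and p: "\<forall>b. \<phi> \<le> p b \<and> p b \<le> 1" and p': "\<forall>b. \<phi> \<le> p' b \<and> p' b \<le> 1"
    and v: "\<forall>b c. \<bar>(y b - y' b) - (y c - y' c)\<bar> \<le> K"
  shows "\<bar>(lse p y - lse p y') - (lse p' y - lse p' y')\<bar> \<le> (1 - \<phi>) * K"
proof -
  have pos: "\<forall>b. 0 < p b" "\<forall>b. 0 < p' b" using p p' \<phi> by (meson less_le_trans)+
  define z where "z = (\<lambda>b t. y' b + t * (y b - y' b))"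
  have z: "\<forall>b. ((\<lambda>t. z b t) has_real_derivative (y b - y' b)) (at t)" for t
    unfolding z_def by (auto intro!: derivative_eq_intros)
  define F where "F t = lse p (\<lambda>b. z b t) - lse p' (\<lambda>b. z b t)" for t
  have D: "(F has_real_derivative
      (\<Sum>b\<in>UNIV. (gibbs p (\<lambda>b. z b t) b - gibbs p' (\<lambda>b. z b t) b) * (y b - y' b))) (at t)" for t
    unfolding F_def
    by (rule DERIV_cong[OF DERIV_diff[OF lse_has_derivative[OF pos(1) z] lse_has_derivative[OF pos(2) z]]])
      (simp add: left_diff_distrib sum_subtractf)
  obtain t where "F 1 - F 0 = (1 - 0) *
      (\<Sum>b\<in>UNIV. (gibbs p (\<lambda>b. z b t) b - gibbs p' (\<lambda>b. z b t) b) * (y b - y' b))"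
    using MVT2[of 0 1 F, OF _ D] by auto
  then have "\<bar>F 1 - F 0\<bar> \<le> (1 - \<phi>) * K"
    using gibbs_average_osc[OF \<phi> p p' v] by simp
  moreover have "F 1 - F 0 = (lse p y - lse p y') - (lse p' y - lse p' y')"
    by (simp add: F_def z_def)
  ultimately show ?thesis by simp
qed

lemma gibbs_lipschitz:
  fixes p y y' :: "'h::finite \<Rightarrow> real"
  assumes pos: "\<forall>b. 0 < p b" and v: "\<forall>b. \<bar>y b - y' b\<bar> \<le> K"
  shows "\<bar>gibbs p y c - gibbs p y' c\<bar> \<le> 2 * K"
proof -
  define z where "z = (\<lambda>b t. y' b + t * (y b - y' b))"
  have z: "\<forall>b. ((\<lambda>t. z b t) has_real_derivative (y b - y' b)) (at t)" for t
    unfolding z_def by (auto intro!: derivative_eq_intros)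
  obtain t where "gibbs p (\<lambda>b. z b 1) c - gibbs p (\<lambda>b. z b 0) c = (1 - 0) *
      (gibbs p (\<lambda>b. z b t) c * ((y c - y' c) - (\<Sum>b\<in>UNIV. gibbs p (\<lambda>b. z b t) b * (y b - y' b))))"
    using MVT2[of 0 1 "\<lambda>t. gibbs p (\<lambda>b. z b t) c", OF _ gibbs_has_derivative[OF pos z]] by auto
  then have eq: "\<bar>gibbs p y c - gibbs p y' c\<bar> = gibbs p (\<lambda>b. z b t) c *
      \<bar>(y c - y' c) - (\<Sum>b\<in>UNIV. gibbs p (\<lambda>b. z b t) b * (y b - y' b))\<bar>"
    using gibbs_nonneg[of p "\<lambda>b. z b t" c, OF pos] by (simp add: z_def abs_mult)
  have "\<bar>\<Sum>b\<in>UNIV. gibbs p (\<lambda>b. z b t) b * (y b - y' b)\<bar> \<le> (\<Sum>b\<in>UNIV. gibbs p (\<lambda>b. z b t) b * K)"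
    using gibbs_nonneg[of p "\<lambda>b. z b t", OF pos] v[rule_format]
    by (intro order_trans[OF sum_abs] sum_mono) (auto simp: abs_mult intro!: mult_left_mono)
  also have "\<dots> = K" using gibbs_sum[OF pos, of "\<lambda>b. z b t"] by (simp add: sum_distrib_right[symmetric])
  finally have "\<bar>(y c - y' c) - (\<Sum>b\<in>UNIV. gibbs p (\<lambda>b. z b t) b * (y b - y' b))\<bar> \<le> 2 * K"
    using v[rule_format, of c] by linarith
  moreover have "gibbs p (\<lambda>b. z b t) c * X \<le> X" if "0 \<le> X" for X
    using gibbs_le_1[of p "\<lambda>b. z b t" c, OF pos] that by (simp add: mult_left_le_one_le gibbs_nonneg pos)
  ultimately show ?thesis unfolding eq by (meson abs_ge_zero order_trans)
qed

lemma lse_kernel_osc: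
  fixes p p' y :: "'h::finite \<Rightarrow> real"
  assumes \<phi>: "0 < \<phi>" and p: "\<forall>b. \<phi> \<le> p b \<and> p b \<le> 1" and p': "\<forall>b. \<phi> \<le> p' b \<and> p' b \<le> 1"
  shows "\<bar>lse p y - lse p' y\<bar> \<le> - ln \<phi>"
proof -
  have main: "lse p y - lse p' y \<le> - ln \<phi>"
    if p: "\<forall>b. \<phi> \<le> p b \<and> p b \<le> 1" and p': "\<forall>b. \<phi> \<le> p' b \<and> p' b \<le> 1" for p p'
  proof -
    have pos: "\<forall>b. 0 < p b" "\<forall>b. 0 < p' b" using p p' \<phi> by (meson less_le_trans)+
    have "\<phi> * (\<Sum>c\<in>UNIV. p c * exp (y c)) \<le> (\<Sum>c\<in>UNIV. p' c * exp (y c))"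
      unfolding sum_distrib_left
    proof (rule sum_mono)
      fix c
      have "\<phi> * p c \<le> p' c * 1" using p p' \<phi> pos
        by (intro mult_mono) (auto simp: less_imp_le)
      then show "\<phi> * (p c * exp (y c)) \<le> p' c * exp (y c)"
        by (simp add: mult.assoc[symmetric])
    qed
    then have "ln (\<phi> * (\<Sum>c\<in>UNIV. p c * exp (y c))) \<le> lse p' y"
      unfolding lse_def using \<phi> partition_pos[of p y, OF pos(1)] partition_pos[of p' y, OF pos(2)] by simp
    moreover have "ln (\<phi> * (\<Sum>c\<in>UNIV. p c * exp (y c))) = ln \<phi> + lse p y"
      unfolding lse_def using \<phi> partition_pos[of p y, OF pos(1)] by (simp add: ln_mult)
    ultimately show ?thesis by linarith
  qed
  have "lse p y - lse p' y \<le> - ln \<phi>" "lse p' y - lse p y \<le> - ln \<phi>"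
    by (rule main; use assms in simp)+
  then show ?thesis by linarith
qed

lemma partial_deriv_lse:
  assumes p: "\<forall>b. 0 < p b" and y: "\<forall>b x. partial_deriv_exists i (y b) x"
  shows "partial_deriv_exists i (\<lambda>x. lse p (\<lambda>b. y b x)) x"
    and "partial_deriv i (\<lambda>x. lse p (\<lambda>b. y b x)) =
      (\<lambda>x. \<Sum>b\<in>UNIV. gibbs p (\<lambda>b. y b x) b * partial_deriv i (y b) x)"
proof -
  have D: "((\<lambda>t. lse p (\<lambda>b. y b (x + t *\<^sub>R axis i 1))) has_real_derivative
     (\<Sum>b\<in>UNIV. gibbs p (\<lambda>b. y b x) b * partial_deriv i (y b) x)) (at 0)" for x
    using lse_has_derivative[OF p allI[OF partial_deriv_has_derivative[OF y[rule_format]]]] by simp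
  show "partial_deriv_exists i (\<lambda>x. lse p (\<lambda>b. y b x)) x" by (rule partial_derivI(1)[OF D])
  show "partial_deriv i (\<lambda>x. lse p (\<lambda>b. y b x)) =
      (\<lambda>x. \<Sum>b\<in>UNIV. gibbs p (\<lambda>b. y b x) b * partial_deriv i (y b) x)"
    using partial_derivI(2)[OF D] by auto
qed

lemma partial_deriv_gibbs:
  assumes p: "\<forall>b. 0 < p b" and y: "\<forall>b x. partial_deriv_exists i (y b) x"
  shows "partial_deriv_exists i (\<lambda>x. gibbs p (\<lambda>b. y b x) c) x"
    and "partial_deriv i (\<lambda>x. gibbs p (\<lambda>b. y b x) c) =
      (\<lambda>x. gibbs p (\<lambda>b. y b x) c *
        (partial_deriv i (y c) x - (\<Sum>b\<in>UNIV. gibbs p (\<lambda>b. y b x) b * partial_deriv i (y b) x)))"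
proof -
  have D: "((\<lambda>t. gibbs p (\<lambda>b. y b (x + t *\<^sub>R axis i 1)) c) has_real_derivative
     gibbs p (\<lambda>b. y b x) c *
        (partial_deriv i (y c) x - (\<Sum>b\<in>UNIV. gibbs p (\<lambda>b. y b x) b * partial_deriv i (y b) x))) (at 0)" for x
    using gibbs_has_derivative[OF p allI[OF partial_deriv_has_derivative[OF y[rule_format]]]] by simp
  show "partial_deriv_exists i (\<lambda>x. gibbs p (\<lambda>b. y b x) c) x" by (rule partial_derivI(1)[OF D])
  show "partial_deriv i (\<lambda>x. gibbs p (\<lambda>b. y b x) c) =
      (\<lambda>x. gibbs p (\<lambda>b. y b x) c *
        (partial_deriv i (y c) x - (\<Sum>b\<in>UNIV. gibbs p (\<lambda>b. y b x) b * partial_deriv i (y b) x)))"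
    using partial_derivI(2)[OF D] by auto
qed

lemma smooth_gibbs:
  assumes p: "\<forall>b. 0 < p b"
  shows "(\<And>b. smooth k S (y b)) \<Longrightarrow> smooth k S (\<lambda>x. gibbs p (\<lambda>b. y b x) c)"
proof (induction k arbitrary: S c)
  case (Suc k)
  have ex: "\<forall>b x. partial_deriv_exists i (y b) x" "\<And>b. smooth k (S \<inter> {..i}) (partial_deriv i (y b))"
    if "i \<in> S" for i using Suc.prems that by (auto simp: smooth_Suc)
  have IH: "smooth k (S \<inter> {..i}) (\<lambda>x. gibbs p (\<lambda>b. y b x) c)" for i c
    by (intro Suc.IH smooth_mono[OF Suc.prems]) auto
  show ?case unfolding smooth_Suc
  proof (intro ballI conjI allI)
    fix i x assume i: "i \<in> S"
    show "partial_deriv_exists i (\<lambda>x. gibbs p (\<lambda>b. y b x) c) x"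
      by (rule partial_deriv_gibbs(1)[OF p ex(1)[OF i]])
    show "smooth k (S \<inter> {..i}) (partial_deriv i (\<lambda>x. gibbs p (\<lambda>b. y b x) c))"
      unfolding partial_deriv_gibbs(2)[OF p ex(1)[OF i]]
      by (intro smooth_mult smooth_diff smooth_sum IH ex(2)[OF i] finite)
  qed
qed simp

lemma smooth_lse:
  assumes p: "\<forall>b. 0 < p b" and y: "\<And>b. smooth k S (y b)"
  shows "smooth k S (\<lambda>x. lse p (\<lambda>b. y b x))"
proof (cases k)
  case (Suc k')
  have ex: "\<forall>b x. partial_deriv_exists i (y b) x" "\<And>b. smooth k' (S \<inter> {..i}) (partial_deriv i (y b))"
    if "i \<in> S" for i using y that Suc by (auto simp: smooth_Suc)
  have y': "smooth k' (S \<inter> {..i}) (y b)" for i b using smooth_mono[OF y] Suc by auto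
  show ?thesis unfolding Suc smooth_Suc
  proof (intro ballI conjI allI)
    fix i x assume i: "i \<in> S"
    show "partial_deriv_exists i (\<lambda>x. lse p (\<lambda>b. y b x)) x"
      by (rule partial_deriv_lse(1)[OF p ex(1)[OF i]])
    show "smooth k' (S \<inter> {..i}) (partial_deriv i (\<lambda>x. lse p (\<lambda>b. y b x)))"
      unfolding partial_deriv_lse(2)[OF p ex(1)[OF i]]
      by (intro smooth_mult smooth_sum smooth_gibbs ex(2)[OF i] finite p y')
  qed
qed simp

text \<open>
  Through differentiation only the derivatives of \<open>y\<close> enter the Gibbs weights; its values, which may be
  large, matter only through the distance of \<open>y\<close> and \<open>y'\<close>.
\<close>

definition deriv_bound ::
  "nat \<Rightarrow> 'p::{finite,linorder} set \<Rightarrow> real \<Rightarrow> real \<Rightarrow> real \<Rightarrow> (real, 'p::{finite,linorder}) vec \<Rightarrow>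
    ((real, 'p::{finite,linorder}) vec \<Rightarrow> real) \<Rightarrow> ((real, 'p::{finite,linorder}) vec \<Rightarrow> real) \<Rightarrow> bool" where
  "deriv_bound k S \<delta> G C x g g' \<longleftrightarrow>
     (\<forall>I. sorted I \<longrightarrow> I \<noteq> [] \<longrightarrow> length I \<le> k \<longrightarrow> set I \<subseteq> S \<longrightarrow>
        pair_norm \<delta> (iter_partial I g x) (iter_partial I g' x) \<le> C * G ^ length I)"

lemma deriv_bound_mono:
  "deriv_bound k S \<delta> G C x g g' \<Longrightarrow> k' \<le> k \<Longrightarrow> S' \<subseteq> S \<Longrightarrow> deriv_bound k' S' \<delta> G C x g g'"
  unfolding deriv_bound_def by (meson order_trans subset_trans)

lemma deriv_bound_SucD:
  assumes "deriv_bound (Suc k) S \<delta> G C x g g'" "i \<in> S"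
  shows "pair_bound k (S \<inter> {..i}) \<delta> G (C * G) x (partial_deriv i g) (partial_deriv i g')"
  unfolding pair_bound_def
proof (intro allI impI)
  fix J assume J: "sorted J" "length J \<le> k" "set J \<subseteq> S \<inter> {..i}"
  then show "pair_norm \<delta> (iter_partial J (partial_deriv i g) x) (iter_partial J (partial_deriv i g') x)
      \<le> C * G * G ^ length J"
    using assms unfolding deriv_bound_def
    by (elim allE[of _ "J @ [i]"]) (auto simp: iter_partial_append sorted_snoc_iff mult_ac)
qed

text \<open>
  The standing hypotheses for comparing two vectors of functions near a point. The order \<open>m\<close> of
  smoothness and the order \<open>k\<close> of the bounds are separate because the highest derivatives exist but
  are estimated by a different argument.
\<close>

definition close_pair ::
  "nat \<Rightarrow> nat \<Rightarrow> 'p::{finite,linorder} set \<Rightarrow> real \<Rightarrow> real \<Rightarrow> real \<Rightarrow> (real, 'p) vec \<Rightarrow>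
    ('h \<Rightarrow> (real, 'p) vec \<Rightarrow> real) \<Rightarrow> ('h \<Rightarrow> (real, 'p) vec \<Rightarrow> real) \<Rightarrow> bool" where
  "close_pair m k S \<delta> G B x y y' \<longleftrightarrow> 0 < \<delta> \<and> \<delta> \<le> 1 \<and> 0 \<le> G \<and>
     (\<forall>b. smooth m S (y b) \<and> smooth m S (y' b) \<and> \<bar>y b x - y' b x\<bar> \<le> B * \<delta> \<and>
       deriv_bound k S \<delta> G B x (y b) (y' b))"

lemma close_pairD:
  assumes "close_pair m k S \<delta> G B x y y'"
  shows "0 < \<delta>" "\<delta> \<le> 1" "0 \<le> G" "smooth m S (y b)" "smooth m S (y' b)"
    "\<bar>y b x - y' b x\<bar> \<le> B * \<delta>" "deriv_bound k S \<delta> G B x (y b) (y' b)"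
  using assms unfolding close_pair_def by auto

lemma close_pair_mono:
  assumes c: "close_pair m k S \<delta> G B x y y'" and le: "m' \<le> m" "k' \<le> k" "S' \<subseteq> S"
  shows "close_pair m' k' S' \<delta> G B x y y'"
  using close_pairD[OF c] smooth_mono[OF close_pairD(4)[OF c] le(1,3)] smooth_mono[OF close_pairD(5)[OF c] le(1,3)]
    deriv_bound_mono[OF close_pairD(7)[OF c] le(2,3)] unfolding close_pair_def by blast

text \<open>
  The derivative \<open>W\<^sub>b (\<partial>y\<^sub>b - \<Sum>\<^sub>c W\<^sub>c \<partial>y\<^sub>c)\<close> of a Gibbs weight is a polynomial in Gibbs weights and
  first derivatives of \<open>y\<close>, so bounds propagate from one order to the next. It matters that the constant depends only
  on the order, on \<open>B\<close> and on the number of states.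
\<close>

lemma pair_bound_gibbs:
  assumes B: "0 \<le> B"
  shows "\<exists>A\<ge>1. \<forall>(p :: 'h::finite \<Rightarrow> real) (S :: 'p::{finite,linorder} set) \<delta> G x y y' b.
     (\<forall>b. 0 < p b) \<longrightarrow> close_pair k k S \<delta> G B x y y' \<longrightarrow>
     pair_bound k S \<delta> G A x (\<lambda>x. gibbs p (\<lambda>b. y b x) b) (\<lambda>x. gibbs p (\<lambda>b. y' b x) b)"
    (is "\<exists>A\<ge>1. ?bound k A")
proof -
  have zero: "pair_norm \<delta> (gibbs p (\<lambda>b. y b x) b) (gibbs p (\<lambda>b. y' b x) b) \<le> 1 + 2 * B"
    if p: "\<forall>b. 0 < p b" and y: "close_pair m k S \<delta> G B x y y'"
    for p :: "'h \<Rightarrow> real" and S :: "'p set" and \<delta> G x and y y' :: "'h \<Rightarrow> (real, 'p) vec \<Rightarrow> real" and b m k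
  proof -
    have "\<bar>gibbs p (\<lambda>b. y b x) b - gibbs p (\<lambda>b. y' b x) b\<bar> \<le> 2 * (B * \<delta>)"
      by (rule gibbs_lipschitz[OF p]) (use close_pairD[OF y] in blast)
    then have "\<bar>gibbs p (\<lambda>b. y b x) b - gibbs p (\<lambda>b. y' b x) b\<bar> / \<delta> \<le> 2 * B"
      using close_pairD(1)[OF y] by (simp add: field_simps)
    moreover have "\<bar>gibbs p (\<lambda>b. y b x) b\<bar> \<le> 1"
      using gibbs_nonneg[OF p, of "\<lambda>b. y b x" b] gibbs_le_1[OF p, of "\<lambda>b. y b x" b] by simp
    ultimately show ?thesis by (simp add: pair_norm_def)
  qed
  show ?thesis
  proof (induction k)
    case 0
    show ?case by (rule exI[of _ "1 + 2 * B"]) (use B zero in auto)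
  next
    case (Suc k)
    then obtain A where A: "A \<ge> 1" and IH: "?bound k A" by blast
    define A1 where "A1 = 2 ^ k * A * (B + (\<Sum>c\<in>(UNIV::'h set). 2 ^ k * A * B))"
    have A1: "0 \<le> A1" unfolding A1_def using A B by (intro mult_nonneg_nonneg add_nonneg_nonneg sum_nonneg) auto
    show ?case
    proof (rule exI[of _ "1 + 2 * B + A1"], intro conjI allI impI)
      show "1 \<le> 1 + 2 * B + A1" using B A1 by simp
      fix p :: "'h \<Rightarrow> real" and S :: "'p set" and \<delta> G x and y y' :: "'h \<Rightarrow> (real, 'p) vec \<Rightarrow> real" and b
      assume p: "\<forall>b. 0 < p b" and y: "close_pair (Suc k) (Suc k) S \<delta> G B x y y'"
      note d = close_pairD(1,2)[OF y] and G = close_pairD(3)[OF y]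
      have "pair_bound k (S \<inter> {..i}) \<delta> G (A1 * G) x (partial_deriv i (\<lambda>x. gibbs p (\<lambda>b. y b x) b))
          (partial_deriv i (\<lambda>x. gibbs p (\<lambda>b. y' b x) b))" if i: "i \<in> S" for i
      proof -
        let ?S = "S \<inter> {..i}"
        have ex: "\<forall>b x. partial_deriv_exists i (y b) x" "\<forall>b x. partial_deriv_exists i (y' b) x"
          and sm: "\<And>b. smooth k ?S (partial_deriv i (y b))" "\<And>b. smooth k ?S (partial_deriv i (y' b))"
          using close_pairD(4,5)[OF y] i by (auto simp: smooth_Suc)
        have y': "close_pair k k ?S \<delta> G B x y y'" by (rule close_pair_mono[OF y]) auto
        have db: "pair_bound k ?S \<delta> G (B * G) x (partial_deriv i (y b)) (partial_deriv i (y' b))" for b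
          using close_pairD(7)[OF y] i by (rule deriv_bound_SucD)
        have gb: "pair_bound k ?S \<delta> G A x (\<lambda>x. gibbs p (\<lambda>b. y b x) b) (\<lambda>x. gibbs p (\<lambda>b. y' b x) b)" for b
          using IH p y' by blast
        have sg: "smooth k ?S (\<lambda>x. gibbs p (\<lambda>b. y b x) b)" "smooth k ?S (\<lambda>x. gibbs p (\<lambda>b. y' b x) b)" for b
          by (intro smooth_gibbs p close_pairD(4,5)[OF y'])+
        have BG: "0 \<le> B * G" using B G by simp
        have "pair_bound k ?S \<delta> G (2 ^ k * A * (B * G + (\<Sum>c\<in>(UNIV::'h set). 2 ^ k * A * (B * G)))) x
          (\<lambda>x. gibbs p (\<lambda>b. y b x) b * (partial_deriv i (y b) x + - (\<Sum>c\<in>UNIV. gibbs p (\<lambda>b. y b x) c * partial_deriv i (y c) x)))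
          (\<lambda>x. gibbs p (\<lambda>b. y' b x) b * (partial_deriv i (y' b) x + - (\<Sum>c\<in>UNIV. gibbs p (\<lambda>b. y' b x) c * partial_deriv i (y' c) x)))"
          using A BG
          by (intro pair_bound_mult pair_bound_add pair_bound_minus pair_bound_sum smooth_add smooth_minus
              smooth_sum smooth_mult d G gb db sg sm finite add_nonneg_nonneg sum_nonneg) auto
        also have "2 ^ k * A * (B * G + (\<Sum>c\<in>(UNIV::'h set). 2 ^ k * A * (B * G))) = A1 * G"
          by (simp add: A1_def algebra_simps)
        finally show ?thesis
          by (simp add: partial_deriv_gibbs(2)[OF p ex(1)] partial_deriv_gibbs(2)[OF p ex(2)])
      qed
      then have "pair_bound k (S \<inter> {..i}) \<delta> G ((1 + 2 * B + A1) * G) x (partial_deriv i (\<lambda>x. gibbs p (\<lambda>b. y b x) b))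
          (partial_deriv i (\<lambda>x. gibbs p (\<lambda>b. y' b x) b))" if i: "i \<in> S" for i
        by (rule pair_bound_mono) (use i B G in \<open>auto intro!: mult_right_mono\<close>)
      moreover have "pair_norm \<delta> (gibbs p (\<lambda>b. y b x) b) (gibbs p (\<lambda>b. y' b x) b) \<le> 1 + 2 * B + A1"
        using zero[OF p y, of b] A1 by simp
      ultimately show "pair_bound (Suc k) S \<delta> G (1 + 2 * B + A1) x
          (\<lambda>x. gibbs p (\<lambda>b. y b x) b) (\<lambda>x. gibbs p (\<lambda>b. y' b x) b)"
        unfolding pair_bound_Suc by blast
    qed
  qed
qed

text \<open>
  The derivative of order \<open>I\<close> of \<open>lse\<close> without the terms that contain derivatives of order \<open>I\<close> of \<open>y\<close>.
\<close>

definition lse_remainder ::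
  "'p::{finite,linorder} list \<Rightarrow> ('h::finite \<Rightarrow> real) \<Rightarrow> ('h \<Rightarrow> (real, 'p) vec \<Rightarrow> real) \<Rightarrow> (real, 'p) vec \<Rightarrow> real" where
  "lse_remainder I p y x = iter_partial I (\<lambda>x. lse p (\<lambda>b. y b x)) x -
     (\<Sum>b\<in>UNIV. gibbs p (\<lambda>b. y b x) b * iter_partial I (y b) x)"

text \<open>
  The first derivative of \<open>lse\<close> is \<open>\<Sum>\<^sub>b W\<^sub>b \<partial>y\<^sub>b\<close>. When it is differentiated further, the terms in which
  all derivatives fall on \<open>y\<close> are the ones subtracted in the remainder, and the other ones are
  commutators, which contain only derivatives of \<open>y\<close> of order at most \<open>k\<close>.
\<close>

lemma lse_remainder_bound:
  assumes B: "0 \<le> B"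
  shows "\<exists>A\<ge>0. \<forall>(p :: 'h::finite \<Rightarrow> real) \<delta> G x y y' (I :: 'p::{finite,linorder} list).
     (\<forall>b. 0 < p b) \<longrightarrow> close_pair (Suc k) k UNIV \<delta> G B x y y' \<longrightarrow> sorted I \<longrightarrow> length I = Suc k \<longrightarrow>
     pair_norm \<delta> (lse_remainder I p y x) (lse_remainder I p y' x) \<le> A * G ^ Suc k"
proof -
  from pair_bound_gibbs[OF B, where ?'h = 'h and ?'p = 'p and k = k]
  obtain A where A: "A \<ge> 1" and gb: "\<And>(p :: 'h \<Rightarrow> real) (S :: 'p set) \<delta> G x y y' b.
     \<lbrakk>\<forall>b. 0 < p b; close_pair k k S \<delta> G B x y y'\<rbrakk> \<Longrightarrow>
     pair_bound k S \<delta> G A x (\<lambda>x. gibbs p (\<lambda>b. y b x) b) (\<lambda>x. gibbs p (\<lambda>b. y' b x) b)"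
    by blast
  define A1 where "A1 = (\<Sum>c\<in>(UNIV::'h set). 2 ^ k * A * B)"
  have A1: "0 \<le> A1" unfolding A1_def using A B by (intro sum_nonneg) auto
  show ?thesis
  proof (rule exI[of _ A1], intro conjI allI impI A1)
    fix p :: "'h \<Rightarrow> real" and \<delta> G x and y y' :: "'h \<Rightarrow> (real, 'p) vec \<Rightarrow> real" and I :: "'p list"
    assume p: "\<forall>b. 0 < p b" and y: "close_pair (Suc k) k UNIV \<delta> G B x y y'"
      and I: "sorted I" "length I = Suc k"
    note d = close_pairD(1,2)[OF y] and G = close_pairD(3)[OF y]
    obtain J i where Ji: "I = J @ [i]" using I by (cases I rule: rev_cases) auto
    let ?S = "UNIV \<inter> {..i}"
    have J: "sorted J" "length J \<le> k" "set J \<subseteq> ?S" and lJ: "length J = k"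
      using I Ji by (auto simp: sorted_snoc_iff)
    have ex: "\<forall>b x. partial_deriv_exists i (y b) x" "\<forall>b x. partial_deriv_exists i (y' b) x"
      and sm: "\<And>b. smooth k ?S (partial_deriv i (y b))" "\<And>b. smooth k ?S (partial_deriv i (y' b))"
      using close_pairD(4,5)[OF y] by (auto simp: smooth_Suc)
    have y': "close_pair k k ?S \<delta> G B x y y'" by (rule close_pair_mono[OF y]) auto
    have gbb: "pair_bound k ?S \<delta> G A x (\<lambda>x. gibbs p (\<lambda>b. y b x) b) (\<lambda>x. gibbs p (\<lambda>b. y' b x) b)" for b
      by (rule gb[OF p y'])
    have sg: "smooth k ?S (\<lambda>x. gibbs p (\<lambda>b. y b x) b)" "smooth k ?S (\<lambda>x. gibbs p (\<lambda>b. y' b x) b)" for b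
      by (intro smooth_gibbs p close_pairD(4,5)[OF y'])+
    have eq: "lse_remainder I p y x
       = (\<Sum>b\<in>UNIV. iter_partial J (\<lambda>x. gibbs p (\<lambda>b. y b x) b * partial_deriv i (y b) x) x -
            gibbs p (\<lambda>b. y b x) b * iter_partial J (partial_deriv i (y b)) x)"
      if "\<forall>b x. partial_deriv_exists i (y b) x" "\<And>b. smooth k ?S (partial_deriv i (y b))"
        "\<And>b. smooth k ?S (\<lambda>x. gibbs p (\<lambda>b. y b x) b)" for y
    proof -
      have "iter_partial J (\<lambda>x. \<Sum>b\<in>UNIV. gibbs p (\<lambda>b. y b x) b * partial_deriv i (y b) x) =
         (\<lambda>x. \<Sum>b\<in>UNIV. iter_partial J (\<lambda>x. gibbs p (\<lambda>b. y b x) b * partial_deriv i (y b) x) x)"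
        by (rule iter_partial_sum(2)) (auto intro!: smoothD[OF smooth_mult[OF that(3,2)] J])
      then show ?thesis unfolding Ji iter_partial_append lse_remainder_def
        using p by (simp add: partial_deriv_lse(2)[OF p that(1)] sum_subtractf)
    qed
    have comm: "pair_norm \<delta>
        (iter_partial J (\<lambda>x. gibbs p (\<lambda>b. y b x) b * partial_deriv i (y b) x) x -
            gibbs p (\<lambda>b. y b x) b * iter_partial J (partial_deriv i (y b)) x)
        (iter_partial J (\<lambda>x. gibbs p (\<lambda>b. y' b x) b * partial_deriv i (y' b) x) x -
            gibbs p (\<lambda>b. y' b x) b * iter_partial J (partial_deriv i (y' b)) x) \<le> 2 ^ k * A * (B * G) * G ^ length J" for b
    proof (cases k)
      case 0
      then have "J = []" using lJ by simp
      then show ?thesis using A B G by simp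
    next
      case (Suc k')
      have "pair_bound (k - 1) ?S \<delta> G (B * G) x (partial_deriv i (y b)) (partial_deriv i (y' b))"
        using close_pairD(7)[OF y] Suc by (intro deriv_bound_SucD) auto
      then show ?thesis
        by (intro pair_bound_commutator[OF d G _ _ J gbb]) (use A B G sg sm in auto)
    qed
    have "pair_norm \<delta> (lse_remainder I p y x) (lse_remainder I p y' x)
       \<le> (\<Sum>b\<in>(UNIV::'h set). 2 ^ k * A * (B * G) * G ^ length J)"
      unfolding eq[of y, OF ex(1) sm(1) sg(1)] eq[of y', OF ex(2) sm(2) sg(2)]
      by (rule order_trans[OF pair_norm_sum[OF d(1)] sum_mono]) (rule comm)
    also have "\<dots> = A1 * G ^ Suc k" by (simp add: A1_def lJ algebra_simps)
    finally show "pair_norm \<delta> (lse_remainder I p y x) (lse_remainder I p y' x) \<le> A1 * G ^ Suc k" .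
  qed
qed

lemma sum_weights_bound:
  fixes w v :: "'h::finite \<Rightarrow> real"
  assumes "\<And>b. \<bar>w b\<bar> \<le> K" "\<And>b. \<bar>v b\<bar> \<le> L"
  shows "\<bar>\<Sum>b\<in>UNIV. w b * v b\<bar> \<le> real CARD('h) * (K * L)"
proof -
  have "\<bar>\<Sum>b\<in>UNIV. w b * v b\<bar> \<le> (\<Sum>b\<in>(UNIV::'h set). K * L)"
    using assms by (intro order_trans[OF sum_abs] sum_mono)
      (auto simp: abs_mult intro!: mult_mono intro: order_trans[OF abs_ge_zero])
  then show ?thesis by simp
qed

text \<open>
  One step of the recursion at the highest order. The Gibbs averages of the highest derivatives of
  \<open>y - y'\<close> are contracted; the change of the Gibbs weights, which is of order \<open>\<delta>\<close>, multiplies the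
  highest derivatives of \<open>y'\<close>, bounded by \<open>T\<close>; the remainders differ by a multiple of \<open>\<delta> G\<^sup>k\<^sup>+\<^sup>1\<close>.
\<close>

lemma lse_deriv_diff_osc:
  assumes B: "0 \<le> B" and \<phi>: "0 < \<phi>"
  shows "\<exists>A\<ge>0. \<forall>(p :: 'h::finite \<Rightarrow> real) p' \<delta> G x y y' (I :: 'p::{finite,linorder} list) T K.
     (\<forall>b. \<phi> \<le> p b \<and> p b \<le> 1) \<longrightarrow> (\<forall>b. \<phi> \<le> p' b \<and> p' b \<le> 1) \<longrightarrow>
     close_pair (Suc k) k UNIV \<delta> G B x y y' \<longrightarrow> sorted I \<longrightarrow> length I = Suc k \<longrightarrow>
     (\<forall>b. \<bar>iter_partial I (y' b) x\<bar> \<le> T) \<longrightarrow>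
     (\<forall>b c. \<bar>(iter_partial I (y b) x - iter_partial I (y' b) x) -
             (iter_partial I (y c) x - iter_partial I (y' c) x)\<bar> \<le> K) \<longrightarrow>
     \<bar>(iter_partial I (\<lambda>x. lse p (\<lambda>b. y b x)) x - iter_partial I (\<lambda>x. lse p (\<lambda>b. y' b x)) x) -
      (iter_partial I (\<lambda>x. lse p' (\<lambda>b. y b x)) x - iter_partial I (\<lambda>x. lse p' (\<lambda>b. y' b x)) x)\<bar>
     \<le> (1 - \<phi>) * K + A * \<delta> * (T + G ^ Suc k)"
proof -
  from lse_remainder_bound[OF B, where ?'h = 'h and ?'p = 'p and k = k]
  obtain A where A: "A \<ge> 0" and rem: "\<And>(p :: 'h \<Rightarrow> real) \<delta> G x y y' (I :: 'p list).
     \<lbrakk>\<forall>b. 0 < p b; close_pair (Suc k) k UNIV \<delta> G B x y y'; sorted I; length I = Suc k\<rbrakk> \<Longrightarrow>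
     pair_norm \<delta> (lse_remainder I p y x) (lse_remainder I p y' x) \<le> A * G ^ Suc k"
    by blast
  define A' where "A' = real CARD('h) * (4 * B) + 2 * A"
  show ?thesis
  proof (rule exI[of _ A'], intro conjI allI impI)
    show "0 \<le> A'" using A B by (simp add: A'_def)
    fix p p' :: "'h \<Rightarrow> real" and \<delta> G x and y y' :: "'h \<Rightarrow> (real, 'p) vec \<Rightarrow> real" and I :: "'p list" and T K
    assume p: "\<forall>b. \<phi> \<le> p b \<and> p b \<le> 1" and p': "\<forall>b. \<phi> \<le> p' b \<and> p' b \<le> 1"
      and y: "close_pair (Suc k) k UNIV \<delta> G B x y y'" and I: "sorted I" "length I = Suc k"
      and T: "\<forall>b. \<bar>iter_partial I (y' b) x\<bar> \<le> T"
      and K: "\<forall>b c. \<bar>(iter_partial I (y b) x - iter_partial I (y' b) x) -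
             (iter_partial I (y c) x - iter_partial I (y' c) x)\<bar> \<le> K"
    note \<delta> = close_pairD(1)[OF y] and G = close_pairD(3)[OF y]
    have pos: "\<forall>b. 0 < p b" "\<forall>b. 0 < p' b" using p p' \<phi> by (meson less_le_trans)+
    have R: "\<bar>lse_remainder I p y x - lse_remainder I p y' x\<bar> \<le> A * G ^ Suc k * \<delta>" if "\<forall>b. 0 < p b" for p
    proof -
      have "\<bar>lse_remainder I p y x\<bar> + \<bar>lse_remainder I p y x - lse_remainder I p y' x\<bar> / \<delta> \<le> A * G ^ Suc k"
        using rem[OF that y I] unfolding pair_norm_def .
      then have "\<bar>lse_remainder I p y x - lse_remainder I p y' x\<bar> / \<delta> \<le> A * G ^ Suc k" by linarith
      then show ?thesis using \<delta> by (simp add: divide_le_eq)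
    qed
    define W where "W = (\<lambda>(p :: 'h \<Rightarrow> real) y b. gibbs p (\<lambda>b. y b x) b)"
    define v v' where "v = (\<lambda>b. iter_partial I (y b) x)" and "v' = (\<lambda>b. iter_partial I (y' b) x)"
    have avg: "\<bar>\<Sum>b\<in>UNIV. (W p y b - W p' y b) * (v b - v' b)\<bar> \<le> (1 - \<phi>) * K"
      unfolding W_def by (rule gibbs_average_osc[OF \<phi> p p']) (use K in \<open>simp add: v_def v'_def\<close>)
    have Wd: "\<bar>W p y b - W p y' b\<bar> \<le> 2 * (B * \<delta>)" if "\<forall>b. 0 < p b" for p b
      unfolding W_def by (rule gibbs_lipschitz[OF that]) (use close_pairD(6)[OF y] in blast)
    have W2: "\<bar>\<Sum>b\<in>UNIV. ((W p y b - W p y' b) - (W p' y b - W p' y' b)) * v' b\<bar>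
        \<le> real CARD('h) * ((4 * (B * \<delta>)) * T)"
    proof (rule sum_weights_bound)
      fix b
      show "\<bar>W p y b - W p y' b - (W p' y b - W p' y' b)\<bar> \<le> 4 * (B * \<delta>)"
        using Wd[OF pos(1), of b] Wd[OF pos(2), of b] by linarith
      show "\<bar>v' b\<bar> \<le> T" using T by (simp add: v'_def)
    qed
    have "(iter_partial I (\<lambda>x. lse p (\<lambda>b. y b x)) x - iter_partial I (\<lambda>x. lse p (\<lambda>b. y' b x)) x) -
      (iter_partial I (\<lambda>x. lse p' (\<lambda>b. y b x)) x - iter_partial I (\<lambda>x. lse p' (\<lambda>b. y' b x)) x) =
        (\<Sum>b\<in>UNIV. (W p y b - W p' y b) * (v b - v' b))
        + (\<Sum>b\<in>UNIV. ((W p y b - W p y' b) - (W p' y b - W p' y' b)) * v' b)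
        + (lse_remainder I p y x - lse_remainder I p y' x) - (lse_remainder I p' y x - lse_remainder I p' y' x)"
      unfolding lse_remainder_def W_def v_def v'_def
      by (simp add: left_diff_distrib right_diff_distrib sum_subtractf)
    then have "\<bar>(iter_partial I (\<lambda>x. lse p (\<lambda>b. y b x)) x - iter_partial I (\<lambda>x. lse p (\<lambda>b. y' b x)) x) -
      (iter_partial I (\<lambda>x. lse p' (\<lambda>b. y b x)) x - iter_partial I (\<lambda>x. lse p' (\<lambda>b. y' b x)) x)\<bar>
      \<le> (1 - \<phi>) * K + real CARD('h) * ((4 * (B * \<delta>)) * T) + A * G ^ Suc k * \<delta> + A * G ^ Suc k * \<delta>"
      using avg W2 R[OF pos(1)] R[OF pos(2)] by linarith
    also have "\<dots> = (1 - \<phi>) * K + \<delta> * (real CARD('h) * (4 * B) * T + 2 * A * G ^ Suc k)"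
      by (simp add: algebra_simps)
    also have "\<dots> \<le> (1 - \<phi>) * K + \<delta> * (A' * T + A' * G ^ Suc k)"
    proof -
      have "0 \<le> T" using order_trans[OF abs_ge_zero] T by blast
      then have "real CARD('h) * (4 * B) * T \<le> A' * T" "2 * A * G ^ Suc k \<le> A' * G ^ Suc k"
        using A B G unfolding A'_def by (auto intro!: mult_right_mono simp del: power_Suc)
      then show ?thesis using \<delta> by (simp del: power_Suc add: mult_left_mono add_mono)
    qed
    finally show "\<bar>(iter_partial I (\<lambda>x. lse p (\<lambda>b. y b x)) x - iter_partial I (\<lambda>x. lse p (\<lambda>b. y' b x)) x) -
      (iter_partial I (\<lambda>x. lse p' (\<lambda>b. y b x)) x - iter_partial I (\<lambda>x. lse p' (\<lambda>b. y' b x)) x)\<bar>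
      \<le> (1 - \<phi>) * K + A' * \<delta> * (T + G ^ Suc k)"
      by (simp add: algebra_simps)
  qed
qed

section \<open>Exponential forgetting of the backward recursion\<close>

text \<open>
  The first number is the number of remaining steps and the second one the current time. Subtracting
  the value at the reference state \<open>\<iota>\<close> makes the values equal to their oscillation up to a factor, and it
  is the oscillation that is contracted.
\<close>

primrec logback :: "(nat \<Rightarrow> 'h \<Rightarrow> 'h \<Rightarrow> real) \<Rightarrow> (nat \<Rightarrow> 'h \<Rightarrow> 'e \<Rightarrow> real) \<Rightarrow> 'h \<Rightarrow> nat \<Rightarrow> nat \<Rightarrow> 'h::finite \<Rightarrow> 'e \<Rightarrow> real" where
  "logback P l \<iota> 0 = (\<lambda>s a x. 0)"
| "logback P l \<iota> (Suc j) = (\<lambda>s a x.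
     lse (P s a) (\<lambda>b. l (Suc s) b x + logback P l \<iota> j (Suc s) b x) -
     lse (P s \<iota>) (\<lambda>b. l (Suc s) b x + logback P l \<iota> j (Suc s) b x))"

lemma logback_ref: "logback P l \<iota> j s \<iota> = (\<lambda>x. 0)"
  by (cases j) auto

lemma logback_step_osc:
  assumes \<phi>: "0 < \<phi>" and P: "\<forall>s a b. \<phi> \<le> P s a b \<and> P s a b \<le> 1"
  shows "\<bar>(logback P l \<iota> j s a x - logback P l \<iota> (Suc j) s a x) - (logback P l \<iota> j s a' x - logback P l \<iota> (Suc j) s a' x)\<bar>
     \<le> - ln \<phi> * (1 - \<phi>) ^ j"
proof (induction j arbitrary: s a a')
  case 0
  show ?case using lse_kernel_osc[OF \<phi>, of "P s a'" "P s a"] P by simp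
next
  case (Suc j)
  let ?y = "\<lambda>b. l (Suc s) b x + logback P l \<iota> j (Suc s) b x"
  let ?y' = "\<lambda>b. l (Suc s) b x + logback P l \<iota> (Suc j) (Suc s) b x"
  have "\<bar>(lse (P s a) ?y - lse (P s a) ?y') - (lse (P s a') ?y - lse (P s a') ?y')\<bar>
      \<le> (1 - \<phi>) * (- ln \<phi> * (1 - \<phi>) ^ j)"
    by (rule lse_diff_osc[OF \<phi>]) (use P Suc.IH[of "Suc s"] in auto)
  then show ?case by (simp add: algebra_simps)
qed

lemma logback_bound:
  assumes \<phi>: "0 < \<phi>" "\<phi> \<le> 1" and P: "\<forall>s a b. \<phi> \<le> P s a b \<and> P s a b \<le> 1"
  shows "\<bar>logback P l \<iota> n s a x\<bar> \<le> - ln \<phi>"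
  using lse_kernel_osc[OF \<phi>(1), of "P s a" "P s \<iota>"] P \<phi> by (cases n) auto

text \<open>
  The exponential allowance \<open>g / \<kappa>\<^sup>s\<close> absorbs the unboundedness of a stationary sequence of
  log-likelihood derivatives.
\<close>

definition regular_data ::
  "real \<Rightarrow> real \<Rightarrow> nat \<Rightarrow> (nat \<Rightarrow> 'h \<Rightarrow> 'h \<Rightarrow> real) \<Rightarrow>
    (nat \<Rightarrow> 'h \<Rightarrow> (real, 'p::{finite,linorder}) vec \<Rightarrow> real) \<Rightarrow> real \<Rightarrow> (real, 'p) vec \<Rightarrow> bool" where
  "regular_data \<phi> \<kappa> q P l g x \<longleftrightarrow>
     (\<forall>s a b. \<phi> \<le> P s a b \<and> P s a b \<le> 1) \<and> 1 \<le> g \<and> (\<forall>s b. smooth q UNIV (l s b)) \<and>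
     (\<forall>s\<ge>1. \<forall>b I. sorted I \<longrightarrow> I \<noteq> [] \<longrightarrow> length I \<le> q \<longrightarrow> \<bar>iter_partial I (l s b) x\<bar> \<le> g / \<kappa> ^ s)"

lemma smooth_logback:
  assumes P: "\<forall>s a b. 0 < P s a b" and l: "\<forall>s b. smooth q S (l s b)"
  shows "smooth q S (logback P l \<iota> j s a)"
proof (induction j arbitrary: s a)
  case 0
  then show ?case by (simp add: smooth_const)
next
  case (Suc j)
  have "smooth q S (\<lambda>x. lse (P s a) (\<lambda>b. l (Suc s) b x + logback P l \<iota> j (Suc s) b x))" for a
    by (intro smooth_lse smooth_add Suc.IH) (use P l in auto)
  then show ?case by (simp add: smooth_diff)
qed

lemma regular_dataD:
  assumes "regular_data \<phi> \<kappa> q P l g x"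
  shows "\<forall>s a b. \<phi> \<le> P s a b \<and> P s a b \<le> 1" "1 \<le> g" "\<forall>s b. smooth q UNIV (l s b)"
    "\<And>s b I. s \<ge> 1 \<Longrightarrow> sorted I \<Longrightarrow> I \<noteq> [] \<Longrightarrow> length I \<le> q \<Longrightarrow> \<bar>iter_partial I (l s b) x\<bar> \<le> g / \<kappa> ^ s"
  using assms unfolding regular_data_def by blast+

lemma regular_data_scale_ge_1:
  assumes "regular_data \<phi> \<kappa> q P l g x" "0 < \<kappa>" "\<kappa> \<le> 1"
  shows "1 \<le> g / \<kappa> ^ s"
  using regular_dataD(2)[OF assms(1)] assms(2,3) power_le_one[of \<kappa> s] by (simp add: le_divide_eq)

definition step_arg ::
  "(nat \<Rightarrow> 'h \<Rightarrow> 'h \<Rightarrow> real) \<Rightarrow> (nat \<Rightarrow> 'h \<Rightarrow> 'e \<Rightarrow> real) \<Rightarrow> 'h::finite \<Rightarrow> nat \<Rightarrow> nat \<Rightarrow> 'h \<Rightarrow> 'e \<Rightarrow> real" where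
  "step_arg P l \<iota> j s b x = l (Suc s) b x + logback P l \<iota> j (Suc s) b x"

lemma iter_partial_step_arg:
  assumes \<phi>: "0 < \<phi>" and reg: "regular_data \<phi> \<kappa> q P l g x"
  shows "smooth q UNIV (step_arg P l \<iota> j s b)"
    and "sorted I \<Longrightarrow> length I \<le> q \<Longrightarrow> iter_partial I (step_arg P l \<iota> j s b) x =
      iter_partial I (l (Suc s) b) x + iter_partial I (logback P l \<iota> j (Suc s) b) x"
    and "sorted I \<Longrightarrow> length I \<le> q \<Longrightarrow> iter_partial I (logback P l \<iota> (Suc j) s a) x =
      iter_partial I (\<lambda>x. lse (P s a) (\<lambda>b. step_arg P l \<iota> j s b x)) x -
      iter_partial I (\<lambda>x. lse (P s \<iota>) (\<lambda>b. step_arg P l \<iota> j s b x)) x"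
proof -
  note P = regular_dataD(1)[OF reg] and l = regular_dataD(3)[OF reg]
  have pos: "\<forall>s a b. 0 < P s a b" using P \<phi> by (meson less_le_trans)
  have smb: "smooth q UNIV (logback P l \<iota> j (Suc s) b)" for b by (rule smooth_logback[OF pos l])
  have eq: "step_arg P l \<iota> j s b = (\<lambda>x. l (Suc s) b x + logback P l \<iota> j (Suc s) b x)" for b
    by (rule ext) (rule step_arg_def)
  show sm: "smooth q UNIV (step_arg P l \<iota> j s b)" for b
    unfolding eq by (intro smooth_add smb l[rule_format])
  show "iter_partial I (step_arg P l \<iota> j s b) x =
      iter_partial I (l (Suc s) b) x + iter_partial I (logback P l \<iota> j (Suc s) b) x" if "sorted I" "length I \<le> q"
    unfolding eq using iter_partial_add(2)[OF smoothD[OF l[rule_format]] smoothD[OF smb], of I "Suc s" b b] that by simp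
  show "iter_partial I (logback P l \<iota> (Suc j) s a) x =
      iter_partial I (\<lambda>x. lse (P s a) (\<lambda>b. step_arg P l \<iota> j s b x)) x -
      iter_partial I (\<lambda>x. lse (P s \<iota>) (\<lambda>b. step_arg P l \<iota> j s b x)) x" if "sorted I" "length I \<le> q"
  proof -
    have "iter_partial_exists I (\<lambda>x. lse (P s a) (\<lambda>b. step_arg P l \<iota> j s b x))" for a
      using pos sm that by (intro smoothD[OF smooth_lse, of _ q UNIV]) auto
    then show ?thesis by (simp add: iter_partial_diff(2) step_arg_def)
  qed
qed

text \<open>
  Induction on the order \<open>k\<close>, and for a new order on the number of steps. With \<open>G = g / \<kappa>\<^sup>s\<^sup>+\<^sup>1\<close>, a bound
  \<open>C' G\<^sup>k\<close> at time \<open>s + 1\<close> is turned into \<open>((1 - \<phi>) C' + const) G\<^sup>k\<close> at time \<open>s\<close>, where \<open>C' \<kappa>\<^sup>k G\<^sup>k\<close> is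
  wanted; as \<open>1 - \<phi> < \<kappa>\<^sup>q\<close>, this holds for large \<open>C'\<close>.
\<close>

lemma logback_deriv_bound:
  fixes \<phi> \<kappa> :: real
  assumes \<phi>: "0 < \<phi>" "\<phi> \<le> 1" and \<kappa>: "0 < \<kappa>" "\<kappa> \<le> 1" and contr: "1 - \<phi> < \<kappa> ^ q"
  shows "k \<le> q \<Longrightarrow> \<exists>C\<ge>1. \<forall>(P :: nat \<Rightarrow> 'h::finite \<Rightarrow> 'h \<Rightarrow> real) l \<iota> g x j s a a' (I :: 'p::{finite,linorder} list).
    regular_data \<phi> \<kappa> q P l g x \<longrightarrow> sorted I \<longrightarrow> I \<noteq> [] \<longrightarrow> length I \<le> k \<longrightarrow>
    \<bar>iter_partial I (logback P l \<iota> j s a) x - iter_partial I (logback P l \<iota> j s a') x\<bar> \<le> C * (g / \<kappa> ^ s) ^ length I"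
    (is "_ \<Longrightarrow> \<exists>C\<ge>1. ?bound k C")
proof (induction k)
  case 0
  then show ?case by (intro exI[of _ 1]) auto
next
  case (Suc k)
  then obtain C where C: "C \<ge> 1" and IH: "?bound k C" by auto
  have B: "0 \<le> 2 * (1 + C)" using C by simp
  from lse_deriv_diff_osc[OF B \<phi>(1), where ?'h = 'h and ?'p = 'p and k = k]
  obtain A where A: "A \<ge> 0" and step: "\<And>(p :: 'h \<Rightarrow> real) p' \<delta> G x y y' (I :: 'p list) T K.
     \<lbrakk>\<forall>b. \<phi> \<le> p b \<and> p b \<le> 1; \<forall>b. \<phi> \<le> p' b \<and> p' b \<le> 1;
     close_pair (Suc k) k UNIV \<delta> G (2 * (1 + C)) x y y'; sorted I; length I = Suc k;
     \<forall>b. \<bar>iter_partial I (y' b) x\<bar> \<le> T;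
     \<forall>b c. \<bar>(iter_partial I (y b) x - iter_partial I (y' b) x) -
             (iter_partial I (y c) x - iter_partial I (y' c) x)\<bar> \<le> K\<rbrakk> \<Longrightarrow>
     \<bar>(iter_partial I (\<lambda>x. lse p (\<lambda>b. y b x)) x - iter_partial I (\<lambda>x. lse p (\<lambda>b. y' b x)) x) -
      (iter_partial I (\<lambda>x. lse p' (\<lambda>b. y b x)) x - iter_partial I (\<lambda>x. lse p' (\<lambda>b. y' b x)) x)\<bar>
     \<le> (1 - \<phi>) * K + A * \<delta> * (T + G ^ Suc k)"
    by blast
  \<comment> \<open>The gap \<open>r\<close> between the decrease of the bound and the contraction decides how large the new constant has to be.\<close>
  define r where "r = \<kappa> ^ q - (1 - \<phi>)"
  have r: "0 < r" using contr by (simp add: r_def)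
  define C' where "C' = max C ((2 + A) / r)"
  have C': "1 \<le> C'" "C \<le> C'" "(2 + A) / r \<le> C'" using C by (auto simp: C'_def)
  then have C'r: "2 + A \<le> C' * r" using r by (simp add: divide_le_eq)
  show ?case
  proof (rule exI[of _ C'], intro conjI allI impI)
    show "1 \<le> C'" by (rule C')
    fix P :: "nat \<Rightarrow> 'h \<Rightarrow> 'h \<Rightarrow> real" and l :: "nat \<Rightarrow> 'h \<Rightarrow> (real, 'p) vec \<Rightarrow> real" and \<iota> g x j s a a' and I :: "'p list"
    assume reg: "regular_data \<phi> \<kappa> q P l g x" and I: "sorted I" "I \<noteq> []" "length I \<le> Suc k"
    note P = regular_dataD(1)[OF reg] and lb = regular_dataD(4)[OF reg]
      and G1 = regular_data_scale_ge_1[OF reg \<kappa>]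
    have Pa: "\<forall>b. \<phi> \<le> P s a b \<and> P s a b \<le> 1" for s a using P by blast
    show "\<bar>iter_partial I (logback P l \<iota> j s a) x - iter_partial I (logback P l \<iota> j s a') x\<bar> \<le> C' * (g / \<kappa> ^ s) ^ length I"
    proof (cases "length I \<le> k")
      case True
      have "\<bar>iter_partial I (logback P l \<iota> j s a) x - iter_partial I (logback P l \<iota> j s a') x\<bar> \<le> C * (g / \<kappa> ^ s) ^ length I"
        using IH reg I(1,2) True by blast
      also have "\<dots> \<le> C' * (g / \<kappa> ^ s) ^ length I"
        using C' G1[of s] by (intro mult_right_mono) auto
      finally show ?thesis .
    next
      case False
      then have len: "length I = Suc k" using I by simp
      show ?thesis
      proof (induction j arbitrary: s a a')
        case 0
        then show ?case using C' G1[of s] I by (simp add: iter_partial_const)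
      next
        case (Suc j)
        define G where "G = g / \<kappa> ^ Suc s"
        have G: "1 \<le> G" unfolding G_def by (rule G1)
        have Gs: "g / \<kappa> ^ s = \<kappa> * G" using \<kappa> by (simp add: G_def)
        define y where "y = step_arg P l \<iota> j s"
        note y_rules = iter_partial_step_arg[where \<iota> = \<iota> and j = j and s = s, OF \<phi>(1) reg, folded y_def]
        have lG: "\<bar>iter_partial J (l (Suc s) b) x\<bar> \<le> G ^ length J"
          if J: "sorted J" "J \<noteq> []" "length J \<le> q" for J b
        proof -
          have "\<bar>iter_partial J (l (Suc s) b) x\<bar> \<le> G" using lb[of "Suc s" J b] J by (simp add: G_def)
          also have "G \<le> G ^ length J" using G J by (intro self_le_power) auto
          finally show ?thesis .
        qed
        \<comment> \<open>The bound comes from comparing \<open>y\<close> with the constant functions of the same value, for which all derivatives vanish.\<close>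
        have y': "close_pair (Suc k) k UNIV 1 G (2 * (1 + C)) x y (\<lambda>b _. y b x)"
          unfolding close_pair_def
        proof (intro conjI allI)
          fix b
          show "smooth (Suc k) UNIV (y b)" by (rule smooth_mono[OF y_rules(1) \<open>Suc k \<le> q\<close> subset_refl])
          show "\<bar>y b x - y b x\<bar> \<le> 2 * (1 + C) * 1" using C by simp
          show "deriv_bound k UNIV 1 G (2 * (1 + C)) x (y b) (\<lambda>_. y b x)"
            unfolding deriv_bound_def
          proof (intro allI impI)
            fix J :: "'p list" assume J: "sorted J" "J \<noteq> []" "length J \<le> k"
            have "\<bar>iter_partial J (logback P l \<iota> j (Suc s) b) x - iter_partial J (logback P l \<iota> j (Suc s) \<iota>) x\<bar> \<le> C * G ^ length J"
              unfolding G_def using IH reg J by blast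
            then have "\<bar>iter_partial J (y b) x\<bar> \<le> (1 + C) * G ^ length J"
              using lG[of J b] y_rules(2)[of J b] J \<open>Suc k \<le> q\<close>
              by (simp add: distrib_right logback_ref iter_partial_const)
            then show "pair_norm 1 (iter_partial J (y b) x) (iter_partial J (\<lambda>_. y b x) x) \<le> 2 * (1 + C) * G ^ length J"
              using J unfolding mult.assoc by (simp add: pair_norm_def iter_partial_const)
          qed
        qed (use G in \<open>auto simp: smooth_const\<close>)
        have osc: "\<bar>(iter_partial I (y b) x - iter_partial I (\<lambda>_. y b x) x) -
            (iter_partial I (y c) x - iter_partial I (\<lambda>_. y c x) x)\<bar> \<le> 2 * G ^ Suc k + C' * G ^ Suc k" for b c
          using lG[of I b] lG[of I c] Suc.IH[of "Suc s" b c, folded G_def] y_rules(2)[of I b] y_rules(2)[of I c] I len \<open>Suc k \<le> q\<close>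
          by (simp add: iter_partial_const)
        have zero: "\<forall>b. \<bar>iter_partial I (\<lambda>_. y b x) x\<bar> \<le> 0" using I by (simp add: iter_partial_const)
        have "\<bar>iter_partial I (logback P l \<iota> (Suc j) s a) x - iter_partial I (logback P l \<iota> (Suc j) s a') x\<bar>
            \<le> (1 - \<phi>) * (2 * G ^ Suc k + C' * G ^ Suc k) + A * 1 * (0 + G ^ Suc k)"
          using step[OF Pa[of s a] Pa[of s a'] y' I(1) len zero, of "2 * G ^ Suc k + C' * G ^ Suc k"] osc I len \<open>Suc k \<le> q\<close>
          by (simp add: y_rules(3) iter_partial_const del: logback.simps)
        also have "\<dots> = ((1 - \<phi>) * 2 + A + (1 - \<phi>) * C') * G ^ Suc k" by (simp add: algebra_simps)
        also have "\<dots> \<le> (C' * \<kappa> ^ Suc k) * G ^ Suc k"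
        proof (rule mult_right_mono)
          have "(1 - \<phi>) * 2 + A + (1 - \<phi>) * C' \<le> C' * r + (1 - \<phi>) * C'" using C'r \<phi> by simp
          also have "\<dots> = C' * \<kappa> ^ q" by (simp add: r_def algebra_simps)
          also have "\<dots> \<le> C' * \<kappa> ^ Suc k"
            using \<open>Suc k \<le> q\<close> \<kappa> C' by (intro mult_left_mono power_decreasing) auto
          finally show "(1 - \<phi>) * 2 + A + (1 - \<phi>) * C' \<le> C' * \<kappa> ^ Suc k" .
        qed (use G in auto)
        also have "\<dots> = C' * (g / \<kappa> ^ s) ^ length I" unfolding Gs len power_mult_distrib by simp
        finally show ?case .
      qed
    qed
  qed
qed

text \<open>
  The argument is the one for the bounds, applied to a pair of recursions at distance \<open>\<delta> = \<tau>\<^sup>j\<close>. The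
  difference of the highest derivatives is contracted, the difference of the Gibbs weights multiplies
  highest derivatives that are already known to be bounded, and the lower orders contribute at most
  a constant times \<open>\<delta> G\<^sup>k\<close>.
\<close>

lemma logback_deriv_step_bound:
  fixes \<phi> \<kappa> \<tau> :: real
  assumes \<phi>: "0 < \<phi>" "\<phi> < 1" and \<kappa>: "0 < \<kappa>" "\<kappa> \<le> 1" and \<tau>: "0 < \<tau>" "\<tau> \<le> 1"
    and contr: "1 - \<phi> < \<tau> * \<kappa> ^ q"
  shows "k \<le> q \<Longrightarrow> \<exists>D\<ge>1. \<forall>(P :: nat \<Rightarrow> 'h::finite \<Rightarrow> 'h \<Rightarrow> real) l \<iota> g x j s a a' (I :: 'p::{finite,linorder} list).
    regular_data \<phi> \<kappa> q P l g x \<longrightarrow> sorted I \<longrightarrow> length I \<le> k \<longrightarrow>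
    \<bar>(iter_partial I (logback P l \<iota> j s a) x - iter_partial I (logback P l \<iota> (Suc j) s a) x) -
     (iter_partial I (logback P l \<iota> j s a') x - iter_partial I (logback P l \<iota> (Suc j) s a') x)\<bar>
    \<le> D * \<tau> ^ j * (g / \<kappa> ^ s) ^ length I"
    (is "_ \<Longrightarrow> \<exists>D\<ge>1. ?bound k D")
proof (induction k)
  case 0
  have \<rho>: "1 - \<phi> \<le> \<tau>" using contr mult_left_le[of "\<kappa> ^ q" \<tau>] \<kappa> \<tau> power_le_one[of \<kappa> q] by linarith
  show ?case
  proof (rule exI[of _ "max 1 (- ln \<phi>)"], intro conjI allI impI)
    fix P :: "nat \<Rightarrow> 'h \<Rightarrow> 'h \<Rightarrow> real" and l :: "nat \<Rightarrow> 'h \<Rightarrow> (real, 'p) vec \<Rightarrow> real" and \<iota> g x j s a a' and I :: "'p list"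
    assume reg: "regular_data \<phi> \<kappa> q P l g x" and I: "length I \<le> 0"
    have "\<bar>(logback P l \<iota> j s a x - logback P l \<iota> (Suc j) s a x) - (logback P l \<iota> j s a' x - logback P l \<iota> (Suc j) s a' x)\<bar>
       \<le> - ln \<phi> * (1 - \<phi>) ^ j"
      by (rule logback_step_osc[OF \<phi>(1) regular_dataD(1)[OF reg]])
    also have "\<dots> \<le> max 1 (- ln \<phi>) * \<tau> ^ j"
      using \<rho> \<phi> \<tau> by (intro mult_mono power_mono) auto
    finally show "\<bar>(iter_partial I (logback P l \<iota> j s a) x - iter_partial I (logback P l \<iota> (Suc j) s a) x) -
     (iter_partial I (logback P l \<iota> j s a') x - iter_partial I (logback P l \<iota> (Suc j) s a') x)\<bar>
    \<le> max 1 (- ln \<phi>) * \<tau> ^ j * (g / \<kappa> ^ s) ^ length I"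
      using I by (simp del: logback.simps)
  qed simp
next
  case (Suc k)
  have "\<tau> * \<kappa> ^ q \<le> \<kappa> ^ q" using \<kappa> \<tau> by (simp add: mult_left_le_one_le)
  then have contr': "1 - \<phi> < \<kappa> ^ q" using contr by linarith
  from logback_deriv_bound[OF \<phi>(1) less_imp_le[OF \<phi>(2)] \<kappa> contr' Suc.prems, where ?'h = 'h and ?'p = 'p]
  obtain C where C: "C \<ge> 1" and Cb: "\<And>(P :: nat \<Rightarrow> 'h \<Rightarrow> 'h \<Rightarrow> real) l \<iota> g x j s a a' (I :: 'p list).
    \<lbrakk>regular_data \<phi> \<kappa> q P l g x; sorted I; I \<noteq> []; length I \<le> Suc k\<rbrakk> \<Longrightarrow>
    \<bar>iter_partial I (logback P l \<iota> j s a) x - iter_partial I (logback P l \<iota> j s a') x\<bar> \<le> C * (g / \<kappa> ^ s) ^ length I"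
    by blast
  from Suc obtain D where D: "D \<ge> 1" and IH: "?bound k D" by auto
  define B where "B = 1 + C + D"
  have B: "0 \<le> B" using C D by (simp add: B_def)
  from lse_deriv_diff_osc[OF B \<phi>(1), where ?'h = 'h and ?'p = 'p and k = k]
  obtain A where A: "A \<ge> 0" and step: "\<And>(p :: 'h \<Rightarrow> real) p' \<delta> G x y y' (I :: 'p list) T K.
     \<lbrakk>\<forall>b. \<phi> \<le> p b \<and> p b \<le> 1; \<forall>b. \<phi> \<le> p' b \<and> p' b \<le> 1;
     close_pair (Suc k) k UNIV \<delta> G B x y y'; sorted I; length I = Suc k;
     \<forall>b. \<bar>iter_partial I (y' b) x\<bar> \<le> T;
     \<forall>b c. \<bar>(iter_partial I (y b) x - iter_partial I (y' b) x) -
             (iter_partial I (y c) x - iter_partial I (y' c) x)\<bar> \<le> K\<rbrakk> \<Longrightarrow>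
     \<bar>(iter_partial I (\<lambda>x. lse p (\<lambda>b. y b x)) x - iter_partial I (\<lambda>x. lse p (\<lambda>b. y' b x)) x) -
      (iter_partial I (\<lambda>x. lse p' (\<lambda>b. y b x)) x - iter_partial I (\<lambda>x. lse p' (\<lambda>b. y' b x)) x)\<bar>
     \<le> (1 - \<phi>) * K + A * \<delta> * (T + G ^ Suc k)"
    by blast
  \<comment> \<open>The distance \<open>\<delta>\<close> may shrink by \<open>\<tau>\<close> in each step, so the gap is that between \<open>\<tau> \<kappa>\<^sup>q\<close> and the contraction.\<close>
  define r where "r = \<tau> * \<kappa> ^ q - (1 - \<phi>)"
  have r: "0 < r" using contr by (simp add: r_def)
  define E where "E = A * (B + 1)"
  define D' where "D' = max (max C D) (E / r)"
  have D': "1 \<le> D'" "C \<le> D'" "D \<le> D'" "E / r \<le> D'" using C by (auto simp: D'_def)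
  then have D'r: "E \<le> D' * r" using r by (simp add: divide_le_eq)
  show ?case
  proof (rule exI[of _ D'], intro conjI allI impI)
    show "1 \<le> D'" by (rule D')
    fix P :: "nat \<Rightarrow> 'h \<Rightarrow> 'h \<Rightarrow> real" and l :: "nat \<Rightarrow> 'h \<Rightarrow> (real, 'p) vec \<Rightarrow> real" and \<iota> g x j s a a' and I :: "'p list"
    assume reg: "regular_data \<phi> \<kappa> q P l g x" and I: "sorted I" "length I \<le> Suc k"
    note P = regular_dataD(1)[OF reg] and lb = regular_dataD(4)[OF reg]
      and G1 = regular_data_scale_ge_1[OF reg \<kappa>]
    have Pa: "\<forall>b. \<phi> \<le> P s a b \<and> P s a b \<le> 1" for s a using P by blast
    show "\<bar>(iter_partial I (logback P l \<iota> j s a) x - iter_partial I (logback P l \<iota> (Suc j) s a) x) -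
     (iter_partial I (logback P l \<iota> j s a') x - iter_partial I (logback P l \<iota> (Suc j) s a') x)\<bar>
    \<le> D' * \<tau> ^ j * (g / \<kappa> ^ s) ^ length I"
    proof (cases "length I \<le> k")
      case True
      have "\<bar>(iter_partial I (logback P l \<iota> j s a) x - iter_partial I (logback P l \<iota> (Suc j) s a) x) -
         (iter_partial I (logback P l \<iota> j s a') x - iter_partial I (logback P l \<iota> (Suc j) s a') x)\<bar>
        \<le> D * \<tau> ^ j * (g / \<kappa> ^ s) ^ length I"
        using IH reg I(1) True by blast
      also have "\<dots> \<le> D' * \<tau> ^ j * (g / \<kappa> ^ s) ^ length I"
        using D' G1[of s] \<tau> by (intro mult_right_mono) auto
      finally show ?thesis .
    next
      case False
      then have len: "length I = Suc k" using I by simp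
      then have I0: "I \<noteq> []" by auto
      show ?thesis
      proof (induction j arbitrary: s a a')
        case 0
        have "\<bar>iter_partial I (logback P l \<iota> (Suc 0) s a) x - iter_partial I (logback P l \<iota> (Suc 0) s a') x\<bar>
            \<le> C * (g / \<kappa> ^ s) ^ length I"
          by (rule Cb[OF reg I(1) I0]) (simp add: len)
        also have "\<dots> \<le> D' * (g / \<kappa> ^ s) ^ length I"
          using D' G1[of s] by (intro mult_right_mono) auto
        finally show ?case using I0 by (simp add: iter_partial_const abs_minus_commute del: logback.simps(2))
      next
        case (Suc j)
        define G where "G = g / \<kappa> ^ Suc s"
        have G: "1 \<le> G" unfolding G_def by (rule G1)
        have Gs: "g / \<kappa> ^ s = \<kappa> * G" using \<kappa> by (simp add: G_def)
        define \<delta> where "\<delta> = \<tau> ^ j"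
        have \<delta>: "0 < \<delta>" "\<delta> \<le> 1" using \<tau> by (auto simp: \<delta>_def power_le_one)
        define Y where "Y = (\<lambda>j. step_arg P l \<iota> j s)"
        have Y_rules: "smooth q UNIV (Y j b)"
          "sorted J \<Longrightarrow> length J \<le> q \<Longrightarrow> iter_partial J (Y j b) x =
            iter_partial J (l (Suc s) b) x + iter_partial J (logback P l \<iota> j (Suc s) b) x"
          "sorted J \<Longrightarrow> length J \<le> q \<Longrightarrow> iter_partial J (logback P l \<iota> (Suc j) s a) x =
            iter_partial J (\<lambda>x. lse (P s a) (\<lambda>b. Y j b x)) x - iter_partial J (\<lambda>x. lse (P s \<iota>) (\<lambda>b. Y j b x)) x" for j b J a
          unfolding Y_def by (rule iter_partial_step_arg[OF \<phi>(1) reg]; assumption)+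
        have yb: "\<bar>iter_partial J (Y j b) x\<bar> \<le> (1 + C) * G ^ length J"
          if J: "sorted J" "J \<noteq> []" "length J \<le> Suc k" for J b j
        proof -
          have "\<bar>iter_partial J (l (Suc s) b) x\<bar> \<le> G"
            using lb[of "Suc s" J b] J \<open>Suc k \<le> q\<close> by (simp add: G_def)
          also have "G \<le> G ^ length J" using G J by (intro self_le_power) auto
          finally show "\<bar>iter_partial J (Y j b) x\<bar> \<le> (1 + C) * G ^ length J"
            using Cb[OF reg J, of \<iota> j "Suc s" b \<iota>] Y_rules(2)[of J j b] J \<open>Suc k \<le> q\<close>
            by (simp add: distrib_right logback_ref iter_partial_const G_def del: logback.simps)
        qed
        have dd: "iter_partial J (Y j b) x - iter_partial J (Y (Suc j) b) x =
            iter_partial J (logback P l \<iota> j (Suc s) b) x - iter_partial J (logback P l \<iota> (Suc j) (Suc s) b) x"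
          if "sorted J" "length J \<le> q" for J b
          using Y_rules(2)[OF that, of j b] Y_rules(2)[OF that, of "Suc j" b] by simp
        have diff: "\<bar>iter_partial J (Y j b) x - iter_partial J (Y (Suc j) b) x\<bar> \<le> D * \<delta> * G ^ length J"
          if J: "sorted J" "length J \<le> k" for J b
          using IH[rule_format, OF reg J, of \<iota> j "Suc s" b \<iota>] dd[of J b] J \<open>Suc k \<le> q\<close>
          by (simp add: logback_ref \<delta>_def G_def del: logback.simps)
        have y': "close_pair (Suc k) k UNIV \<delta> G B x (Y j) (Y (Suc j))"
          unfolding close_pair_def
        proof (intro conjI allI \<delta>)
          fix b
          show "smooth (Suc k) UNIV (Y j b)" "smooth (Suc k) UNIV (Y (Suc j) b)"
            by (rule smooth_mono[OF Y_rules(1) \<open>Suc k \<le> q\<close> subset_refl])+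
          have "\<bar>Y j b x - Y (Suc j) b x\<bar> \<le> D * \<delta>" using diff[of "[]" b] by simp
          also have "\<dots> \<le> B * \<delta>" using \<delta> C by (intro mult_right_mono) (auto simp: B_def)
          finally show "\<bar>Y j b x - Y (Suc j) b x\<bar> \<le> B * \<delta>" .
          show "deriv_bound k UNIV \<delta> G B x (Y j b) (Y (Suc j) b)"
            unfolding deriv_bound_def
          proof (intro allI impI)
            fix J :: "'p list" assume J: "sorted J" "J \<noteq> []" "length J \<le> k"
            have "\<bar>iter_partial J (Y j b) x - iter_partial J (Y (Suc j) b) x\<bar> / \<delta> \<le> D * G ^ length J"
              using diff[OF J(1,3), of b] \<delta> by (simp add: divide_le_eq mult_ac)
            then show "pair_norm \<delta> (iter_partial J (Y j b) x) (iter_partial J (Y (Suc j) b) x) \<le> B * G ^ length J"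
              using yb[of J j b] J by (simp add: pair_norm_def B_def distrib_right)
          qed
        qed (use G in auto)
        have osc: "\<bar>(iter_partial I (Y j b) x - iter_partial I (Y (Suc j) b) x) -
            (iter_partial I (Y j c) x - iter_partial I (Y (Suc j) c) x)\<bar> \<le> D' * \<delta> * G ^ Suc k" for b c
          using Suc.IH[of "Suc s" b c] dd[of I b] dd[of I c] I len \<open>Suc k \<le> q\<close>
          by (simp add: G_def \<delta>_def del: logback.simps)
        have top: "\<bar>iter_partial I (Y (Suc j) b) x\<bar> \<le> B * G ^ Suc k" for b
        proof -
          have "\<bar>iter_partial I (Y (Suc j) b) x\<bar> \<le> (1 + C) * G ^ Suc k"
            using yb[of I "Suc j" b] I I0 len by simp
          also have "\<dots> \<le> B * G ^ Suc k" using D G by (intro mult_right_mono) (auto simp: B_def)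
          finally show ?thesis .
        qed
        have "\<bar>(iter_partial I (logback P l \<iota> (Suc j) s a) x - iter_partial I (logback P l \<iota> (Suc (Suc j)) s a) x) -
            (iter_partial I (logback P l \<iota> (Suc j) s a') x - iter_partial I (logback P l \<iota> (Suc (Suc j)) s a') x)\<bar>
            \<le> (1 - \<phi>) * (D' * \<delta> * G ^ Suc k) + A * \<delta> * (B * G ^ Suc k + G ^ Suc k)"
          using step[OF Pa[of s a] Pa[of s a'] y' I(1) len, of "B * G ^ Suc k" "D' * \<delta> * G ^ Suc k"] osc top I len \<open>Suc k \<le> q\<close>
          by (simp add: Y_rules(3) del: logback.simps)
        also have "\<dots> = ((1 - \<phi>) * D' + E) * (\<delta> * G ^ Suc k)" by (simp add: E_def algebra_simps)
        also have "\<dots> \<le> (D' * \<tau> * \<kappa> ^ Suc k) * (\<delta> * G ^ Suc k)"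
        proof (rule mult_right_mono)
          have "(1 - \<phi>) * D' + E \<le> D' * r + (1 - \<phi>) * D'" using D'r by simp
          also have "\<dots> = D' * \<tau> * \<kappa> ^ q" by (simp add: r_def algebra_simps)
          also have "\<dots> \<le> D' * \<tau> * \<kappa> ^ Suc k"
            using \<open>Suc k \<le> q\<close> \<kappa> D' \<tau> by (intro mult_left_mono power_decreasing) auto
          finally show "(1 - \<phi>) * D' + E \<le> D' * \<tau> * \<kappa> ^ Suc k" .
        qed (use G \<delta> in auto)
        also have "\<dots> = D' * \<tau> ^ Suc j * (g / \<kappa> ^ s) ^ length I"
          unfolding Gs len power_mult_distrib \<delta>_def by simp
        finally show ?case .
      qed
    qed
  qed
qed

section \<open>Likelihood ratios of a Markov chain in both directions of time\<close>

text \<open>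
  Transition probabilities away from time \<open>0\<close>; for \<open>u = -1\<close> they are those of the reversed chain.
\<close>

definition trans_prob :: "'w measure \<Rightarrow> (int \<Rightarrow> 'w \<Rightarrow> 'h) \<Rightarrow> int \<Rightarrow> nat \<Rightarrow> 'h \<Rightarrow> 'h \<Rightarrow> real" where
  "trans_prob M X u m a b = \<P>(\<omega> in M. X (u * int (Suc m)) \<omega> = b \<bar> X (u * int m) \<omega> = a)"

context prob_space
begin

text \<open>
  If the past has probability zero, both sides vanish.
\<close>

lemma markov_chain_step:
  fixes X :: "int \<Rightarrow> 'a \<Rightarrow> 'h::finite"
  assumes meas: "\<And>t. X t \<in> measurable M (count_space UNIV)" and markov: "markov_chain M X"
  shows "prob {\<omega>\<in>space M. \<forall>i\<le>Suc n. X (s + int i) \<omega> = x i} =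
     prob {\<omega>\<in>space M. \<forall>i\<le>n. X (s + int i) \<omega> = x i} *
     \<P>(\<omega> in M. X (s + int (Suc n)) \<omega> = x (Suc n) \<bar> X (s + int n) \<omega> = x n)"
proof -
  note [measurable] = meas
  let ?W = "{\<omega>\<in>space M. \<forall>i\<le>n. X (s + int i) \<omega> = x i}"
  let ?W' = "{\<omega>\<in>space M. \<forall>i\<le>Suc n. X (s + int i) \<omega> = x i}"
  have sub: "?W' \<subseteq> ?W" by auto
  show ?thesis
  proof (cases "prob ?W = 0")
    case True
    have "prob ?W' \<le> prob ?W" using sub by (intro finite_measure_mono) measurable
    then show ?thesis using True by (simp add: measure_le_0_iff)
  next
    case False
    define t where "t = s + int n"
    define y where "y r = x (nat (r - s))" for r
    have win: "(\<forall>r\<in>{t - int n..t}. X r \<omega> = y r) \<longleftrightarrow> (\<forall>i\<le>n. X (s + int i) \<omega> = x i)" for \<omega>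
    proof
      assume L: "\<forall>r\<in>{t - int n..t}. X r \<omega> = y r"
      show "\<forall>i\<le>n. X (s + int i) \<omega> = x i"
      proof (intro allI impI)
        fix i assume "i \<le> n"
        then show "X (s + int i) \<omega> = x i" using L[rule_format, of "s + int i"] by (simp add: t_def y_def)
      qed
    next
      assume R: "\<forall>i\<le>n. X (s + int i) \<omega> = x i"
      show "\<forall>r\<in>{t - int n..t}. X r \<omega> = y r"
      proof
        fix r assume "r \<in> {t - int n..t}"
        then show "X r \<omega> = y r" using R[rule_format, of "nat (r - s)"] by (auto simp: t_def y_def)
      qed
    qed
    have t1: "t + 1 = s + int (Suc n)" by (simp add: t_def)
    have "\<P>(\<omega> in M. X (t + 1) \<omega> = x (Suc n) \<bar> \<forall>r\<in>{t - int n..t}. X r \<omega> = y r) =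
        \<P>(\<omega> in M. X (t + 1) \<omega> = x (Suc n) \<bar> X t \<omega> = y t)"
      using markov[unfolded markov_chain_def, rule_format, of t n y "x (Suc n)"] False
        measure_nonneg[of M ?W] unfolding win by simp
    moreover have "\<P>(\<omega> in M. X (t + 1) \<omega> = x (Suc n) \<bar> \<forall>r\<in>{t - int n..t}. X r \<omega> = y r) = prob ?W' / prob ?W"
      unfolding cond_prob_def win t1
      by (intro arg_cong2[where f="(/)"] arg_cong[where f=prob]) (auto simp: le_Suc_eq)
    moreover have "y t = x n" by (simp add: y_def t_def)
    ultimately show ?thesis using False unfolding t1 by (simp add: t_def field_simps)
  qed
qed

lemma markov_chain_path:
  fixes X :: "int \<Rightarrow> 'a \<Rightarrow> 'h::finite"
  assumes meas: "\<And>t. X t \<in> measurable M (count_space UNIV)" and markov: "markov_chain M X"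
  shows "prob {\<omega>\<in>space M. \<forall>i\<le>n. X (s + int i) \<omega> = x i} =
     prob {\<omega>\<in>space M. X s \<omega> = x 0} *
     (\<Prod>i<n. \<P>(\<omega> in M. X (s + int (Suc i)) \<omega> = x (Suc i) \<bar> X (s + int i) \<omega> = x i))"
  by (induction n) (simp_all add: markov_chain_step[OF meas markov] del: of_nat_Suc)

text \<open>
  Against the direction of time, compare the path formula started at \<open>-(n+1)\<close> with the one started at
  \<open>-n\<close>: they share all factors except those for the two earliest times, and these are exchanged by
  writing the joint probability of two consecutive states in both ways.
\<close>

lemma markov_chain_step_directed:
  fixes X :: "int \<Rightarrow> 'a \<Rightarrow> 'h::finite"
  assumes meas: "\<And>t. X t \<in> measurable M (count_space UNIV)" and markov: "markov_chain M X"
    and pos: "\<And>t a. 0 < prob {\<omega>\<in>space M. X t \<omega> = a}" and u: "u \<in> {1, -1}"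
  shows "prob {\<omega>\<in>space M. \<forall>i\<le>Suc n. X (u * int i) \<omega> = x i} =
     prob {\<omega>\<in>space M. \<forall>i\<le>n. X (u * int i) \<omega> = x i} * trans_prob M X u n (x n) (x (Suc n))"
proof (cases "u = 1")
  case True
  then show ?thesis using markov_chain_step[OF meas markov, of n 0 x] by (simp add: trans_prob_def)
next
  case False
  then have u: "u = -1" using u by auto
  define s where "s = - int (Suc n)"
  let ?p = "\<lambda>i. \<P>(\<omega> in M. X (s + int (Suc i)) \<omega> = x (Suc n - Suc i) \<bar> X (s + int i) \<omega> = x (Suc n - i))"
  have rev: "(\<forall>i\<le>m. X (u * int i) \<omega> = x i) \<longleftrightarrow> (\<forall>i\<le>m. X (- int m + int i) \<omega> = x (m - i))" for m \<omega>
  proof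
    assume L: "\<forall>i\<le>m. X (u * int i) \<omega> = x i"
    show "\<forall>i\<le>m. X (- int m + int i) \<omega> = x (m - i)"
    proof (intro allI impI)
      fix i assume "i \<le> m"
      then show "X (- int m + int i) \<omega> = x (m - i)"
        using L[rule_format, of "m - i"] u by (simp add: of_nat_diff)
    qed
  next
    assume R: "\<forall>i\<le>m. X (- int m + int i) \<omega> = x (m - i)"
    show "\<forall>i\<le>m. X (u * int i) \<omega> = x i"
    proof (intro allI impI)
      fix i assume "i \<le> m"
      then show "X (u * int i) \<omega> = x i"
        using R[rule_format, of "m - i"] u by (simp add: of_nat_diff)
    qed
  qed
  have long: "prob {\<omega>\<in>space M. \<forall>i\<le>Suc n. X (u * int i) \<omega> = x i} =
      prob {\<omega>\<in>space M. X s \<omega> = x (Suc n)} * (\<Prod>i<Suc n. ?p i)"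
    unfolding rev using markov_chain_path[OF meas markov, of "Suc n" s "\<lambda>i. x (Suc n - i)"] by (simp add: s_def)
  have short: "prob {\<omega>\<in>space M. \<forall>i\<le>n. X (u * int i) \<omega> = x i} =
      prob {\<omega>\<in>space M. X (s + 1) \<omega> = x n} * (\<Prod>i<n. ?p (Suc i))"
    unfolding rev using markov_chain_path[OF meas markov, of n "s + 1" "\<lambda>i. x (n - i)"]
    by (simp add: s_def algebra_simps)
  have joint: "prob {\<omega>\<in>space M. X s \<omega> = x (Suc n)} * ?p 0 =
      prob {\<omega>\<in>space M. X (s + 1) \<omega> = x n} * trans_prob M X u n (x n) (x (Suc n))"
  proof -
    have "prob {\<omega>\<in>space M. X (s + 1) \<omega> = x n \<and> X s \<omega> = x (Suc n)} =
        prob {\<omega>\<in>space M. X s \<omega> = x (Suc n) \<and> X (s + 1) \<omega> = x n}"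
      by (intro arg_cong[where f=prob]) auto
    moreover have "s = u * int (Suc n)" "s + 1 = u * int n" using u by (auto simp: s_def)
    ultimately show ?thesis
      using pos[of s "x (Suc n)"] pos[of "s + 1" "x n"] unfolding trans_prob_def cond_prob_def
      by (simp del: of_nat_Suc add: of_nat_Suc[of 0])
  qed
  have "prob {\<omega>\<in>space M. \<forall>i\<le>Suc n. X (u * int i) \<omega> = x i} =
      (prob {\<omega>\<in>space M. X s \<omega> = x (Suc n)} * ?p 0) * (\<Prod>i<n. ?p (Suc i))"
    unfolding long by (simp add: prod.lessThan_Suc_shift del: prod.lessThan_Suc)
  then show ?thesis unfolding joint short by simp
qed

end

text \<open>
  The unnormalised backward variables of a hidden Markov model.
\<close>

primrec weighted_mass :: "(nat \<Rightarrow> 'h \<Rightarrow> 'h \<Rightarrow> real) \<Rightarrow> (nat \<Rightarrow> 'h \<Rightarrow> real) \<Rightarrow> nat \<Rightarrow> nat \<Rightarrow> 'h::finite \<Rightarrow> real" where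
  "weighted_mass P f 0 = (\<lambda>s a. 1)"
| "weighted_mass P f (Suc n) = (\<lambda>s a. \<Sum>b\<in>UNIV. P s a b * (f (Suc s) b * weighted_mass P f n (Suc s) b))"

text \<open>
  Summing over the state at time \<open>m + 1\<close> extends the prescribed path by one step.
\<close>

lemma (in prob_space) expectation_path_product:
  fixes X :: "int \<Rightarrow> 'a \<Rightarrow> 'h::finite"
  assumes meas: "\<And>t. X t \<in> measurable M (count_space UNIV)" and markov: "markov_chain M X"
    and pos: "\<And>t a. 0 < prob {\<omega>\<in>space M. X t \<omega> = a}" and u: "u \<in> {1, -1}"
  shows "(LINT \<omega>|M. indicator {\<omega>\<in>space M. \<forall>i\<le>m. X (u * int i) \<omega> = x i} \<omega> *
      (\<Prod>i<n. f (Suc m + i) (X (u * int (Suc m + i)) \<omega>))) =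
     prob {\<omega>\<in>space M. \<forall>i\<le>m. X (u * int i) \<omega> = x i} * weighted_mass (trans_prob M X u) f n m (x m)"
proof (induction n arbitrary: m x)
  case 0
  note [measurable] = meas
  have "{\<omega>\<in>space M. \<forall>i\<le>m. X (u * int i) \<omega> = x i} \<in> sets M" by measurable
  then have "(LINT \<omega>|M. indicator {\<omega>\<in>space M. \<forall>i\<le>m. X (u * int i) \<omega> = x i} \<omega>) =
      prob {\<omega>\<in>space M. \<forall>i\<le>m. X (u * int i) \<omega> = x i}"
    using sets.Int_space_eq2 by (simp add: Bochner_Integration.integral_indicator)
  then show ?case by (simp only: lessThan_0 prod.empty mult_1_right weighted_mass.simps)
next
  case (Suc n)
  note [measurable] = meas
  let ?A = "\<lambda>m x. {\<omega>\<in>space M. \<forall>i\<le>m. X (u * int i) \<omega> = x i}"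
  let ?F = "\<lambda>\<omega>. \<Prod>i<n. f (Suc (Suc m) + i) (X (u * int (Suc (Suc m) + i)) \<omega>)"
  have A[measurable]: "?A m x \<in> sets M" for m x by measurable
  have bnd: "\<exists>K. \<forall>\<omega>. \<bar>?F \<omega>\<bar> \<le> K"
  proof (rule exI[of _ "\<Prod>i<n. \<Sum>b\<in>UNIV. \<bar>f (Suc (Suc m) + i) b\<bar>"], intro allI)
    fix \<omega> show "\<bar>?F \<omega>\<bar> \<le> (\<Prod>i<n. \<Sum>b\<in>UNIV. \<bar>f (Suc (Suc m) + i) b\<bar>)"
      unfolding abs_prod
      by (intro prod_mono conjI member_le_sum[where f="\<lambda>b. \<bar>f _ b\<bar>"]) auto
  qed
  then obtain K where K: "\<And>\<omega>. \<bar>?F \<omega>\<bar> \<le> K" by blast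
  have F[measurable]: "?F \<in> borel_measurable M" by measurable
  have int: "integrable M (\<lambda>\<omega>. indicator (?A (Suc m) (x(Suc m := b))) \<omega> * ?F \<omega>)" for b
    using K order_trans[OF abs_ge_zero K]
    by (intro integrable_const_bound[where B=K]) (auto simp: indicator_def)
  have split: "indicator (?A m x) \<omega> * (\<Prod>i<Suc n. f (Suc m + i) (X (u * int (Suc m + i)) \<omega>)) =
      (\<Sum>b\<in>UNIV. f (Suc m) b * (indicator (?A (Suc m) (x(Suc m := b))) \<omega> * ?F \<omega>))" if "\<omega> \<in> space M" for \<omega>
  proof -
    have "indicator (?A (Suc m) (x(Suc m := b))) \<omega> =
        (if b = X (u * int (Suc m)) \<omega> then indicator (?A m x) \<omega> else (0::real))" for b
      using that by (auto simp: indicator_def le_Suc_eq simp del: of_nat_Suc)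
    then have "(\<Sum>b\<in>UNIV. f (Suc m) b * (indicator (?A (Suc m) (x(Suc m := b))) \<omega> * ?F \<omega>)) =
        (\<Sum>b\<in>UNIV. if b = X (u * int (Suc m)) \<omega> then f (Suc m) b * (indicator (?A m x) \<omega> * ?F \<omega>) else 0)"
      by (intro sum.cong) auto
    also have "\<dots> = f (Suc m) (X (u * int (Suc m)) \<omega>) * (indicator (?A m x) \<omega> * ?F \<omega>)" by simp
    finally show ?thesis
      by (simp add: prod.lessThan_Suc_shift mult_ac del: prod.lessThan_Suc of_nat_Suc)
  qed
  have "(LINT \<omega>|M. indicator (?A m x) \<omega> * (\<Prod>i<Suc n. f (Suc m + i) (X (u * int (Suc m + i)) \<omega>))) =
      (LINT \<omega>|M. (\<Sum>b\<in>UNIV. f (Suc m) b * (indicator (?A (Suc m) (x(Suc m := b))) \<omega> * ?F \<omega>)))"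
    by (intro Bochner_Integration.integral_cong split refl)
  also have "\<dots> = (\<Sum>b\<in>UNIV. f (Suc m) b * (LINT \<omega>|M. indicator (?A (Suc m) (x(Suc m := b))) \<omega> * ?F \<omega>))"
    using int by (subst Bochner_Integration.integral_sum) (auto intro!: integrable_mult_right simp del: integrable_mult_left_iff)
  also have "\<dots> = (\<Sum>b\<in>UNIV. f (Suc m) b * (prob (?A (Suc m) (x(Suc m := b))) * weighted_mass (trans_prob M X u) f n (Suc m) b))"
    using Suc.IH[of "Suc m" "x(Suc m := _)"] by simp
  also have "\<dots> = (\<Sum>b\<in>UNIV. f (Suc m) b * ((prob (?A m x) * trans_prob M X u m (x m) b) * weighted_mass (trans_prob M X u) f n (Suc m) b))"
  proof (intro sum.cong refl arg_cong2[where f="(*)"])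
    fix b
    have "(\<forall>i\<le>m. X (u * int i) \<omega> = (x(Suc m := b)) i) \<longleftrightarrow> (\<forall>i\<le>m. X (u * int i) \<omega> = x i)" for \<omega> by auto
    then show "prob (?A (Suc m) (x(Suc m := b))) = prob (?A m x) * trans_prob M X u m (x m) b"
      using markov_chain_step_directed[OF meas markov pos u, of m "x(Suc m := b)"] by simp
  qed
  finally show ?case by (simp add: sum_distrib_left mult_ac)
qed

lemma (in prob_space) cond_expect_path_product:
  fixes X :: "int \<Rightarrow> 'a \<Rightarrow> 'h::finite"
  assumes meas: "\<And>t. X t \<in> measurable M (count_space UNIV)" and markov: "markov_chain M X"
    and pos: "\<And>t a. 0 < prob {\<omega>\<in>space M. X t \<omega> = a}" and u: "u \<in> {1, -1}"
  shows "cond_expect M (\<lambda>\<omega>. \<Prod>s=1..n. f s (X (u * int s) \<omega>)) (\<lambda>\<omega>. X 0 \<omega> = a) =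
     weighted_mass (trans_prob M X u) f n 0 a"
proof -
  have "(\<Prod>s=1..n. f s (X (u * int s) \<omega>)) = (\<Prod>i<n. f (Suc 0 + i) (X (u * int (Suc 0 + i)) \<omega>))" for \<omega>
    using prod.atLeast1_atMost_eq[of "\<lambda>s. f s (X (u * int s) \<omega>)" n] by simp
  then show ?thesis
    using expectation_path_product[OF meas markov pos u, where m = 0 and x = "\<lambda>_. a" and n = n and f = f] pos[of 0 a]
    unfolding cond_expect_def set_lebesgue_integral_def by simp
qed

lemma weighted_mass_pos:
  assumes "\<forall>s a b. 0 < P s a b" "\<forall>s b. 0 < f s b"
  shows "0 < weighted_mass P f n s a"
  using assms by (induction n arbitrary: s a) (auto intro!: sum_pos)

text \<open>
  This links the recursion for logarithms to the conditional expectations in the likelihood ratios.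
\<close>

lemma logback_eq_ln_weighted_mass:
  assumes P: "\<forall>s a b. 0 < P s a b"
  shows "logback P l \<iota> n s a x =
    ln (weighted_mass P (\<lambda>s b. exp (l s b x)) n s a) - ln (weighted_mass P (\<lambda>s b. exp (l s b x)) n s \<iota>)"
proof (induction n arbitrary: s a)
  case (Suc n)
  let ?V = "weighted_mass P (\<lambda>s b. exp (l s b x))"
  have V: "0 < ?V n s a" for n s a using P by (intro weighted_mass_pos) auto
  have "lse (P s a) (\<lambda>b. l (Suc s) b x + logback P l \<iota> n (Suc s) b x) = ln (?V (Suc n) s a / ?V n (Suc s) \<iota>)" for a
    unfolding lse_def Suc.IH using V
    by (intro arg_cong[where f=ln]) (simp add: exp_add exp_diff sum_divide_distrib mult_ac)
  then show ?case using V[THEN less_imp_neq, symmetric] by (simp add: ln_div del: weighted_mass.simps)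
qed simp

lemma prob_eq_of_distr_eq:
  assumes X: "\<And>t. X t \<in> measurable M (count_space UNIV)" and Y: "\<And>t. Y t \<in> measurable M (count_space UNIV)"
    and eq: "distr M (PiM UNIV (\<lambda>_. count_space UNIV)) (\<lambda>\<omega> t. X t \<omega>) = distr M (PiM UNIV (\<lambda>_. count_space UNIV)) (\<lambda>\<omega> t. Y t \<omega>)"
    and Q[measurable]: "Measurable.pred (PiM UNIV (\<lambda>_. count_space UNIV)) Q"
  shows "measure M {\<omega>\<in>space M. Q (\<lambda>t. X t \<omega>)} = measure M {\<omega>\<in>space M. Q (\<lambda>t. Y t \<omega>)}"
proof -
  have XY: "(\<lambda>\<omega> t. X t \<omega>) \<in> measurable M (PiM UNIV (\<lambda>_. count_space UNIV))"
    "(\<lambda>\<omega> t. Y t \<omega>) \<in> measurable M (PiM UNIV (\<lambda>_. count_space UNIV))"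
    using X Y by (auto intro!: measurable_PiM_single' simp: space_PiM PiE_UNIV_domain)
  let ?B = "{h \<in> space (PiM UNIV (\<lambda>_. count_space UNIV)). Q h}"
  have B: "?B \<in> sets (PiM UNIV (\<lambda>_. count_space UNIV))" by measurable
  have "measure M {\<omega>\<in>space M. Q (\<lambda>t. X t \<omega>)} = measure (distr M (PiM UNIV (\<lambda>_. count_space UNIV)) (\<lambda>\<omega> t. X t \<omega>)) ?B"
    unfolding measure_distr[OF XY(1) B] by (intro arg_cong[where f="measure M"]) (auto simp: space_PiM PiE_UNIV_domain)
  also have "\<dots> = measure (distr M (PiM UNIV (\<lambda>_. count_space UNIV)) (\<lambda>\<omega> t. Y t \<omega>)) ?B" by (simp only: eq)
  also have "\<dots> = measure M {\<omega>\<in>space M. Q (\<lambda>t. Y t \<omega>)}"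
    unfolding measure_distr[OF XY(2) B] by (intro arg_cong[where f="measure M"]) (auto simp: space_PiM PiE_UNIV_domain)
  finally show ?thesis .
qed

text \<open>
  Both properties only involve probabilities of events about finitely many times, which are
  determined by the law of the process.
\<close>

lemma copy_markov_cond_prob:
  fixes X Y :: "int \<Rightarrow> 'w \<Rightarrow> 'h::finite"
  assumes X: "\<And>t. X t \<in> measurable M (count_space UNIV)" and Y: "\<And>t. Y t \<in> measurable M (count_space UNIV)"
    and eq: "distr M (PiM UNIV (\<lambda>_. count_space UNIV)) (\<lambda>\<omega> t. X t \<omega>) = distr M (PiM UNIV (\<lambda>_. count_space UNIV)) (\<lambda>\<omega> t. Y t \<omega>)"
  shows "markov_chain M X \<longleftrightarrow> markov_chain M Y"
    and "\<P>(\<omega> in M. X t \<omega> = b \<bar> X s \<omega> = a) = \<P>(\<omega> in M. Y t \<omega> = b \<bar> Y s \<omega> = a)"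
proof -
  note E = prob_eq_of_distr_eq[OF X Y eq]
  have 1: "measure M {\<omega>\<in>space M. \<forall>s\<in>{c..d}. X s \<omega> = x s} = measure M {\<omega>\<in>space M. \<forall>s\<in>{c..d}. Y s \<omega> = x s}" for c d and x :: "int \<Rightarrow> 'h"
    by (rule E) measurable
  have 2: "measure M {\<omega>\<in>space M. X t \<omega> = b \<and> (\<forall>s\<in>{c..d}. X s \<omega> = x s)} =
      measure M {\<omega>\<in>space M. Y t \<omega> = b \<and> (\<forall>s\<in>{c..d}. Y s \<omega> = x s)}" for c d t b and x :: "int \<Rightarrow> 'h"
    by (rule E) measurable
  have 3: "measure M {\<omega>\<in>space M. X t \<omega> = b \<and> X s \<omega> = a} = measure M {\<omega>\<in>space M. Y t \<omega> = b \<and> Y s \<omega> = a}" for t s a b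
    by (rule E) measurable
  have 4: "measure M {\<omega>\<in>space M. X s \<omega> = a} = measure M {\<omega>\<in>space M. Y s \<omega> = a}" for s a
    by (rule E) measurable
  show "markov_chain M X \<longleftrightarrow> markov_chain M Y"
    unfolding markov_chain_def cond_prob_def 1 2 3 4 ..
  show "\<P>(\<omega> in M. X t \<omega> = b \<bar> X s \<omega> = a) = \<P>(\<omega> in M. Y t \<omega> = b \<bar> Y s \<omega> = a)"
    unfolding cond_prob_def 3 4 ..
qed

section \<open>Derivatives of limits and of expectations\<close>

lemma geometric_cauchy_limit:
  fixes a :: "nat \<Rightarrow> real"
  assumes a: "\<And>n. \<bar>a n - a (Suc n)\<bar> \<le> K * \<tau> ^ n" and \<tau>: "0 \<le> \<tau>" "\<tau> < 1"
  shows "convergent a" and "\<bar>a n - lim a\<bar> \<le> K * \<tau> ^ n / (1 - \<tau>)"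
proof -
  have sm: "summable (\<lambda>n. K * \<tau> ^ n)" using \<tau> by (intro summable_mult summable_geometric) auto
  have sa: "summable (\<lambda>n. a (Suc n) - a n)"
    by (rule summable_comparison_test'[OF sm, of 0]) (use a in \<open>simp add: abs_minus_commute\<close>)
  then have lim: "a \<longlonglongrightarrow> a 0 + (\<Sum>n. a (Suc n) - a n)"
  proof -
    have "(\<lambda>n. a 0 + (\<Sum>i<n. a (Suc i) - a i)) \<longlonglongrightarrow> a 0 + (\<Sum>n. a (Suc n) - a n)"
      by (intro tendsto_add tendsto_const summable_LIMSEQ sa)
    then show ?thesis by (simp add: sum_lessThan_telescope)
  qed
  then show "convergent a" by (auto simp: convergent_def)
  then have L: "a \<longlonglongrightarrow> lim a" by (simp add: convergent_LIMSEQ_iff)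
  have part: "\<bar>a n - a (n + m)\<bar> \<le> K * \<tau> ^ n / (1 - \<tau>)" for m
  proof -
    have K: "0 \<le> K" using order_trans[OF abs_ge_zero a[of 0]] by simp
    have "\<bar>a n - a (n + m)\<bar> \<le> K * \<tau> ^ n * (\<Sum>i<m. \<tau> ^ i)"
    proof (induction m)
      case (Suc m)
      have "\<bar>a n - a (n + Suc m)\<bar> \<le> \<bar>a n - a (n + m)\<bar> + \<bar>a (n + m) - a (Suc (n + m))\<bar>" by simp
      also have "\<dots> \<le> K * \<tau> ^ n * (\<Sum>i<m. \<tau> ^ i) + K * \<tau> ^ (n + m)" using Suc a by (intro add_mono) auto
      finally show ?case by (simp add: power_add algebra_simps)
    qed simp
    also have "\<dots> \<le> K * \<tau> ^ n * (1 / (1 - \<tau>))"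
    proof (rule mult_left_mono)
      show "(\<Sum>i<m. \<tau> ^ i) \<le> 1 / (1 - \<tau>)"
        using sum_le_suminf[OF summable_geometric[of \<tau>], of "{..<m}"] suminf_geometric[of \<tau>] \<tau> by auto
    qed (use K \<tau> in auto)
    finally show ?thesis by simp
  qed
  have "(\<lambda>m. a (m + n)) \<longlonglongrightarrow> lim a" using L by (rule LIMSEQ_ignore_initial_segment)
  then have "(\<lambda>m. \<bar>a n - a (m + n)\<bar>) \<longlonglongrightarrow> \<bar>a n - lim a\<bar>" by (intro tendsto_intros)
  then show "\<bar>a n - lim a\<bar> \<le> K * \<tau> ^ n / (1 - \<tau>)"
    by (rule LIMSEQ_le_const2) (use part in \<open>auto simp: add.commute\<close>)
qed

lemma iter_partial_has_derivative_along:
  assumes "iter_partial_exists (i # I) g"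
  shows "((\<lambda>s. iter_partial I g (x + s *\<^sub>R axis i 1)) has_real_derivative
     iter_partial (i # I) g (x + t *\<^sub>R axis i 1)) (at t)"
proof -
  have "((\<lambda>s. iter_partial I g ((x + t *\<^sub>R axis i 1) + s *\<^sub>R axis i 1)) has_real_derivative
     iter_partial (i # I) g (x + t *\<^sub>R axis i 1)) (at 0)"
    using assms by (simp add: partial_deriv_has_derivative)
  moreover have "(x + t *\<^sub>R axis i 1) + s *\<^sub>R axis i 1 = x + (s + t) *\<^sub>R axis i 1" for s
    by (simp add: algebra_simps)
  ultimately show ?thesis
    using DERIV_shift[of "\<lambda>s. iter_partial I g (x + s *\<^sub>R axis i 1)" _ 0 t] by simp
qed

text \<open>
  The geometric Cauchy condition makes each order of derivatives converge uniformly on bounded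
  sets, so that limits and derivatives can be exchanged one coordinate at a time.
\<close>

lemma limit_iter_partial:
  fixes f :: "nat \<Rightarrow> (real, 'p::{finite,linorder}) vec \<Rightarrow> real"
  assumes sm: "\<And>n. smooth q UNIV (f n)" and \<tau>: "0 \<le> \<tau>" "\<tau> < 1"
    and cau: "\<And>r. \<exists>K. \<forall>n x I. norm x \<le> r \<longrightarrow> sorted I \<longrightarrow> length I \<le> q \<longrightarrow>
        \<bar>iter_partial I (f n) x - iter_partial I (f (Suc n)) x\<bar> \<le> K * \<tau> ^ n"
    and g: "\<And>x. (\<lambda>n. f n x) \<longlonglongrightarrow> g x"
  shows "sorted I \<Longrightarrow> length I \<le> q \<Longrightarrow>
    iter_partial_exists I g \<and> (\<forall>x. (\<lambda>n. iter_partial I (f n) x) \<longlonglongrightarrow> iter_partial I g x)"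
proof (induction I)
  case Nil
  then show ?case using g by simp
next
  case (Cons i I)
  then have IH: "iter_partial_exists I g" "\<And>x. (\<lambda>n. iter_partial I (f n) x) \<longlonglongrightarrow> iter_partial I g x" by auto
  have ex: "iter_partial_exists (i # I) (f n)" for n
    using smoothD[OF sm, of "i # I"] Cons.prems by auto
  define G where "G x = lim (\<lambda>n. iter_partial (i # I) (f n) x)" for x
  have D: "((\<lambda>t. iter_partial I g (x + t *\<^sub>R axis i 1)) has_real_derivative G x) (at 0) \<and>
      (\<lambda>n. iter_partial (i # I) (f n) x) \<longlonglongrightarrow> G x" for x
  proof -
    obtain K where K: "\<And>n y. norm y \<le> norm x + 1 \<Longrightarrow>
        \<bar>iter_partial (i # I) (f n) y - iter_partial (i # I) (f (Suc n)) y\<bar> \<le> K * \<tau> ^ n"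
      using cau[of "norm x + 1"] Cons.prems by blast
    have KG: "convergent (\<lambda>n. iter_partial (i # I) (f n) y)"
      "\<bar>iter_partial (i # I) (f n) y - G y\<bar> \<le> K * \<tau> ^ n / (1 - \<tau>)" if "norm y \<le> norm x + 1" for n y
      unfolding G_def by (rule geometric_cauchy_limit[OF K[OF that] \<tau>])+
    define S where "S = {-1<..<(1::real)}"
    have nS: "norm (x + t *\<^sub>R axis i 1) \<le> norm x + 1" if "t \<in> S" for t
      using norm_triangle_ineq[of x "t *\<^sub>R axis i 1"] that by (auto simp: S_def)
    have der: "((\<lambda>t. iter_partial I (f n) (x + t *\<^sub>R axis i 1)) has_derivative
        (\<lambda>h. iter_partial (i # I) (f n) (x + t *\<^sub>R axis i 1) * h)) (at t within S)" for n t
      using iter_partial_has_derivative_along[OF ex[of n]] unfolding has_field_derivative_def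
      by (rule has_derivative_at_withinI)
    have "\<exists>H. \<forall>t\<in>S. (\<lambda>n. iter_partial I (f n) (x + t *\<^sub>R axis i 1)) \<longlonglongrightarrow> H t \<and>
        (H has_derivative (\<lambda>h. G (x + t *\<^sub>R axis i 1) * h)) (at t within S)"
    proof (rule has_derivative_sequence)
      show "convex S" by (simp add: S_def convex_real_interval)
      show "0 \<in> S" by (simp add: S_def)
      show "(\<lambda>n. iter_partial I (f n) (x + 0 *\<^sub>R axis i 1)) \<longlonglongrightarrow> iter_partial I g x" using IH(2) by simp
      fix e :: real assume e: "0 < e"
      have "(\<lambda>n. K * \<tau> ^ n / (1 - \<tau>)) \<longlonglongrightarrow> K * 0 / (1 - \<tau>)"
        using \<tau> by (intro tendsto_intros) auto
      then have "\<forall>\<^sub>F n in sequentially. K * \<tau> ^ n / (1 - \<tau>) < e" using e by (simp add: order_tendsto_iff)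
      then show "\<forall>\<^sub>F n in sequentially. \<forall>t\<in>S. \<forall>h. norm (iter_partial (i # I) (f n) (x + t *\<^sub>R axis i 1) * h -
          G (x + t *\<^sub>R axis i 1) * h) \<le> e * norm h"
      proof eventually_elim
        case (elim n)
        show ?case
        proof (intro ballI allI)
          fix t h assume "t \<in> S"
          then have "\<bar>iter_partial (i # I) (f n) (x + t *\<^sub>R axis i 1) - G (x + t *\<^sub>R axis i 1)\<bar> \<le> e"
            using KG(2)[OF nS, of t n] elim by linarith
          then show "norm (iter_partial (i # I) (f n) (x + t *\<^sub>R axis i 1) * h -
              G (x + t *\<^sub>R axis i 1) * h) \<le> e * norm h"
            unfolding left_diff_distrib[symmetric] by (auto simp: abs_mult intro: mult_right_mono)
        qed
      qed
    qed (rule der)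
    then obtain H where H: "\<And>t. t \<in> S \<Longrightarrow> (\<lambda>n. iter_partial I (f n) (x + t *\<^sub>R axis i 1)) \<longlonglongrightarrow> H t"
      "\<And>t. t \<in> S \<Longrightarrow> (H has_derivative (\<lambda>h. G (x + t *\<^sub>R axis i 1) * h)) (at t within S)" by blast
    have Heq: "H t = iter_partial I g (x + t *\<^sub>R axis i 1)" if "t \<in> S" for t
      using LIMSEQ_unique[OF H(1)[OF that] IH(2)] .
    have S0: "0 \<in> S" "open S" by (auto simp: S_def)
    have "(H has_real_derivative G x) (at 0)"
      using H(2)[OF S0(1)] at_within_open[OF S0] by (simp add: has_field_derivative_def)
    then have "((\<lambda>t. iter_partial I g (x + t *\<^sub>R axis i 1)) has_real_derivative G x) (at 0)"
      by (rule has_field_derivative_transform_within_open[OF _ S0(2) S0(1)]) (rule Heq)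
    moreover have "(\<lambda>n. iter_partial (i # I) (f n) x) \<longlonglongrightarrow> G x"
      unfolding G_def using KG(1)[of x] by (simp add: convergent_LIMSEQ_iff)
    ultimately show ?thesis by blast
  qed
  have "partial_deriv_exists i (iter_partial I g) x" "partial_deriv i (iter_partial I g) x = G x" for x
    using partial_derivI D by blast+
  then show ?case using IH(1) D by auto
qed

lemma has_derivative_integral_dominated:
  fixes f f' :: "'w \<Rightarrow> real \<Rightarrow> real"
  assumes int: "\<And>t. \<bar>t\<bar> < 1 \<Longrightarrow> integrable N (\<lambda>\<omega>. f \<omega> t)" and meas: "(\<lambda>\<omega>. f' \<omega> 0) \<in> borel_measurable N"
    and der: "AE \<omega> in N. \<forall>t. (f \<omega> has_real_derivative f' \<omega> t) (at t)"
    and bound: "AE \<omega> in N. \<forall>t. \<bar>t\<bar> < 1 \<longrightarrow> \<bar>f' \<omega> t\<bar> \<le> D \<omega>" and D: "integrable N D"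
  shows "((\<lambda>t. LINT \<omega>|N. f \<omega> t) has_real_derivative (LINT \<omega>|N. f' \<omega> 0)) (at 0)"
proof -
  define S where "S = {-1<..<(1::real)}"
  have S0: "0 \<in> S" "open S" by (auto simp: S_def)
  have "((\<lambda>h. ((LINT \<omega>|N. f \<omega> h) - (LINT \<omega>|N. f \<omega> 0)) / h) \<longlongrightarrow> (LINT \<omega>|N. f' \<omega> 0)) (at 0 within S)"
    unfolding tendsto_at_iff_sequentially
  proof (intro allI impI)
    fix X :: "nat \<Rightarrow> real" assume X: "\<forall>i. X i \<in> S - {0}" "X \<longlonglongrightarrow> 0"
    have Xn: "\<bar>X n\<bar> < 1" "X n \<noteq> 0" for n using X(1)[rule_format, of n] by (auto simp: S_def)
    have "(\<lambda>n. LINT \<omega>|N. (f \<omega> (X n) - f \<omega> 0) / X n) \<longlonglongrightarrow> (LINT \<omega>|N. f' \<omega> 0)"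
    proof (rule integral_dominated_convergence[OF meas _ D])
      show "(\<lambda>\<omega>. (f \<omega> (X n) - f \<omega> 0) / X n) \<in> borel_measurable N" for n
        using int[OF Xn(1)[of n]] int[of 0] by (auto intro!: borel_measurable_divide borel_measurable_diff)
      show "AE \<omega> in N. (\<lambda>n. (f \<omega> (X n) - f \<omega> 0) / X n) \<longlonglongrightarrow> f' \<omega> 0"
        using der
      proof eventually_elim
        case (elim \<omega>)
        then have "((\<lambda>h. (f \<omega> h - f \<omega> 0) / h) \<longlongrightarrow> f' \<omega> 0) (at 0)"
          using elim[THEN spec, of 0] by (simp add: has_field_derivative_iff)
        moreover have "filterlim X (at 0) sequentially" using X Xn by (simp add: filterlim_at)
        ultimately show ?case using filterlim_compose by blast
      qed
      show "AE \<omega> in N. norm ((f \<omega> (X n) - f \<omega> 0) / X n) \<le> D \<omega>" for n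
        using der bound
      proof eventually_elim
        case (elim \<omega>)
        have "norm (f \<omega> (X n) - f \<omega> 0) \<le> D \<omega> * norm (X n - 0)"
        proof (rule field_differentiable_bound[of S])
          show "convex S" by (simp add: S_def convex_real_interval)
          show "X n \<in> S" using X(1) by blast
          show "(f \<omega> has_field_derivative f' \<omega> t) (at t within S)" for t
            using elim(1) has_field_derivative_at_within by blast
          show "norm (f' \<omega> t) \<le> D \<omega>" if "t \<in> S" for t using elim(2) that by (simp add: S_def abs_less_iff)
        qed (use S0 in auto)
        then show ?case using Xn[of n] by (simp add: divide_le_eq)
      qed
    qed
    then show "((\<lambda>h. ((LINT \<omega>|N. f \<omega> h) - (LINT \<omega>|N. f \<omega> 0)) / h) \<circ> X) \<longlonglongrightarrow> (LINT \<omega>|N. f' \<omega> 0)"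
      using int[OF Xn(1)] int[of 0] by (simp add: o_def)
  qed
  then show ?thesis using at_within_open[OF S0] by (simp add: has_field_derivative_iff)
qed

lemma iter_partial_integral:
  fixes U :: "'w \<Rightarrow> (real, 'p::{finite,linorder}) vec \<Rightarrow> real"
  assumes ex: "AE \<omega> in N. smooth q UNIV (U \<omega>)"
    and meas: "\<And>I x. sorted I \<Longrightarrow> length I \<le> q \<Longrightarrow> (\<lambda>\<omega>. iter_partial I (U \<omega>) x) \<in> borel_measurable N"
    and dom: "\<And>r. \<exists>D. integrable N D \<and>
       (AE \<omega> in N. \<forall>x I. norm x \<le> r \<longrightarrow> sorted I \<longrightarrow> length I \<le> q \<longrightarrow> \<bar>iter_partial I (U \<omega>) x\<bar> \<le> D \<omega>)"
  shows "sorted I \<Longrightarrow> length I \<le> q \<Longrightarrow> integrable N (\<lambda>\<omega>. iter_partial I (U \<omega>) x)"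
    and "sorted I \<Longrightarrow> length I \<le> q \<Longrightarrow> iter_partial_exists I (\<lambda>x. LINT \<omega>|N. U \<omega> x) \<and>
      iter_partial I (\<lambda>x. LINT \<omega>|N. U \<omega> x) = (\<lambda>x. LINT \<omega>|N. iter_partial I (U \<omega>) x)"
proof -
  show int: "integrable N (\<lambda>\<omega>. iter_partial I (U \<omega>) x)" if "sorted I" "length I \<le> q" for I x
  proof -
    obtain D where D: "integrable N D" and b:
      "AE \<omega> in N. \<forall>y I. norm y \<le> norm x \<longrightarrow> sorted I \<longrightarrow> length I \<le> q \<longrightarrow> \<bar>iter_partial I (U \<omega>) y\<bar> \<le> D \<omega>"
      using dom by blast
    show ?thesis
    proof (rule Bochner_Integration.integrable_bound[OF D meas[OF that]])
      show "AE \<omega> in N. norm (iter_partial I (U \<omega>) x) \<le> norm (D \<omega>)"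
        using b
      proof eventually_elim
        case (elim \<omega>)
        then have "\<bar>iter_partial I (U \<omega>) x\<bar> \<le> D \<omega>" using that by blast
        then show ?case by simp
      qed
    qed
  qed
  show "sorted I \<Longrightarrow> length I \<le> q \<Longrightarrow> iter_partial_exists I (\<lambda>x. LINT \<omega>|N. U \<omega> x) \<and>
      iter_partial I (\<lambda>x. LINT \<omega>|N. U \<omega> x) = (\<lambda>x. LINT \<omega>|N. iter_partial I (U \<omega>) x)"
  proof (induction I)
    case (Cons i I)
    then have IH: "iter_partial_exists I (\<lambda>x. LINT \<omega>|N. U \<omega> x)"
      "iter_partial I (\<lambda>x. LINT \<omega>|N. U \<omega> x) = (\<lambda>x. LINT \<omega>|N. iter_partial I (U \<omega>) x)" and I: "sorted I" "length I \<le> q"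
      by auto
    have D: "((\<lambda>t. LINT \<omega>|N. iter_partial I (U \<omega>) (x + t *\<^sub>R axis i 1)) has_real_derivative
        (LINT \<omega>|N. iter_partial (i # I) (U \<omega>) x)) (at 0)" for x
    proof -
      obtain D where D: "integrable N D" and b:
        "AE \<omega> in N. \<forall>y I. norm y \<le> norm x + 1 \<longrightarrow> sorted I \<longrightarrow> length I \<le> q \<longrightarrow> \<bar>iter_partial I (U \<omega>) y\<bar> \<le> D \<omega>"
        using dom by blast
      have "((\<lambda>t. LINT \<omega>|N. iter_partial I (U \<omega>) (x + t *\<^sub>R axis i 1)) has_real_derivative
        (LINT \<omega>|N. iter_partial (i # I) (U \<omega>) (x + 0 *\<^sub>R axis i 1))) (at 0)"
      proof (rule has_derivative_integral_dominated[where D = D and f' = "\<lambda>\<omega> t. iter_partial (i # I) (U \<omega>) (x + t *\<^sub>R axis i 1)"])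
        show "integrable N (\<lambda>\<omega>. iter_partial I (U \<omega>) (x + t *\<^sub>R axis i 1))" for t by (rule int[OF I])
        show "(\<lambda>\<omega>. iter_partial (i # I) (U \<omega>) (x + 0 *\<^sub>R axis i 1)) \<in> borel_measurable N"
          by (rule meas) (use Cons.prems in auto)
        show "AE \<omega> in N. \<forall>t. ((\<lambda>t. iter_partial I (U \<omega>) (x + t *\<^sub>R axis i 1)) has_real_derivative
            iter_partial (i # I) (U \<omega>) (x + t *\<^sub>R axis i 1)) (at t)"
          using ex
        proof eventually_elim
          case (elim \<omega>)
          have "iter_partial_exists (i # I) (U \<omega>)" using smoothD[OF elim] Cons.prems by blast
          then show ?case using iter_partial_has_derivative_along by blast
        qed
        show "AE \<omega> in N. \<forall>t. \<bar>t\<bar> < 1 \<longrightarrow> \<bar>iter_partial (i # I) (U \<omega>) (x + t *\<^sub>R axis i 1)\<bar> \<le> D \<omega>"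
          using b
        proof eventually_elim
          case (elim \<omega>)
          show ?case
          proof (intro allI impI)
            fix t :: real assume "\<bar>t\<bar> < 1"
            then have "norm (x + t *\<^sub>R axis i 1) \<le> norm x + 1"
              using norm_triangle_ineq[of x "t *\<^sub>R axis i 1"] by auto
            then show "\<bar>iter_partial (i # I) (U \<omega>) (x + t *\<^sub>R axis i 1)\<bar> \<le> D \<omega>"
              using elim Cons.prems by blast
          qed
        qed
      qed (rule D)
      then show ?thesis by simp
    qed
    show ?case using partial_derivI[OF D] IH by auto
  qed simp
qed

text \<open>
  A partial derivative is a limit of difference quotients along a fixed sequence.
\<close>

lemma measurable_iter_partial:
  fixes f :: "'w \<Rightarrow> (real, 'p::{finite,linorder}) vec \<Rightarrow> real"
  assumes meas: "\<And>x. (\<lambda>\<omega>. f \<omega> x) \<in> borel_measurable N"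
    and ex: "\<And>\<omega>. iter_partial_exists I (f \<omega>)"
  shows "(\<lambda>\<omega>. iter_partial I (f \<omega>) x) \<in> borel_measurable N"
  using ex
proof (induction I arbitrary: x)
  case (Cons i I)
  have m: "(\<lambda>\<omega>. iter_partial I (f \<omega>) x) \<in> borel_measurable N" for x using Cons by auto
  let ?X = "\<lambda>n::nat. 1 / real (Suc n)"
  have X: "filterlim ?X (at 0) sequentially"
    using LIMSEQ_Suc[OF lim_1_over_n] by (simp add: filterlim_at)
  show ?case
  proof (rule borel_measurable_LIMSEQ_real[where u = "\<lambda>n \<omega>. (iter_partial I (f \<omega>) (x + ?X n *\<^sub>R axis i 1) - iter_partial I (f \<omega>) x) / ?X n"])
    fix \<omega> assume "\<omega> \<in> space N"
    have "((\<lambda>t. iter_partial I (f \<omega>) (x + t *\<^sub>R axis i 1)) has_real_derivative iter_partial (i # I) (f \<omega>) x) (at 0)"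
      using Cons.prems[of \<omega>] by (simp add: partial_deriv_has_derivative)
    then have "((\<lambda>t. (iter_partial I (f \<omega>) (x + t *\<^sub>R axis i 1) - iter_partial I (f \<omega>) x) / t) \<longlongrightarrow>
        iter_partial (i # I) (f \<omega>) x) (at 0)" by (simp add: has_field_derivative_iff)
    from filterlim_compose[OF this X]
    show "(\<lambda>n. (iter_partial I (f \<omega>) (x + ?X n *\<^sub>R axis i 1) - iter_partial I (f \<omega>) x) / ?X n)
        \<longlonglongrightarrow> iter_partial (i # I) (f \<omega>) x" .
  next
    show "(\<lambda>\<omega>. (iter_partial I (f \<omega>) (x + ?X n *\<^sub>R axis i 1) - iter_partial I (f \<omega>) x) / ?X n) \<in> borel_measurable N" for n
      by (intro borel_measurable_divide borel_measurable_diff m borel_measurable_const)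
  qed
qed (simp add: meas)

lemma borel_measurable_completion_AE:
  fixes f g :: "'w \<Rightarrow> real"
  assumes f: "f \<in> borel_measurable (completion M)" and eq: "AE \<omega> in completion M. f \<omega> = g \<omega>"
  shows "g \<in> borel_measurable (completion M)"
proof (rule measurableI)
  fix B :: "real set" assume B: "B \<in> sets borel"
  show "g -` B \<inter> space (completion M) \<in> sets (completion M)"
  proof (rule completion.in_sets_AE)
    show "f -` B \<inter> space (completion M) \<in> sets (completion M)" using f B by (rule measurable_sets)
    show "AE x in completion M. (x \<in> f -` B \<inter> space (completion M)) = (x \<in> g -` B \<inter> space (completion M))"
      using eq by eventually_elim auto
  qed simp
qed simp

text \<open>
  The two estimates behind the exchange of limits: domination for the expectations and, through the
  factor \<open>\<tau>\<^sup>n\<close>, uniform convergence of the derivatives on the ball.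
\<close>

definition geometrically_dominated ::
  "'w measure \<Rightarrow> nat \<Rightarrow> real \<Rightarrow> ('w \<Rightarrow> nat \<Rightarrow> (real, 'p::{finite,linorder}) vec \<Rightarrow> real) \<Rightarrow> real \<Rightarrow> ('w \<Rightarrow> real) \<Rightarrow> bool" where
  "geometrically_dominated M q \<tau> f r D \<longleftrightarrow> integrable M D \<and>
     (AE \<omega> in M. \<forall>n x I. norm x \<le> r \<longrightarrow> sorted I \<longrightarrow> length I \<le> q \<longrightarrow>
       \<bar>iter_partial I (f \<omega> n) x\<bar> \<le> D \<omega> \<and>
       \<bar>iter_partial I (f \<omega> n) x - iter_partial I (f \<omega> (Suc n)) x\<bar> \<le> D \<omega> * \<tau> ^ n)"

text \<open>
  The derivatives of the limit exist only almost surely, hence the completion: there, measurability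
  of \<open>\<omega> \<mapsto> g\<^sup>(\<^sup>I\<^sup>)(\<omega>, x)\<close> follows from almost sure convergence.
\<close>

lemma limit_derivatives_expectation:
  fixes f :: "'w \<Rightarrow> nat \<Rightarrow> (real, 'p::{finite,linorder}) vec \<Rightarrow> real" and g :: "'w \<Rightarrow> (real, 'p::{finite,linorder}) vec \<Rightarrow> real"
  assumes meas: "\<And>n x. (\<lambda>\<omega>. f \<omega> n x) \<in> borel_measurable M"
    and sm: "\<And>\<omega> n. smooth q UNIV (f \<omega> n)" and \<tau>: "0 \<le> \<tau>" "\<tau> < 1"
    and dom: "\<And>r. \<exists>D. geometrically_dominated M q \<tau> f r D"
    and g: "\<And>\<omega> x. (\<lambda>n. f \<omega> n x) \<longlonglongrightarrow> g \<omega> x"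
  shows "AE \<omega> in M. smooth q UNIV (g \<omega>)"
    and "sorted I \<Longrightarrow> length I \<le> q \<Longrightarrow> integrable (completion M) (\<lambda>\<omega>. iter_partial I (g \<omega>) x)"
    and "sorted I \<Longrightarrow> length I \<le> q \<Longrightarrow> integrable (completion M) (\<lambda>\<omega>. iter_partial I (f \<omega> n) x)"
    and "sorted I \<Longrightarrow> length I \<le> q \<Longrightarrow> (\<lambda>n. LINT \<omega>|completion M. iter_partial I (f \<omega> n) x) \<longlonglongrightarrow>
      (LINT \<omega>|completion M. iter_partial I (g \<omega>) x)"
    and "sorted I \<Longrightarrow> length I \<le> q \<Longrightarrow> iter_partial_exists I (\<lambda>x. LINT \<omega>|completion M. g \<omega> x) \<and>
      iter_partial I (\<lambda>x. LINT \<omega>|completion M. g \<omega> x) = (\<lambda>x. LINT \<omega>|completion M. iter_partial I (g \<omega>) x)"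
proof -
  from dom have "\<forall>r. \<exists>D. geometrically_dominated M q \<tau> f r D" by blast
  from choice[OF this] obtain D where gd: "\<And>r. geometrically_dominated M q \<tau> f r (D r)" by blast
  have D: "integrable M (D r)" for r using gd unfolding geometrically_dominated_def by blast
  have Db: "AE \<omega> in M. \<forall>n x I. norm x \<le> r \<longrightarrow> sorted I \<longrightarrow> length I \<le> q \<longrightarrow>
          \<bar>iter_partial I (f \<omega> n) x\<bar> \<le> D r \<omega> \<and>
          \<bar>iter_partial I (f \<omega> n) x - iter_partial I (f \<omega> (Suc n)) x\<bar> \<le> D r \<omega> * \<tau> ^ n" for r
    using gd unfolding geometrically_dominated_def by blast
  let ?N = "completion M"
  have "AE \<omega> in M. \<forall>r::nat. \<forall>n x I. norm x \<le> real r \<longrightarrow> sorted I \<longrightarrow> length I \<le> q \<longrightarrow>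
          \<bar>iter_partial I (f \<omega> n) x\<bar> \<le> D (real r) \<omega> \<and>
          \<bar>iter_partial I (f \<omega> n) x - iter_partial I (f \<omega> (Suc n)) x\<bar> \<le> D (real r) \<omega> * \<tau> ^ n"
    by (rule AE_all_countable[THEN iffD2]) (use Db in blast)
  then have lim: "AE \<omega> in M. smooth q UNIV (g \<omega>) \<and>
      (\<forall>x I. sorted I \<longrightarrow> length I \<le> q \<longrightarrow> (\<lambda>n. iter_partial I (f \<omega> n) x) \<longlonglongrightarrow> iter_partial I (g \<omega>) x)"
  proof eventually_elim
    case (elim \<omega>)
    have "\<exists>K. \<forall>n x I. norm x \<le> r \<longrightarrow> sorted I \<longrightarrow> length I \<le> q \<longrightarrow>
        \<bar>iter_partial I (f \<omega> n) x - iter_partial I (f \<omega> (Suc n)) x\<bar> \<le> K * \<tau> ^ n" for r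
    proof -
      obtain m :: nat where "r \<le> real m" using real_arch_simple by blast
      then show ?thesis using elim[rule_format, of _ m] by (meson order_trans)
    qed
    note L = limit_iter_partial[where f = "f \<omega>" and g = "g \<omega>", OF sm \<tau> this g]
    show ?case unfolding smooth_def using L by blast
  qed
  then show "AE \<omega> in M. smooth q UNIV (g \<omega>)" by eventually_elim blast
  have limN: "AE \<omega> in ?N. (\<lambda>n. iter_partial I (f \<omega> n) x) \<longlonglongrightarrow> iter_partial I (g \<omega>) x"
    if "sorted I" "length I \<le> q" for I x
    using AE_completion[OF lim] that by (auto elim: eventually_mono)
  have fm: "(\<lambda>\<omega>. iter_partial I (f \<omega> n) x) \<in> borel_measurable ?N" if "sorted I" "length I \<le> q" for I n x
    by (intro measurable_completion measurable_iter_partial meas smoothD[OF sm]) (use that in auto)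
  have gm: "(\<lambda>\<omega>. iter_partial I (g \<omega>) x) \<in> borel_measurable ?N" if "sorted I" "length I \<le> q" for I x
  proof (rule borel_measurable_completion_AE)
    show "(\<lambda>\<omega>. lim (\<lambda>n. iter_partial I (f \<omega> n) x)) \<in> borel_measurable ?N"
      by (intro borel_measurable_lim_metric fm that)
    show "AE \<omega> in ?N. lim (\<lambda>n. iter_partial I (f \<omega> n) x) = iter_partial I (g \<omega>) x"
      using limN[OF that, of x] by eventually_elim (rule limI)
  qed
  have DN: "integrable ?N (D r)" for r
    using D[of r] by (simp add: integrable_completion borel_measurable_integrable)
  have fb: "AE \<omega> in ?N. norm (iter_partial I (f \<omega> n) x) \<le> D (norm x) \<omega>" if "sorted I" "length I \<le> q" for I n x
    using AE_completion[OF Db[of "norm x"]] that by (auto elim!: eventually_mono)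
  show "integrable ?N (\<lambda>\<omega>. iter_partial I (f \<omega> n) x)" if "sorted I" "length I \<le> q"
    by (rule Bochner_Integration.integrable_bound[OF DN[of "norm x"] fm[OF that]])
      (use fb[OF that, of n x] in \<open>auto elim!: eventually_mono\<close>)
  show "(\<lambda>n. LINT \<omega>|?N. iter_partial I (f \<omega> n) x) \<longlonglongrightarrow> (LINT \<omega>|?N. iter_partial I (g \<omega>) x)"
    if "sorted I" "length I \<le> q"
    by (rule integral_dominated_convergence[OF gm[OF that] fm[OF that] DN[of "norm x"] limN[OF that] fb[OF that]])
  have dom': "\<exists>D. integrable ?N D \<and>
     (AE \<omega> in ?N. \<forall>x I. norm x \<le> r \<longrightarrow> sorted I \<longrightarrow> length I \<le> q \<longrightarrow> \<bar>iter_partial I (g \<omega>) x\<bar> \<le> D \<omega>)" for r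
  proof (intro exI[of _ "D r"] conjI DN AE_completion)
    show "AE \<omega> in M. \<forall>x I. norm x \<le> r \<longrightarrow> sorted I \<longrightarrow> length I \<le> q \<longrightarrow> \<bar>iter_partial I (g \<omega>) x\<bar> \<le> D r \<omega>"
      using lim Db[of r]
    proof eventually_elim
      case (elim \<omega>)
      show ?case
      proof (intro allI impI)
        fix x :: "(real, 'p::{finite,linorder}) vec" and I :: "'p list" assume x: "norm x \<le> r" and I: "sorted I" "length I \<le> q"
        have "(\<lambda>n. \<bar>iter_partial I (f \<omega> n) x\<bar>) \<longlonglongrightarrow> \<bar>iter_partial I (g \<omega>) x\<bar>"
          using elim(1) I by (intro tendsto_rabs) blast
        then show "\<bar>iter_partial I (g \<omega>) x\<bar> \<le> D r \<omega>"
          by (rule LIMSEQ_le_const2) (use elim(2) x I in blast)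
      qed
    qed
  qed
  have smN: "AE \<omega> in ?N. smooth q UNIV (g \<omega>)"
    using AE_completion[OF lim] by eventually_elim blast
  show "integrable ?N (\<lambda>\<omega>. iter_partial I (g \<omega>) x)" if "sorted I" "length I \<le> q"
    by (rule iter_partial_integral(1)[OF smN gm dom' that])
  show "iter_partial_exists I (\<lambda>x. LINT \<omega>|?N. g \<omega> x) \<and>
      iter_partial I (\<lambda>x. LINT \<omega>|?N. g \<omega> x) = (\<lambda>x. LINT \<omega>|?N. iter_partial I (g \<omega>) x)" if "sorted I" "length I \<le> q"
    by (rule iter_partial_integral(2)[OF smN gm dom' that])
qed

section \<open>Integrable domination of the derivatives\<close>

text \<open>
  By continuity of the derivatives the supremum over the ball does not change when it is restricted
  to a countable dense subset, and there it is measurable. It is stated as an inequality because this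
  is what passes to integrals: that of a non-measurable function is a lower integral.
\<close>

lemma measurable_sup_derivatives:
  fixes l :: "'i::countable \<Rightarrow> 'z \<Rightarrow> (real, 'p::{finite,linorder}) vec \<Rightarrow> real"
  assumes sm: "\<And>c z. cont_smooth q UNIV (l c z)"
    and meas: "\<And>c x. (\<lambda>z. l c z x) \<in> borel_measurable N"
  obtains m :: "'z \<Rightarrow> ennreal" where "m \<in> borel_measurable N"
    and "\<And>z. m z \<le> Sup {ennreal \<bar>iter_partial I (l c z) x\<bar> | I c x. sorted I \<and> I \<noteq> [] \<and> length I \<le> q \<and> norm x \<le> r}"
    and "\<And>z I c x. sorted I \<Longrightarrow> I \<noteq> [] \<Longrightarrow> length I \<le> q \<Longrightarrow> norm x \<le> r \<Longrightarrow>
      ennreal \<bar>iter_partial I (l c z) x\<bar> \<le> m z"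
proof -
  obtain T where T: "countable T" "T \<subseteq> cball 0 r" "cball (0::(real, 'p::{finite,linorder}) vec) r \<subseteq> closure T"
    using separable[of "cball 0 r"] by blast
  define X where "X = {I :: 'p list. sorted I \<and> I \<noteq> [] \<and> length I \<le> q} \<times> (UNIV :: 'i set) \<times> T"
  define m where "m z = (SUP (I, c, x)\<in>X. ennreal \<bar>iter_partial I (l c z) x\<bar>)" for z
  have X: "countable X" unfolding X_def using T by (intro countable_SIGMA) auto
  have ex: "iter_partial_exists I (l c z)" if "sorted I" "length I \<le> q" for I c z
    using cont_smoothD(1)[OF sm] that by simp
  show thesis
  proof
    show "m \<in> borel_measurable N"
      unfolding m_def
    proof (intro borel_measurable_SUP X)
      fix p assume "p \<in> X"
      then obtain I c x where p: "p = (I, c, x)" and I: "sorted I" "length I \<le> q" by (auto simp: X_def)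
      have [measurable]: "(\<lambda>z. iter_partial I (l c z) x) \<in> borel_measurable N"
        by (intro measurable_iter_partial meas ex I)
      show "(\<lambda>z. case p of (I, c, x) \<Rightarrow> ennreal \<bar>iter_partial I (l c z) x\<bar>) \<in> borel_measurable N"
        unfolding p by simp
    qed
    show "m z \<le> Sup {ennreal \<bar>iter_partial I (l c z) x\<bar> | I c x. sorted I \<and> I \<noteq> [] \<and> length I \<le> q \<and> norm x \<le> r}" for z
      unfolding m_def
    proof (rule SUP_least)
      fix p assume "p \<in> X"
      then obtain I c x where p: "p = (I, c, x)" "sorted I" "I \<noteq> []" "length I \<le> q" "x \<in> T" by (auto simp: X_def)
      moreover have "norm x \<le> r" using p(5) T(2) by auto
      ultimately show "(case p of (I, c, x) \<Rightarrow> ennreal \<bar>iter_partial I (l c z) x\<bar>) \<le>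
          Sup {ennreal \<bar>iter_partial I (l c z) x\<bar> | I c x. sorted I \<and> I \<noteq> [] \<and> length I \<le> q \<and> norm x \<le> r}"
        by (auto intro!: Sup_upper)
    qed
    fix z and I :: "'p list" and c and x :: "(real, 'p::{finite,linorder}) vec" assume I: "sorted I" "I \<noteq> []" "length I \<le> q" and x: "norm x \<le> r"
    have "x \<in> closure T" using T(3) x by auto
    then obtain y where y: "\<And>n. y n \<in> T" "y \<longlonglongrightarrow> x" by (auto simp: closure_sequential)
    have "isCont (iter_partial I (l c z)) x"
      using cont_smoothD(2)[OF sm[of c z] I(1,3)] by (simp add: continuous_on_eq_continuous_at)
    then have "(\<lambda>n. iter_partial I (l c z) (y n)) \<longlonglongrightarrow> iter_partial I (l c z) x"
      using y(2) isCont_tendsto_compose by blast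
    then have "(\<lambda>n. ennreal \<bar>iter_partial I (l c z) (y n)\<bar>) \<longlonglongrightarrow> ennreal \<bar>iter_partial I (l c z) x\<bar>"
      by (intro tendsto_ennrealI tendsto_rabs)
    then show "ennreal \<bar>iter_partial I (l c z) x\<bar> \<le> m z"
    proof (rule LIMSEQ_le_const2)
      show "\<exists>N. \<forall>n\<ge>N. ennreal \<bar>iter_partial I (l c z) (y n)\<bar> \<le> m z"
      proof (intro exI allI impI)
        fix n
        have "(I, c, y n) \<in> X" using I y by (auto simp: X_def)
        then show "ennreal \<bar>iter_partial I (l c z) (y n)\<bar> \<le> m z"
          unfolding m_def by (rule SUP_upper2) simp
      qed
    qed
  qed
qed

text \<open>
  Each summand of \<open>\<Sum>\<^sub>t (\<kappa>\<^sup>t m(Z\<^sub>t))\<^sup>q\<close> is at most the sum, so the \<open>q\<close>-th root of the sum, increased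
  to \<open>1\<close> if necessary, serves as \<open>g\<close>. The expectation of the sum is a geometric series times a moment of \<open>m(Z\<^sub>0)\<close>.
\<close>

lemma (in prob_space) dominating_variable:
  fixes m :: "'z::topological_space \<Rightarrow> ennreal" and Z :: "int \<Rightarrow> 'a \<Rightarrow> 'z"
  assumes m[measurable]: "m \<in> borel_measurable borel" and Z[measurable]: "\<And>t. Z t \<in> borel_measurable M"
    and ident: "\<And>s t. distr M borel (Z s) = distr M borel (Z t)"
    and mom: "(\<integral>\<^sup>+\<omega>. m (Z 0 \<omega>) ^ k \<partial>M) < \<infinity>" and q: "1 \<le> q" "q \<le> k" and \<kappa>: "0 < \<kappa>" "\<kappa> < 1"
  obtains g :: "'a \<Rightarrow> real" where "\<And>\<omega>. 1 \<le> g \<omega>" "integrable M (\<lambda>\<omega>. g \<omega> ^ q)"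
    "AE \<omega> in M. \<forall>t\<ge>1. m (Z (u * int t) \<omega>) \<le> ennreal (g \<omega> / \<kappa> ^ t)"
proof -
  define Q where "Q \<omega> = (\<Sum>t. (ennreal (\<kappa> ^ t) * m (Z (u * int t) \<omega>)) ^ q)" for \<omega>
  have Qm[measurable]: "Q \<in> borel_measurable M" unfolding Q_def by measurable
  define K where "K = (\<integral>\<^sup>+\<omega>. m (Z 0 \<omega>) ^ q \<partial>M)"
  have "m z ^ q \<le> 1 + m z ^ k" for z
  proof (cases "m z \<le> 1")
    case True
    then have "m z ^ q \<le> 1 ^ q" by (intro power_mono) auto
    then show ?thesis by (simp add: add_increasing2)
  next
    case False
    then have "m z ^ q \<le> m z ^ k" using q by (intro power_increasing) auto
    then show ?thesis by (simp add: add_increasing)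
  qed
  then have "K \<le> (\<integral>\<^sup>+\<omega>. 1 + m (Z 0 \<omega>) ^ k \<partial>M)" unfolding K_def by (intro nn_integral_mono)
  also have "\<dots> = 1 + (\<integral>\<^sup>+\<omega>. m (Z 0 \<omega>) ^ k \<partial>M)" by (subst nn_integral_add) (auto simp: emeasure_space_1)
  also have "\<dots> < \<infinity>" using mom by (simp add: ennreal_add_eq_top less_top)
  finally have K: "K < \<infinity>" .
  have KZ: "(\<integral>\<^sup>+\<omega>. m (Z t \<omega>) ^ q \<partial>M) = K" for t
  proof -
    have "(\<integral>\<^sup>+\<omega>. m (Z t \<omega>) ^ q \<partial>M) = (\<integral>\<^sup>+z. m z ^ q \<partial>distr M borel (Z t))"
      by (subst nn_integral_distr) auto
    also have "\<dots> = (\<integral>\<^sup>+z. m z ^ q \<partial>distr M borel (Z 0))" by (simp only: ident[of t 0])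
    also have "\<dots> = K" unfolding K_def by (subst nn_integral_distr) auto
    finally show ?thesis .
  qed
  have "(\<integral>\<^sup>+\<omega>. Q \<omega> \<partial>M) = (\<Sum>t. \<integral>\<^sup>+\<omega>. (ennreal (\<kappa> ^ t) * m (Z (u * int t) \<omega>)) ^ q \<partial>M)"
    unfolding Q_def by (rule nn_integral_suminf) measurable
  also have "\<dots> = (\<Sum>t. K * ennreal ((\<kappa> ^ q) ^ t))"
  proof (intro suminf_cong)
    fix t
    have "(\<integral>\<^sup>+\<omega>. (ennreal (\<kappa> ^ t) * m (Z (u * int t) \<omega>)) ^ q \<partial>M) =
        (\<integral>\<^sup>+\<omega>. ennreal (\<kappa> ^ t) ^ q * m (Z (u * int t) \<omega>) ^ q \<partial>M)"
      by (simp add: power_mult_distrib)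
    also have "\<dots> = ennreal (\<kappa> ^ t) ^ q * K" by (subst nn_integral_cmult) (auto simp: KZ)
    also have "ennreal (\<kappa> ^ t) ^ q = ennreal ((\<kappa> ^ q) ^ t)"
      using \<kappa> by (simp add: ennreal_power power_mult[symmetric] mult.commute)
    finally show "(\<integral>\<^sup>+\<omega>. (ennreal (\<kappa> ^ t) * m (Z (u * int t) \<omega>)) ^ q \<partial>M) = K * ennreal ((\<kappa> ^ q) ^ t)"
      by (simp add: mult.commute)
  qed
  also have "\<dots> = K * (\<Sum>t. ennreal ((\<kappa> ^ q) ^ t))" by (rule ennreal_suminf_cmult)
  also have "(\<Sum>t. ennreal ((\<kappa> ^ q) ^ t)) = ennreal (\<Sum>t. (\<kappa> ^ q) ^ t)"
    using \<kappa> q power_Suc_less_one[of \<kappa> "q - 1"] by (intro suminf_ennreal2 summable_geometric) auto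
  finally have "(\<integral>\<^sup>+\<omega>. Q \<omega> \<partial>M) = K * ennreal (\<Sum>t. (\<kappa> ^ q) ^ t)" .
  then have Qint: "(\<integral>\<^sup>+\<omega>. Q \<omega> \<partial>M) < \<infinity>" using K by (simp add: ennreal_mult_less_top)
  then have Qfin: "AE \<omega> in M. Q \<omega> \<noteq> \<infinity>" by (intro nn_integral_noteq_infinite Qm) auto
  define g where "g \<omega> = root q (max 1 (enn2real (Q \<omega>)))" for \<omega>
  have gq: "g \<omega> ^ q = max 1 (enn2real (Q \<omega>))" for \<omega>
    using q unfolding g_def by (intro real_root_pow_pos2) auto
  show thesis
  proof
    show g1: "1 \<le> g \<omega>" for \<omega> using q unfolding g_def by simp
    have "integrable M (\<lambda>\<omega>. enn2real (Q \<omega>))"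
    proof (rule integrableI_bounded)
      have "(\<integral>\<^sup>+\<omega>. ennreal (norm (enn2real (Q \<omega>))) \<partial>M) \<le> (\<integral>\<^sup>+\<omega>. Q \<omega> \<partial>M)"
        by (intro nn_integral_mono) (simp add: ennreal_enn2real_if)
      then show "(\<integral>\<^sup>+\<omega>. ennreal (norm (enn2real (Q \<omega>))) \<partial>M) < \<infinity>" using Qint by (rule le_less_trans)
    qed simp
    then show "integrable M (\<lambda>\<omega>. g \<omega> ^ q)" unfolding gq by (intro integrable_max) auto
    show "AE \<omega> in M. \<forall>t\<ge>1. m (Z (u * int t) \<omega>) \<le> ennreal (g \<omega> / \<kappa> ^ t)"
      using Qfin
    proof eventually_elim
      case (elim \<omega>)
      show ?case
      proof (intro allI impI)
        fix t :: nat assume "t \<ge> 1"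
        let ?y = "m (Z (u * int t) \<omega>)"
        have "(ennreal (\<kappa> ^ t) * ?y) ^ q \<le> Q \<omega>"
        proof -
          let ?f = "\<lambda>t. (ennreal (\<kappa> ^ t) * m (Z (u * int t) \<omega>)) ^ q"
          have "sum ?f {t} \<le> suminf ?f" by (rule sum_le_suminf[OF summableI]) auto
          then show ?thesis by (simp add: Q_def)
        qed
        moreover have Qr: "Q \<omega> = ennreal (enn2real (Q \<omega>))" using elim by (simp add: less_top)
        ultimately have le: "(ennreal (\<kappa> ^ t) * ?y) ^ q \<le> ennreal (enn2real (Q \<omega>))" by simp
        have "?y \<noteq> \<infinity>"
        proof
          assume "?y = \<infinity>"
          then have "ennreal (\<kappa> ^ t) * ?y = \<infinity>" using \<kappa> by (simp add: ennreal_mult_top)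
          then have "(ennreal (\<kappa> ^ t) * ?y) ^ q = \<infinity>"
            using q by (simp add: power_eq_top_ennreal)
          then show False using le by (simp add: top_unique)
        qed
        then obtain r where r: "?y = ennreal r" "0 \<le> r" by (cases ?y) auto
        have "(\<kappa> ^ t * r) ^ q \<le> enn2real (Q \<omega>)"
          using le \<kappa> r by (simp add: ennreal_mult[symmetric] ennreal_power)
        also have "\<dots> \<le> g \<omega> ^ q" unfolding gq by simp
        finally have "\<kappa> ^ t * r \<le> g \<omega>"
          using g1[of \<omega>] power_le_imp_le_base[of "\<kappa> ^ t * r" "q - 1" "g \<omega>"] q by simp
        then have "r \<le> g \<omega> / \<kappa> ^ t" using \<kappa> by (simp add: field_simps)
        then show "?y \<le> ennreal (g \<omega> / \<kappa> ^ t)" unfolding r by (rule ennreal_leI)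
      qed
    qed
  qed
qed

lemma (in prob_space) logback_dominated:
  fixes ll :: "'h::finite \<Rightarrow> 'h \<Rightarrow> 'z::topological_space \<Rightarrow> (real, 'p::{finite,linorder}) vec \<Rightarrow> real"
    and Z :: "int \<Rightarrow> 'a \<Rightarrow> 'z" and P :: "nat \<Rightarrow> 'h \<Rightarrow> 'h \<Rightarrow> real"
  assumes \<phi>: "0 < \<phi>" "\<phi> < 1" and P: "\<forall>s a b. \<phi> \<le> P s a b \<and> P s a b \<le> 1"
    and \<kappa>: "0 < \<kappa>" "\<kappa> < 1" and \<tau>: "0 < \<tau>" "\<tau> \<le> 1" and contr: "1 - \<phi> < \<tau> * \<kappa> ^ q" and q: "1 \<le> q" "q \<le> k"
    and sm: "\<And>a b z. cont_smooth q UNIV (ll a b z)" and meas: "\<And>a b x. (\<lambda>z. ll a b z x) \<in> borel_measurable borel"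
    and Z: "\<And>t. Z t \<in> borel_measurable M" and ident: "\<And>s t. distr M borel (Z s) = distr M borel (Z t)"
    and mom: "(\<integral>\<^sup>+\<omega>. Sup {ennreal \<bar>iter_partial I (ll a b (Z 0 \<omega>)) x\<bar> | I a b x.
        sorted I \<and> I \<noteq> [] \<and> length I \<le> q \<and> norm x \<le> r} ^ k \<partial>M) < \<infinity>"
  shows "\<exists>D. geometrically_dominated M q \<tau>
    (\<lambda>\<omega> n. logback P (\<lambda>s b. ll (h (u * int s)) b (Z (u * int s) \<omega>)) \<iota> n 0 a) r D"
proof -
  have "\<tau> * \<kappa> ^ q \<le> \<kappa> ^ q" using \<kappa> \<tau> by (simp add: mult_left_le_one_le)
  then have contr': "1 - \<phi> < \<kappa> ^ q" using contr by linarith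
  from logback_deriv_bound[OF \<phi>(1) less_imp_le[OF \<phi>(2)] \<kappa>(1) less_imp_le[OF \<kappa>(2)] contr' order_refl, where ?'h = 'h and ?'p = 'p]
  obtain C where C: "C \<ge> 1" and Cb: "\<And>(P :: nat \<Rightarrow> 'h \<Rightarrow> 'h \<Rightarrow> real) l \<iota> g x j s a a' (I :: 'p list).
    \<lbrakk>regular_data \<phi> \<kappa> q P l g x; sorted I; I \<noteq> []; length I \<le> q\<rbrakk> \<Longrightarrow>
    \<bar>iter_partial I (logback P l \<iota> j s a) x - iter_partial I (logback P l \<iota> j s a') x\<bar> \<le> C * (g / \<kappa> ^ s) ^ length I"
    by blast
  from logback_deriv_step_bound[OF \<phi> \<kappa>(1) less_imp_le[OF \<kappa>(2)] \<tau> contr order_refl, where ?'h = 'h and ?'p = 'p]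
  obtain D where D: "D \<ge> 1" and Db: "\<And>(P :: nat \<Rightarrow> 'h \<Rightarrow> 'h \<Rightarrow> real) l \<iota> g x j s a a' (I :: 'p list).
    \<lbrakk>regular_data \<phi> \<kappa> q P l g x; sorted I; length I \<le> q\<rbrakk> \<Longrightarrow>
    \<bar>(iter_partial I (logback P l \<iota> j s a) x - iter_partial I (logback P l \<iota> (Suc j) s a) x) -
     (iter_partial I (logback P l \<iota> j s a') x - iter_partial I (logback P l \<iota> (Suc j) s a') x)\<bar>
    \<le> D * \<tau> ^ j * (g / \<kappa> ^ s) ^ length I"
    by blast
  obtain m :: "'z \<Rightarrow> ennreal" where m: "m \<in> borel_measurable borel"
    and m_le: "\<And>z. m z \<le> Sup {ennreal \<bar>iter_partial I (case c of (a, b) \<Rightarrow> ll a b z) x\<bar> | I c x.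
        sorted I \<and> I \<noteq> [] \<and> length I \<le> q \<and> norm x \<le> r}"
    and m_ge: "\<And>z I c x. sorted I \<Longrightarrow> I \<noteq> [] \<Longrightarrow> length I \<le> q \<Longrightarrow> norm x \<le> r \<Longrightarrow>
      ennreal \<bar>iter_partial I (case c of (a, b) \<Rightarrow> ll a b z) x\<bar> \<le> m z"
    by (rule measurable_sup_derivatives[where l = "\<lambda>c z. case c of (a, b) \<Rightarrow> ll a b z" and q = q and N = borel and r = r])
      (auto simp: sm meas split: prod.split)
  have "m z \<le> Sup {ennreal \<bar>iter_partial I (ll a b z) x\<bar> | I a b x.
        sorted I \<and> I \<noteq> [] \<and> length I \<le> q \<and> norm x \<le> r}" for z
    by (rule order_trans[OF m_le]) (auto intro!: Sup_subset_mono)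
  then have "(\<integral>\<^sup>+\<omega>. m (Z 0 \<omega>) ^ k \<partial>M) \<le> (\<integral>\<^sup>+\<omega>. Sup {ennreal \<bar>iter_partial I (ll a b (Z 0 \<omega>)) x\<bar> | I a b x.
        sorted I \<and> I \<noteq> [] \<and> length I \<le> q \<and> norm x \<le> r} ^ k \<partial>M)"
    by (intro nn_integral_mono power_mono) auto
  then have mom': "(\<integral>\<^sup>+\<omega>. m (Z 0 \<omega>) ^ k \<partial>M) < \<infinity>" using mom by (rule le_less_trans)
  obtain g :: "'a \<Rightarrow> real" where g1: "\<And>\<omega>. 1 \<le> g \<omega>" and gint: "integrable M (\<lambda>\<omega>. g \<omega> ^ q)"
    and gm: "AE \<omega> in M. \<forall>t\<ge>1. m (Z (u * int t) \<omega>) \<le> ennreal (g \<omega> / \<kappa> ^ t)"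
    using dominating_variable[where Z = Z and m = m and u = u, OF m Z ident mom' q \<kappa>] by blast
  define K where "K = C + D - ln \<phi>"
  have ln\<phi>: "0 \<le> - ln \<phi>" using \<phi> by simp
  have K: "C \<le> K" "D \<le> K" "- ln \<phi> \<le> K" using C D ln\<phi> by (auto simp: K_def)
  show ?thesis
    unfolding geometrically_dominated_def
  proof (intro exI[of _ "\<lambda>\<omega>. K * g \<omega> ^ q"] conjI)
    show "integrable M (\<lambda>\<omega>. K * g \<omega> ^ q)" using gint by simp
    show "AE \<omega> in M. \<forall>n x I. norm x \<le> r \<longrightarrow> sorted I \<longrightarrow> length I \<le> q \<longrightarrow>
          \<bar>iter_partial I (logback P (\<lambda>s b. ll (h (u * int s)) b (Z (u * int s) \<omega>)) \<iota> n 0 a) x\<bar> \<le> K * g \<omega> ^ q \<and>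
          \<bar>iter_partial I (logback P (\<lambda>s b. ll (h (u * int s)) b (Z (u * int s) \<omega>)) \<iota> n 0 a) x -
           iter_partial I (logback P (\<lambda>s b. ll (h (u * int s)) b (Z (u * int s) \<omega>)) \<iota> (Suc n) 0 a) x\<bar> \<le> K * g \<omega> ^ q * \<tau> ^ n"
      using gm
    proof eventually_elim
      case (elim \<omega>)
      let ?l = "\<lambda>s b. ll (h (u * int s)) b (Z (u * int s) \<omega>)"
      show ?case
      proof (intro allI impI)
        fix n and x :: "(real, 'p::{finite,linorder}) vec" and I :: "'p list"
        assume x: "norm x \<le> r" and I: "sorted I" "length I \<le> q"
        have gI: "g \<omega> ^ length I \<le> g \<omega> ^ q" using g1[of \<omega>] I by (intro power_increasing) auto
        have g0: "1 \<le> g \<omega> ^ q" using g1[of \<omega>] by simp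
        have reg: "regular_data \<phi> \<kappa> q P ?l (g \<omega>) x"
          unfolding regular_data_def
        proof (intro conjI P g1 allI impI)
          show "smooth q UNIV (?l s b)" for s b by (rule cont_smooth_imp_smooth[OF sm])
          fix s :: nat and b and J :: "'p list" assume s: "1 \<le> s" and J: "sorted J" "J \<noteq> []" "length J \<le> q"
          have "ennreal \<bar>iter_partial J (?l s b) x\<bar> \<le> m (Z (u * int s) \<omega>)"
            using m_ge[OF J x, of "Z (u * int s) \<omega>" "(h (u * int s), b)"] by simp
          also have "\<dots> \<le> ennreal (g \<omega> / \<kappa> ^ s)" using elim s by blast
          finally show "\<bar>iter_partial J (?l s b) x\<bar> \<le> g \<omega> / \<kappa> ^ s"
            using g1[of \<omega>] \<kappa> by (subst (asm) ennreal_le_iff) auto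
        qed
        have "\<bar>iter_partial I (logback P ?l \<iota> n 0 a) x\<bar> \<le> K * g \<omega> ^ q"
        proof (cases "I = []")
          case True
          then have "\<bar>iter_partial I (logback P ?l \<iota> n 0 a) x\<bar> \<le> - ln \<phi>"
            using logback_bound[OF \<phi>(1) _ P] \<phi> by simp
          also have "\<dots> \<le> K * 1" using K by simp
          also have "\<dots> \<le> K * g \<omega> ^ q" using g0 K ln\<phi> by (intro mult_left_mono) auto
          finally show ?thesis .
        next
          case False
          have "\<bar>iter_partial I (logback P ?l \<iota> n 0 a) x\<bar> \<le> C * g \<omega> ^ length I"
            using Cb[OF reg I(1) False I(2), of \<iota> n 0 a \<iota>] False by (simp add: logback_ref iter_partial_const)
          also have "\<dots> \<le> K * g \<omega> ^ q" using gI K C g1[of \<omega>] by (intro mult_mono) auto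
          finally show ?thesis .
        qed
        moreover have "\<bar>iter_partial I (logback P ?l \<iota> n 0 a) x - iter_partial I (logback P ?l \<iota> (Suc n) 0 a) x\<bar>
            \<le> K * g \<omega> ^ q * \<tau> ^ n"
        proof -
          have "\<bar>iter_partial I (logback P ?l \<iota> n 0 a) x - iter_partial I (logback P ?l \<iota> (Suc n) 0 a) x\<bar>
              \<le> D * \<tau> ^ n * g \<omega> ^ length I"
            using Db[OF reg I, of \<iota> n 0 a \<iota>] by (simp add: logback_ref iter_partial_const del: logback.simps)
          also have "\<dots> \<le> K * \<tau> ^ n * g \<omega> ^ q"
            using gI K D g1[of \<omega>] \<tau> by (intro mult_mono) auto
          finally show ?thesis by (simp add: mult_ac)
        qed
        ultimately show "\<bar>iter_partial I (logback P ?l \<iota> n 0 a) x\<bar> \<le> K * g \<omega> ^ q \<and>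
          \<bar>iter_partial I (logback P ?l \<iota> n 0 a) x - iter_partial I (logback P ?l \<iota> (Suc n) 0 a) x\<bar> \<le> K * g \<omega> ^ q * \<tau> ^ n"
          by blast
      qed
    qed
  qed
qed

section \<open>Logarithmic likelihood ratios and their expectations\<close>

lemma measurable_logback:
  assumes "\<And>s b. (\<lambda>\<omega>. l \<omega> s b x) \<in> borel_measurable M"
  shows "(\<lambda>\<omega>. logback P (l \<omega>) \<iota> n s a x) \<in> borel_measurable M"
  using assms by (induction n arbitrary: s a) (auto simp: lse_def)

text \<open>
  The two conditional expectations are weighted masses of paths, whose logarithms obey the recursion.
\<close>

lemma Lambda_eq_exp_logback:
  fixes \<sigma> :: "int \<Rightarrow> 'w \<Rightarrow> 'h::finite"
  assumes M: "prob_space M" and meas: "\<And>t. \<sigma> t \<in> measurable M (count_space UNIV)" and markov: "markov_chain M \<sigma>"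
    and pos: "\<And>t a. 0 < measure M {\<omega>\<in>space M. \<sigma> t \<omega> = a}" and u: "u \<in> {1, -1}"
    and P: "\<forall>s a b. 0 < trans_prob M \<sigma> u s a b"
    and lik: "\<And>z a b \<epsilon>. 0 < lik f \<phi> \<theta> z a b \<epsilon>"
  shows "Lambda M \<sigma> f \<phi> \<theta> \<iota> u h z n a \<epsilon> =
    exp (logback (trans_prob M \<sigma> u) (\<lambda>s b. loglik f \<phi> \<theta> (z (u * int s)) (h (u * int s)) b) \<iota> n 0 a \<epsilon>)"
proof -
  interpret prob_space M by (rule M)
  let ?l = "\<lambda>s b. loglik f \<phi> \<theta> (z (u * int s)) (h (u * int s)) b"
  let ?V = "weighted_mass (trans_prob M \<sigma> u) (\<lambda>s b. exp (?l s b \<epsilon>)) n 0"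
  have psi: "psi f \<phi> \<theta> h z (u * int s) \<epsilon> b = exp (?l s b \<epsilon>)" for s b
    using lik by (simp add: psi_def loglik_def)
  have V: "0 < ?V a" for a by (rule weighted_mass_pos) (use P in auto)
  have "cond_expect M (\<lambda>\<omega>. \<Prod>s=1..n. psi f \<phi> \<theta> h z (u * int s) \<epsilon> (\<sigma> (u * int s) \<omega>)) (\<lambda>\<omega>. \<sigma> 0 \<omega> = a) = ?V a" for a
    unfolding psi by (rule cond_expect_path_product[OF meas markov pos u])
  then have "Lambda M \<sigma> f \<phi> \<theta> \<iota> u h z n a \<epsilon> = ?V a / ?V \<iota>" by (simp add: Lambda_def)
  then show ?thesis using V by (simp add: logback_eq_ln_weighted_mass[OF P] exp_diff)
qed

theorem theorem2p4:
  fixes M :: "'w measure"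
    and \<eta> \<sigma> :: "int \<Rightarrow> 'w \<Rightarrow> 'h::finite"
    and H0 H1 :: "'h set"
    and Z :: "int \<Rightarrow> 'w \<Rightarrow> 'z::euclidean_space"
    and \<Theta> :: "(real^'d::finite) set"
    and \<phi> :: "'z \<Rightarrow> real^'d \<Rightarrow> 'x::euclidean_space"
    and f :: "'x \<Rightarrow> real^'d \<Rightarrow> ennreal"
    and \<theta> :: "'h \<Rightarrow> real^'p::{finite,linorder} \<Rightarrow> real^'d"
    and \<iota> :: 'h
    and q :: nat
  assumes "prob_space M"
    and H_partition: "H0 \<noteq> {}" "H1 \<noteq> {}" "H0 \<inter> H1 = {}" "H0 \<union> H1 = UNIV"
    and \<eta>_measurable: "\<And>t. \<eta> t \<in> measurable M (count_space UNIV)"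
    and Z_measurable: "\<And>t. Z t \<in> borel_measurable M"
    and "open \<Theta>"
    and \<theta>_in: "\<And>a \<epsilon>. \<theta> a \<epsilon> \<in> \<Theta>"
    and \<sigma>_measurable: "\<And>t. \<sigma> t \<in> measurable M (count_space UNIV)"
    and \<sigma>_copy:
      "distr M (PiM UNIV (\<lambda>_. count_space UNIV)) (\<lambda>\<omega> t. \<sigma> t \<omega>) =
       distr M (PiM UNIV (\<lambda>_. count_space UNIV)) (\<lambda>\<omega> t. \<eta> t \<omega>)"
    and \<sigma>_indep:
      "indep_rv M
         (PiM UNIV (\<lambda>_. count_space UNIV)) (\<lambda>\<omega> t. \<sigma> t \<omega>)
         (PiM UNIV (\<lambda>_. count_space UNIV) \<Otimes>\<^sub>M PiM UNIV (\<lambda>_. borel)) (\<lambda>\<omega>. (\<lambda>t. \<eta> t \<omega>, \<lambda>t. Z t \<omega>))"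
    and Z_indep_\<eta>:
      "indep_rv M
         (PiM UNIV (\<lambda>_. borel)) (\<lambda>\<omega> t. Z t \<omega>)
         (PiM UNIV (\<lambda>_. count_space UNIV)) (\<lambda>\<omega> t. \<eta> t \<omega>)"
    and Z_indep: "prob_space.indep_vars M (\<lambda>_. borel) Z UNIV"
    and Z_identical: "\<And>s t. distr M borel (Z s) = distr M borel (Z t)"
    and density: "\<And>\<xi> t. \<xi> \<in> \<Theta> \<Longrightarrow> distributed M lborel (\<lambda>\<omega>. \<phi> (Z t \<omega>) \<xi>) (\<lambda>x. f x \<xi>)"
    and markov: "markov_chain M \<eta>"
    and minorized:
      "\<exists>\<phi>s>0. \<forall>a b s t. \<bar>s - t\<bar> \<ge> 1 \<longrightarrow> \<P>(\<omega> in M. \<eta> t \<omega> = b \<bar> \<eta> s \<omega> = a) \<ge> \<phi>s"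
    and f_pos_finite: "\<And>z a b \<epsilon>. 0 < f (\<phi> z (\<theta> a \<epsilon>)) (\<theta> b \<epsilon>) \<and> f (\<phi> z (\<theta> a \<epsilon>)) (\<theta> b \<epsilon>) < \<infinity>"
    and f_cont: "\<And>z a b. continuous_on UNIV (\<lambda>\<epsilon>. f (\<phi> z (\<theta> a \<epsilon>)) (\<theta> b \<epsilon>))"
    and f_Cq: "\<And>z a b. class_C q (lik f \<phi> \<theta> z a b)"
    and f_deriv_cont:
      "\<And>a b \<nu>. mi_order \<nu> \<le> q \<Longrightarrow> continuous_on UNIV (\<lambda>(z, \<epsilon>). mderiv \<nu> (lik f \<phi> \<theta> z a b) \<epsilon>)"
    and moment:
      "\<And>r. r > 0 \<Longrightarrow> (\<integral>\<^sup>+\<omega>. deriv_sup f \<phi> \<theta> q (Z 0 \<omega>) r ^ (q\<^sup>2 * (q + 1) div 2) \<partial>M) < \<infinity>"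
  shows
    "\<forall>u\<in>{1, -1}.
       let \<Lambda> = Lambda M \<sigma> f \<phi> \<theta> \<iota> u; L = Lambda_lim M \<sigma> f \<phi> \<theta> \<iota> u in
       (AE \<omega> in M. \<forall>a \<epsilon>. convergent (\<lambda>n. \<Lambda> (\<lambda>t. \<eta> t \<omega>) (\<lambda>t. Z t \<omega>) n a \<epsilon>)) \<and>
       (\<exists>c C. 0 < c \<and> c < C \<and>
          (AE \<omega> in M. \<forall>\<^sub>F n in sequentially. \<forall>a \<epsilon>.
             c \<le> \<Lambda> (\<lambda>t. \<eta> t \<omega>) (\<lambda>t. Z t \<omega>) n a \<epsilon> \<and> \<Lambda> (\<lambda>t. \<eta> t \<omega>) (\<lambda>t. Z t \<omega>) n a \<epsilon> \<le> C)) \<and>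
       (AE \<omega> in M. let h = (\<lambda>t. \<eta> t \<omega>) in
          \<forall>a \<epsilon>.
            integrable_Z M Z (\<lambda>z. ln (L h z a \<epsilon>)) \<and>
            (\<forall>n\<ge>1. integrable_Z M Z (\<lambda>z. ln (\<Lambda> h z n a \<epsilon>))) \<and>
            (\<lambda>n. expect_Z M Z (\<lambda>z. ln (\<Lambda> h z n a \<epsilon>)))
              \<longlonglongrightarrow> expect_Z M Z (\<lambda>z. ln (L h z a \<epsilon>))) \<and>
       (AE \<omega> in M. let h = (\<lambda>t. \<eta> t \<omega>) in
          \<forall>\<nu> a. 1 \<le> mi_order \<nu> \<and> mi_order \<nu> \<le> q \<longrightarrow>
            mderiv_exists \<nu> (\<lambda>\<epsilon>. expect_Z M Z (\<lambda>z. ln (L h z a \<epsilon>))) \<and>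
            (AE \<omega>' in M. mderiv_exists \<nu> (\<lambda>\<epsilon>. ln (L h (\<lambda>t. Z t \<omega>') a \<epsilon>)) \<and>
               (\<forall>n\<ge>1. mderiv_exists \<nu> (\<lambda>\<epsilon>. ln (\<Lambda> h (\<lambda>t. Z t \<omega>') n a \<epsilon>)))) \<and>
            (\<forall>\<epsilon>.
               integrable_Z M Z (\<lambda>z. mderiv \<nu> (\<lambda>\<epsilon>. ln (L h z a \<epsilon>)) \<epsilon>) \<and>
               (\<forall>n\<ge>1. integrable_Z M Z (\<lambda>z. mderiv \<nu> (\<lambda>\<epsilon>. ln (\<Lambda> h z n a \<epsilon>)) \<epsilon>)) \<and>
               mderiv \<nu> (\<lambda>\<epsilon>. expect_Z M Z (\<lambda>z. ln (L h z a \<epsilon>))) \<epsilon> =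
                 expect_Z M Z (\<lambda>z. mderiv \<nu> (\<lambda>\<epsilon>. ln (L h z a \<epsilon>)) \<epsilon>) \<and>
               (\<lambda>n. expect_Z M Z (\<lambda>z. mderiv \<nu> (\<lambda>\<epsilon>. ln (\<Lambda> h z n a \<epsilon>)) \<epsilon>))
                 \<longlonglongrightarrow> expect_Z M Z (\<lambda>z. mderiv \<nu> (\<lambda>\<epsilon>. ln (L h z a \<epsilon>)) \<epsilon>)))"
  proof -
  interpret prob_space M by fact
  obtain \<phi>s where \<phi>s: "0 < \<phi>s" and min\<eta>: "\<And>a b s t. \<bar>s - t\<bar> \<ge> 1 \<Longrightarrow> \<P>(\<omega> in M. \<eta> t \<omega> = b \<bar> \<eta> s \<omega> = a) \<ge> \<phi>s"
    using minorized by blast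
  have copy: "markov_chain M \<sigma>" "\<And>a b s t. \<P>(\<omega> in M. \<sigma> t \<omega> = b \<bar> \<sigma> s \<omega> = a) = \<P>(\<omega> in M. \<eta> t \<omega> = b \<bar> \<eta> s \<omega> = a)"
    using copy_markov_cond_prob[OF \<sigma>_measurable \<eta>_measurable \<sigma>_copy] markov by auto
  have min\<sigma>: "\<bar>s - t\<bar> \<ge> 1 \<Longrightarrow> \<P>(\<omega> in M. \<sigma> t \<omega> = b \<bar> \<sigma> s \<omega> = a) \<ge> \<phi>s" for a b s t
    unfolding copy(2) by (rule min\<eta>)
  have pos: "0 < prob {\<omega>\<in>space M. \<sigma> t \<omega> = a}" for t a
  proof (rule ccontr)
    assume "\<not> 0 < prob {\<omega>\<in>space M. \<sigma> t \<omega> = a}"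
    \<comment> \<open>Conditioning on an event of probability zero gives the value \<open>0\<close> by convention, which the lower bound on transition probabilities excludes.\<close>
    then have "\<P>(\<omega> in M. \<sigma> (t + 1) \<omega> = a \<bar> \<sigma> t \<omega> = a) = 0"
      using measure_nonneg[of M "{\<omega>\<in>space M. \<sigma> t \<omega> = a}"] by (simp add: cond_prob_def)
    then show False using min\<sigma>[of t "t + 1" a a] \<phi>s by simp
  qed
  \<comment> \<open>The cap at \<open>1/2\<close> ensures \<open>\<phi>0 < 1\<close>, so that the two bounds \<open>\<phi>0\<close> and \<open>1 / \<phi>0\<close> are different.\<close>
  define \<phi>0 where "\<phi>0 = min \<phi>s (1 / 2)"
  have \<phi>0: "0 < \<phi>0" "\<phi>0 < 1" "\<phi>0 \<le> 1 / 2" using \<phi>s by (auto simp: \<phi>0_def)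
  have lik_pos: "0 < lik f \<phi> \<theta> z a b \<epsilon>" for z a b \<epsilon>
    using f_pos_finite[of z a \<epsilon> b] by (simp add: lik_def enn2real_positive_iff)
  have ll_smooth: "cont_smooth q UNIV (loglik f \<phi> \<theta> z a b)" for z a b
    using cont_smooth_ln[OF lik_pos f_Cq[unfolded class_C_iff]] unfolding loglik_def[abs_def] .
  have ll_meas: "(\<lambda>z. loglik f \<phi> \<theta> z a b \<epsilon>) \<in> borel_measurable borel" for a b \<epsilon>
  proof -
    have "mderiv (\<lambda>_. 0) g = g" for g :: "(real, 'p) vec \<Rightarrow> real"
      using length_mi_list[of "\<lambda>_::'p. 0"] by (simp add: mderiv_def mi_order_def)
    then have "continuous_on UNIV (\<lambda>(z, \<epsilon>). lik f \<phi> \<theta> z a b \<epsilon>)"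
      using f_deriv_cont[of "\<lambda>_. 0" a b] by (simp add: mi_order_def)
    moreover have "continuous_on UNIV (\<lambda>z::'z. (z, \<epsilon>))"
      by (intro continuous_on_Pair continuous_on_id continuous_on_const)
    ultimately have "continuous_on UNIV (\<lambda>z. lik f \<phi> \<theta> z a b \<epsilon>)"
      using continuous_on_compose2[of UNIV "\<lambda>(z, \<epsilon>). lik f \<phi> \<theta> z a b \<epsilon>" UNIV "\<lambda>z. (z, \<epsilon>)"] by auto
    then have "(\<lambda>z. lik f \<phi> \<theta> z a b \<epsilon>) \<in> borel_measurable borel" by (rule borel_measurable_continuous_onI)
    then show ?thesis unfolding loglik_def by simp
  qed
  have sup_le: "Sup {ennreal \<bar>iter_partial I (loglik f \<phi> \<theta> z a b) x\<bar> | I a b x. sorted I \<and> I \<noteq> [] \<and> length I \<le> q \<and> norm x \<le> r}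
      \<le> deriv_sup f \<phi> \<theta> q z r" for z r
  proof (rule Sup_least)
    fix y assume "y \<in> {ennreal \<bar>iter_partial I (loglik f \<phi> \<theta> z a b) x\<bar> | I a b x. sorted I \<and> I \<noteq> [] \<and> length I \<le> q \<and> norm x \<le> r}"
    then obtain I a b x where y: "y = ennreal \<bar>iter_partial I (loglik f \<phi> \<theta> z a b) x\<bar>"
      and I: "sorted I" "I \<noteq> []" "length I \<le> q" and x: "norm x \<le> r" by blast
    define \<nu> where "\<nu> = count (mset I)"
    have \<nu>: "mi_list \<nu> = I" unfolding \<nu>_def by (rule mi_list_count[OF I(1)])
    then have "y = ennreal \<bar>mderiv \<nu> (loglik f \<phi> \<theta> z a b) x\<bar>" "mi_order \<nu> = length I"
      using length_mi_list[of \<nu>] by (auto simp: y mderiv_def)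
    moreover have "q \<noteq> 0" "1 \<le> length I" using I by (cases I; simp)+
    ultimately have "y \<in> {ennreal \<bar>mderiv \<nu> (loglik f \<phi> \<theta> z a b) \<epsilon>\<bar> | \<nu> \<epsilon> a b.
        1 \<le> mi_order \<nu> \<and> mi_order \<nu> \<le> q \<and> norm \<epsilon> \<le> r}"
      using I x unfolding mem_Collect_eq
      by (intro exI[of _ \<nu>] exI[of _ x] exI[of _ a] exI[of _ b]) simp
    then show "y \<le> deriv_sup f \<phi> \<theta> q z r"
      using \<open>q \<noteq> 0\<close> by (simp add: deriv_sup_def Sup_upper)
  qed
  show ?thesis
  proof (intro ballI, goal_cases)
    case (1 u)
    note u = this
    define P where "P = trans_prob M \<sigma> u"
    have P: "\<forall>s a b. \<phi>0 \<le> P s a b \<and> P s a b \<le> 1"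
    proof (intro allI conjI)
      fix s a b
      have "1 \<le> \<bar>u * int s - u * int (Suc s)\<bar>" using u by auto
      then show "\<phi>0 \<le> P s a b" unfolding P_def trans_prob_def \<phi>0_def
        using min\<sigma>[of "u * int s" "u * int (Suc s)" b a] by (simp add: min_le_iff_disj)
      show "P s a b \<le> 1" unfolding P_def trans_prob_def cond_prob_def
        using pos[of "u * int s" a] \<sigma>_measurable
        by (subst divide_le_eq_1_pos) (auto intro!: finite_measure_mono simp del: of_nat_Suc)
    qed
    have P0: "\<forall>s a b. 0 < P s a b" using P \<phi>0 by (meson less_le_trans)
    define l where "l h z = (\<lambda>s b. loglik f \<phi> \<theta> (z (u * int s)) (h (u * int s)) b)" for h :: "int \<Rightarrow> 'h" and z :: "int \<Rightarrow> 'z"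
    define V where "V h z n a = logback P (l h z) \<iota> n 0 a" for h z n a
    define \<Lambda> where "\<Lambda> = Lambda M \<sigma> f \<phi> \<theta> \<iota> u"
    define L where "L = Lambda_lim M \<sigma> f \<phi> \<theta> \<iota> u"
    have \<Lambda>: "\<Lambda> h z n a \<epsilon> = exp (V h z n a \<epsilon>)" for h z n a \<epsilon>
      unfolding \<Lambda>_def V_def l_def P_def
      by (rule Lambda_eq_exp_logback[OF \<open>prob_space M\<close> \<sigma>_measurable copy(1) pos u P0[unfolded P_def] lik_pos])
    have V_bound: "\<bar>V h z n a \<epsilon>\<bar> \<le> - ln \<phi>0" for h z n a \<epsilon>
      unfolding V_def by (rule logback_bound[OF \<phi>0(1) _ P]) (use \<phi>0 in simp)
    have V_step: "\<bar>V h z n a \<epsilon> - V h z (Suc n) a \<epsilon>\<bar> \<le> - ln \<phi>0 * (1 - \<phi>0) ^ n" for h z n a \<epsilon>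
      using logback_step_osc[OF \<phi>0(1) P, of "l h z" \<iota> n 0 a \<epsilon> \<iota>] unfolding V_def
      by (simp add: logback_ref del: logback.simps)
    have V_conv: "convergent (\<lambda>n. V h z n a \<epsilon>)" for h z a \<epsilon>
      by (rule geometric_cauchy_limit(1)[OF V_step]) (use \<phi>0 in auto)
    have \<Lambda>_lim: "(\<lambda>n. \<Lambda> h z n a \<epsilon>) \<longlonglongrightarrow> exp (lim (\<lambda>n. V h z n a \<epsilon>))" for h z a \<epsilon>
      unfolding \<Lambda> using V_conv[of h z a \<epsilon>] by (intro tendsto_exp) (simp add: convergent_LIMSEQ_iff)
    have L: "L h z a \<epsilon> = exp (lim (\<lambda>n. V h z n a \<epsilon>))" for h z a \<epsilon>
      unfolding L_def Lambda_lim_def \<Lambda>_def[symmetric] by (rule limI[OF \<Lambda>_lim])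
    have V_lim: "(\<lambda>n. V h z n a \<epsilon>) \<longlonglongrightarrow> ln (L h z a \<epsilon>)" for h z a \<epsilon>
      unfolding L using V_conv[of h z a \<epsilon>] by (simp add: convergent_LIMSEQ_iff)
    have ln\<Lambda>: "ln (\<Lambda> h z n a \<epsilon>) = V h z n a \<epsilon>" for h z n a \<epsilon> by (simp add: \<Lambda>)
    have V_meas: "(\<lambda>\<omega>. V h (\<lambda>t. Z t \<omega>) n a \<epsilon>) \<in> borel_measurable M" for h n a \<epsilon>
      unfolding V_def l_def
      by (intro measurable_logback measurable_compose[OF Z_measurable ll_meas])
    have V_smooth: "smooth q UNIV (V h z n a)" for h z n a
      unfolding V_def l_def by (intro smooth_logback P0 allI cont_smooth_imp_smooth[OF ll_smooth])
    have part1: "convergent (\<lambda>n. \<Lambda> h z n a \<epsilon>)" for h z a \<epsilon>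
      using \<Lambda>_lim convergentI by blast
    have \<Lambda>_bounds: "\<phi>0 \<le> \<Lambda> h z n a \<epsilon>" "\<Lambda> h z n a \<epsilon> \<le> 1 / \<phi>0" for h z n a \<epsilon>
    proof -
      have "exp (ln \<phi>0) \<le> exp (V h z n a \<epsilon>)" "exp (V h z n a \<epsilon>) \<le> exp (- ln \<phi>0)"
        using V_bound[of h z n a \<epsilon>] by auto
      then show "\<phi>0 \<le> \<Lambda> h z n a \<epsilon>" "\<Lambda> h z n a \<epsilon> \<le> 1 / \<phi>0"
        unfolding \<Lambda> using \<phi>0 by (auto simp: exp_minus inverse_eq_divide)
    qed
    have part2: "\<exists>c C. 0 < c \<and> c < C \<and> (AE \<omega> in M. \<forall>\<^sub>F n in sequentially. \<forall>a \<epsilon>.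
             c \<le> \<Lambda> (\<lambda>t. \<eta> t \<omega>) (\<lambda>t. Z t \<omega>) n a \<epsilon> \<and> \<Lambda> (\<lambda>t. \<eta> t \<omega>) (\<lambda>t. Z t \<omega>) n a \<epsilon> \<le> C)"
    proof (rule exI[of _ \<phi>0], rule exI[of _ "1 / \<phi>0"], intro conjI)
      have "1 < 1 / \<phi>0" using \<phi>0 by simp
      then show "\<phi>0 < 1 / \<phi>0" using \<phi>0 by linarith
    qed (use \<phi>0 \<Lambda>_bounds in auto)
    have part3: "integrable_Z M Z (\<lambda>z. ln (L h z a \<epsilon>)) \<and>
        (\<forall>n\<ge>1. integrable_Z M Z (\<lambda>z. ln (\<Lambda> h z n a \<epsilon>))) \<and>
        (\<lambda>n. expect_Z M Z (\<lambda>z. ln (\<Lambda> h z n a \<epsilon>))) \<longlonglongrightarrow> expect_Z M Z (\<lambda>z. ln (L h z a \<epsilon>))" for h a \<epsilon>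
    proof -
      have dom: "\<exists>D. geometrically_dominated M 0 (1 - \<phi>0) (\<lambda>\<omega> n. V h (\<lambda>t. Z t \<omega>) n a) r D" for r
        unfolding geometrically_dominated_def by (rule exI[of _ "\<lambda>_. - ln \<phi>0"]) (use V_bound V_step in auto)
      note E = limit_derivatives_expectation[where f = "\<lambda>\<omega> n. V h (\<lambda>t. Z t \<omega>) n a" and g = "\<lambda>\<omega> \<epsilon>. ln (L h (\<lambda>t. Z t \<omega>) a \<epsilon>)"
          and q = 0 and \<tau> = "1 - \<phi>0", OF V_meas smooth_0 _ _ dom V_lim]
      show ?thesis unfolding integrable_Z_def expect_Z_def ln\<Lambda>
        using E(2-4)[where I = "[]" and x = \<epsilon>] \<phi>0 by simp
    qed
    have part4: "mderiv_exists \<nu> (\<lambda>\<epsilon>. expect_Z M Z (\<lambda>z. ln (L h z a \<epsilon>))) \<and>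
            (AE \<omega>' in M. mderiv_exists \<nu> (\<lambda>\<epsilon>. ln (L h (\<lambda>t. Z t \<omega>') a \<epsilon>)) \<and>
               (\<forall>n\<ge>1. mderiv_exists \<nu> (\<lambda>\<epsilon>. ln (\<Lambda> h (\<lambda>t. Z t \<omega>') n a \<epsilon>)))) \<and>
            (\<forall>\<epsilon>.
               integrable_Z M Z (\<lambda>z. mderiv \<nu> (\<lambda>\<epsilon>. ln (L h z a \<epsilon>)) \<epsilon>) \<and>
               (\<forall>n\<ge>1. integrable_Z M Z (\<lambda>z. mderiv \<nu> (\<lambda>\<epsilon>. ln (\<Lambda> h z n a \<epsilon>)) \<epsilon>)) \<and>
               mderiv \<nu> (\<lambda>\<epsilon>. expect_Z M Z (\<lambda>z. ln (L h z a \<epsilon>))) \<epsilon> =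
                 expect_Z M Z (\<lambda>z. mderiv \<nu> (\<lambda>\<epsilon>. ln (L h z a \<epsilon>)) \<epsilon>) \<and>
               (\<lambda>n. expect_Z M Z (\<lambda>z. mderiv \<nu> (\<lambda>\<epsilon>. ln (\<Lambda> h z n a \<epsilon>)) \<epsilon>))
                 \<longlonglongrightarrow> expect_Z M Z (\<lambda>z. mderiv \<nu> (\<lambda>\<epsilon>. ln (L h z a \<epsilon>)) \<epsilon>))"
      if \<nu>: "1 \<le> mi_order \<nu> \<and> mi_order \<nu> \<le> q" for h \<nu> a
    proof -
      have q: "1 \<le> q" using \<nu> by simp
      have "1 * 2 \<le> q * (q + 1)" using q by (intro mult_le_mono) auto
      from mult_le_mono2[OF this, of q] have "q * 2 \<le> q * (q * (q + 1))" by (simp only: mult_1)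
      from div_le_mono[OF this, of 2] have qk: "q \<le> q\<^sup>2 * (q + 1) div 2"
        by (simp only: power2_eq_square mult.assoc)
      \<comment> \<open>Both \<open>\<tau>\<close> and \<open>\<kappa>\<^sup>q\<close> are taken equal to \<open>\<beta>\<close>, whose square lies strictly between \<open>1 - \<phi>0\<close> and \<open>1\<close>.\<close>
      define \<beta> where "\<beta> = sqrt (1 - \<phi>0 / 2)"
      have \<beta>: "0 < \<beta>" "\<beta> < 1" "\<beta> * \<beta> = 1 - \<phi>0 / 2" using \<phi>0 by (auto simp: \<beta>_def)
      define \<kappa> where "\<kappa> = root q \<beta>"
      have \<kappa>: "0 < \<kappa>" "\<kappa> < 1" "\<kappa> ^ q = \<beta>" using q \<beta> by (auto simp: \<kappa>_def real_root_pow_pos)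
      have contr: "1 - \<phi>0 < \<beta> * \<kappa> ^ q" using \<beta> \<kappa> \<phi>0 by simp
      have dom: "\<exists>D. geometrically_dominated M q \<beta> (\<lambda>\<omega> n. V h (\<lambda>t. Z t \<omega>) n a) r D" for r
      proof -
        \<comment> \<open>The moments are only given for positive radii.\<close>
        define r' where "r' = max r 1"
        have "(\<integral>\<^sup>+\<omega>. Sup {ennreal \<bar>iter_partial I (loglik f \<phi> \<theta> (Z 0 \<omega>) a b) x\<bar> | I a b x.
           sorted I \<and> I \<noteq> [] \<and> length I \<le> q \<and> norm x \<le> r'} ^ (q\<^sup>2 * (q + 1) div 2) \<partial>M)
           \<le> (\<integral>\<^sup>+\<omega>. deriv_sup f \<phi> \<theta> q (Z 0 \<omega>) r' ^ (q\<^sup>2 * (q + 1) div 2) \<partial>M)"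
          by (intro nn_integral_mono power_mono sup_le) auto
        also have "\<dots> < \<infinity>" by (rule moment) (simp add: r'_def)
        finally have "\<exists>D. geometrically_dominated M q \<beta> (\<lambda>\<omega> n. V h (\<lambda>t. Z t \<omega>) n a) r' D"
          unfolding V_def l_def
          by (intro logback_dominated[where ll = "\<lambda>a b z. loglik f \<phi> \<theta> z a b", OF \<phi>0(1,2) P \<kappa>(1,2) \<beta>(1) _ contr q qk])
            (use \<beta> ll_smooth ll_meas Z_measurable Z_identical in auto)
        moreover have "norm x \<le> r \<Longrightarrow> norm x \<le> r'" for x :: "(real, 'p) vec" by (simp add: r'_def)
        ultimately show ?thesis unfolding geometrically_dominated_def by (auto elim!: eventually_mono)
      qed
      have I: "sorted (mi_list \<nu>)" "length (mi_list \<nu>) \<le> q" using \<nu> by (auto simp: sorted_mi_list length_mi_list)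
      note E = limit_derivatives_expectation[where f = "\<lambda>\<omega> n. V h (\<lambda>t. Z t \<omega>) n a" and g = "\<lambda>\<omega> \<epsilon>. ln (L h (\<lambda>t. Z t \<omega>) a \<epsilon>)"
          and q = q and \<tau> = \<beta>, OF V_meas V_smooth less_imp_le[OF \<beta>(1)] \<beta>(2) dom V_lim]
      have exists: "AE \<omega>' in M. mderiv_exists \<nu> (\<lambda>\<epsilon>. ln (L h (\<lambda>t. Z t \<omega>') a \<epsilon>)) \<and>
               (\<forall>n\<ge>1. mderiv_exists \<nu> (\<lambda>\<epsilon>. ln (\<Lambda> h (\<lambda>t. Z t \<omega>') n a \<epsilon>)))"
        using E(1)
      proof eventually_elim
        case (elim \<omega>')
        show ?case unfolding mderiv_exists_def ln\<Lambda>
          using smoothD[OF elim I] smoothD[OF V_smooth I] by simp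
      qed
      show ?thesis
        unfolding integrable_Z_def expect_Z_def ln\<Lambda> mderiv_def mderiv_exists_def
        by (intro conjI allI impI E(2-4)[OF I] E(5)[OF I, THEN conjunct1] fun_cong[OF E(5)[OF I, THEN conjunct2]]
            exists[unfolded ln\<Lambda> mderiv_exists_def])
    qed
    show ?case
      unfolding Let_def \<Lambda>_def[symmetric] L_def[symmetric]
      by (intro conjI part2; (rule AE_I2, intro allI impI)?; (rule part1 | rule part3 | erule part4))
  qed
qed

end
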